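(* Let $d\in\mathbb{N}$, fix an integer $0\le q<d$, and let $P$ be a stationary and ergodic probability measure on $\Omega=[0,1]^{\mathcal{K}^d}$ which is a product measure. Let $L_q^n=\int_0^1\beta_q^n(t)\,dt$. Then there exists a constant $\tau^2\ge0$ (depending on $d,q$) such that, as $n\to\infty$, $$\frac{1}{|\Lambda_n|}E\Big[\big(L_q^n-E[L_q^n]\big)^2\Big]\to\tau^2\quad\text{and}\quad\frac{1}{|\Lambda_n|^{1/2}}\big(L_q^n-E[L_q^n]\big)\Rightarrow\mathcal{N}(0,\tau^2),$$ where $\Rightarrow$ denotes convergence in law.
   Context: An elementary interval is $[l,l+1]$ or $[l]=[l,l]$ with $l\in\mathbb{Z}$; an elementary cube in $\mathbb{R}^d$ is a product of $d$ elementary intervals, of dimension equal to the number of nondegenerate factors; $\mathcal{K}^d$ is the set of all elementary cubes. A cubical set is a union of elementary cubes. For a cubical set $X$, $C_k(X)$ is the free $\mathbb{Z}$-module on the $k$-dimensional elementary cubes contained in $X$ with the standard cubical boundary operator; $H_k(X)$ is the resulting homology and, for bounded $X$, $\beta_k(X)$ is the rank of the free part of $H_k(X)$. $\Omega=[0,1]^{\mathcal{K}^d}$ with product topology and Borel $\sigma$-field, $\omega=(\omega_Q)_{Q\in\mathcal{K}^d}$; $\tau_x\omega=(\omega_{-x+Q})_Q$ for $x\in\mathbb{Z}^d$; stationarity: $P\circ\tau_x^{-1}=P$ for all $x$; ergodicity: translation-invariant events have probability $0$ or $1$; $E$ is expectation under $P$. $X(t)=\bigcup\{Q:\omega_Q\le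 t\}$, $\Lambda_n=[-n,n]^d$, $X^n(t)=X(t)\cap\Lambda_n$, $\beta_q^n(t)=\beta_q(X^n(t))$, $|\Lambda_n|=(2n)^d$. *)

theory Defs
  imports "HOL-Probability.Probability"
begin

(* An elementary cube in R^d: list of d elementary intervals; (l, True) = [l,l+1], (l, False) = [l]. *)
type_synonym cube = "(int \<times> bool) list"

definition cubes_all :: "nat \<Rightarrow> cube set" where
  "cubes_all d = {Q. length Q = d}"

definition cdim :: "cube \<Rightarrow> nat" where
  "cdim Q = card {i. i < length Q \<and> snd (Q ! i)}"

definition cube_set :: "cube \<Rightarrow> real list set" where
  "cube_set Q = {p. length p = length Q \<and>
     (\<forall>i<length Q. real_of_int (fst (Q ! i)) \<le> p ! i \<and>
        p ! i \<le> real_of_int (fst (Q ! i)) + (if snd (Q ! i) then 1 else 0))}"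

definition cubes_in :: "nat \<Rightarrow> nat \<Rightarrow> real list set \<Rightarrow> cube set" where
  "cubes_in d k S = {Q. length Q = d \<and> cdim Q = k \<and> cube_set Q \<subseteq> S}"

definition chains :: "nat \<Rightarrow> nat \<Rightarrow> real list set \<Rightarrow> (cube \<Rightarrow> int) set" where
  "chains d k S = {c. finite {Q. c Q \<noteq> 0} \<and> (\<forall>Q. c Q \<noteq> 0 \<longrightarrow> Q \<in> cubes_in d k S)}"

definition bd_cube :: "cube \<Rightarrow> cube \<Rightarrow> int" where
  "bd_cube Q P = (\<Sum>i\<in>{i. i < length Q \<and> snd (Q ! i)}.
      (-1) ^ card {j. j < i \<and> snd (Q ! j)} *
      ((if P = Q[i := (fst (Q ! i) + 1, False)] then 1 else 0)
       - (if P = Q[i := (fst (Q ! i), False)] then 1 else 0)))"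

definition bd :: "(cube \<Rightarrow> int) \<Rightarrow> cube \<Rightarrow> int" where
  "bd c P = (\<Sum>Q\<in>{Q. c Q \<noteq> 0}. c Q * bd_cube Q P)"

definition cycles :: "nat \<Rightarrow> nat \<Rightarrow> real list set \<Rightarrow> (cube \<Rightarrow> int) set" where
  "cycles d k S = {c \<in> chains d k S. bd c = (\<lambda>_. 0)}"

definition boundaries :: "nat \<Rightarrow> nat \<Rightarrow> real list set \<Rightarrow> (cube \<Rightarrow> int) set" where
  "boundaries d k S = bd ` chains d (Suc k) S"

definition lincomb :: "int list \<Rightarrow> (cube \<Rightarrow> int) list \<Rightarrow> cube \<Rightarrow> int" where
  "lincomb cs zs = (\<lambda>Q. \<Sum>i<length zs. cs ! i * (zs ! i) Q)"

(* beta_k(S): rank of the free part of H_k(S) = Z_k/B_k, i.e. the maximal number of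
   Z-linearly independent elements of the quotient group *)
definition betti :: "nat \<Rightarrow> nat \<Rightarrow> real list set \<Rightarrow> nat" where
  "betti d k S = Sup {length zs | zs. set zs \<subseteq> cycles d k S \<and>
      (\<forall>cs. length cs = length zs \<and> lincomb cs zs \<in> boundaries d k S \<longrightarrow> set cs \<subseteq> {0})}"

definition Xt :: "nat \<Rightarrow> (cube \<Rightarrow> real) \<Rightarrow> real \<Rightarrow> real list set" where
  "Xt d \<omega> t = \<Union>{cube_set Q | Q. Q \<in> cubes_all d \<and> \<omega> Q \<le> t}"

definition Lambda :: "nat \<Rightarrow> nat \<Rightarrow> real list set" where
  "Lambda d n = {p. length p = d \<and> (\<forall>i<d. - real n \<le> p ! i \<and> p ! i \<le> real n)}"

definition betti_n :: "nat \<Rightarrow> nat \<Rightarrow> nat \<Rightarrow> (cube \<Rightarrow> real) \<Rightarrow> real \<Rightarrow> nat" where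
  "betti_n d q n \<omega> t = betti d q (Xt d \<omega> t \<inter> Lambda d n)"

definition Lqn :: "nat \<Rightarrow> nat \<Rightarrow> nat \<Rightarrow> (cube \<Rightarrow> real) \<Rightarrow> real" where
  "Lqn d q n \<omega> = (LINT t:{0..1}|lborel. real (betti_n d q n \<omega> t))"

definition Omega :: "nat \<Rightarrow> (cube \<Rightarrow> real) measure" where
  "Omega d = PiM (cubes_all d) (\<lambda>_. restrict_space borel {0..1})"

definition shift_cube :: "int list \<Rightarrow> cube \<Rightarrow> cube" where
  "shift_cube x Q = map2 (\<lambda>(l, b) xi. (l + xi, b)) Q x"

definition tau :: "nat \<Rightarrow> int list \<Rightarrow> (cube \<Rightarrow> real) \<Rightarrow> cube \<Rightarrow> real" where
  "tau d x \<omega> = (\<lambda>Q\<in>cubes_all d. \<omega> (shift_cube (map uminus x) Q))"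

definition normal_law :: "real \<Rightarrow> real measure" where
  "normal_law s2 = (if s2 = 0 then return borel 0
                    else density lborel (normal_density 0 (sqrt s2)))"

end

theory Submission
  imports Defs "HOL-Library.Function_Algebras"
begin

text \<open>
  Write \<open>K(t)\<close> for the set of cubes contained in \<open>X(t)\<close>. By rank-nullity over the rationals,
  \<open>\<beta>\<^sub>q\<close> of the part of \<open>K(t)\<close> in a window is the number of \<open>q\<close>-cubes minus the ranks of \<open>\<partial>\<^sub>q\<close>
  and \<open>\<partial>\<^sub>q\<^sub>+\<^sub>1\<close>. Each of these three numbers is a monotone submodular function of the set of cubes.
  Hence the effect of resampling one coordinate \<open>\<omega>\<^sub>Q\<close> has a fixed sign and its size decreases as the
  window grows, so its mean converges, uniformly over all windows containing a large ball around \<open>Q\<close>.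

  Cut \<open>\<Lambda>\<^sub>n\<close> into blocks of side \<open>2m\<close>, spaced so that the block functionals are i.i.d. By the
  Efron-Stein inequality the variance of the difference between the functional of \<open>\<Lambda>\<^sub>n\<close> and the sum
  over the blocks is the sum of the mean square increments: those of cubes well inside a block are small
  by stabilisation, the others are bounded and occupy a small proportion of \<open>\<Lambda>\<^sub>n\<close>. So the normalised
  functional is approximated in mean square, uniformly in large \<open>n\<close>, by normalised i.i.d. sums, and
  variances and characteristic functions converge.
\<close>

section \<open>Approximation of characteristic functions\<close>

text \<open>The Betti number itself is not monotone in the complex, so its increments have no fixed
  sign. It is treated as the difference of two set functions, the number of \<open>q\<close>-cubes
  and the sum of the two ranks; stabilisation is proved for each of them and only then for the
  difference.

  The fixed sign makes the L1 distance between the increments seen in two nested windows equal to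
  the difference of their mean absolute values. These means decrease along growing windows, so their
  differences become small. A cube has a bounded number of faces, so increments are uniformly
  bounded and smallness in L1 gives smallness in mean square. Up to translation there are only
  finitely many cubes, which makes the estimate uniform.

  A cube belongs to X(t) as soon as some coface of it has appeared, and that coface may stick out of
  the window. The functional of a window thus reads coordinates one layer beyond it. This is why
  block centres are \<open>2 * m + 2\<close> apart, and why the boxes of relevant coordinates start
  at \<open>- int n - 1\<close>.\<close>

lemma integrable_mult_of_squares:
  fixes f g :: "'a \<Rightarrow> real"
  assumes [measurable]: "f \<in> borel_measurable M" "g \<in> borel_measurable M"
    and "integrable M (\<lambda>x. (f x)\<^sup>2)" "integrable M (\<lambda>x. (g x)\<^sup>2)"
  shows "integrable M (\<lambda>x. f x * g x)"
proof (rule Bochner_Integration.integrable_bound)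
  show "integrable M (\<lambda>x. (f x)\<^sup>2 + (g x)\<^sup>2)"
    using assms by simp
  have "\<bar>f x * g x\<bar> \<le> (f x)\<^sup>2 + (g x)\<^sup>2" for x
  proof -
    have "2 * (\<bar>f x\<bar> * \<bar>g x\<bar>) \<le> (f x)\<^sup>2 + (g x)\<^sup>2"
      using sum_squares_bound[of "\<bar>f x\<bar>" "\<bar>g x\<bar>"] by (simp add: mult.assoc)
    moreover have "\<bar>f x\<bar> * \<bar>g x\<bar> \<ge> 0" by simp
    ultimately show ?thesis unfolding abs_mult by linarith
  qed
  then show "AE x in M. norm (f x * g x) \<le> norm ((f x)\<^sup>2 + (g x)\<^sup>2)"
    by (auto intro!: AE_I2)
qed simp

lemma abs_integral_mult_le:
  fixes f g :: "'a \<Rightarrow> real"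
  assumes [measurable]: "f \<in> borel_measurable M" "g \<in> borel_measurable M"
    and f: "integrable M (\<lambda>x. (f x)\<^sup>2)" and g: "integrable M (\<lambda>x. (g x)\<^sup>2)"
  shows "\<bar>\<integral>x. f x * g x \<partial>M\<bar> \<le> sqrt (\<integral>x. (f x)\<^sup>2 \<partial>M) * sqrt (\<integral>x. (g x)\<^sup>2 \<partial>M)"
proof -
  define A B C where "A = (\<integral>x. (f x)\<^sup>2 \<partial>M)" "B = (\<integral>x. (g x)\<^sup>2 \<partial>M)" "C = (\<integral>x. f x * g x \<partial>M)"
  have fg: "integrable M (\<lambda>x. f x * g x)"
    using assms by (rule integrable_mult_of_squares)
  have nonneg: "0 \<le> A - 2 * l * C + l\<^sup>2 * B" for l
  proof -
    have "0 \<le> (\<integral>x. (f x - l * g x)\<^sup>2 \<partial>M)"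
      by simp
    also have "\<dots> = (\<integral>x. ((f x)\<^sup>2 - 2 * l * (f x * g x)) + l\<^sup>2 * (g x)\<^sup>2 \<partial>M)"
      by (intro Bochner_Integration.integral_cong) (auto simp: power2_eq_square algebra_simps)
    also have "\<dots> = A - 2 * l * C + l\<^sup>2 * B"
      using f g fg by (simp add: A_B_C_def)
    finally show ?thesis .
  qed
  have "A \<ge> 0" "B \<ge> 0"
    by (auto simp: A_B_C_def)
  have "C\<^sup>2 \<le> A * B"
  proof (cases "B = 0")
    case True
    have "C = 0"
    proof (rule ccontr)
      assume "C \<noteq> 0"
      \<comment> \<open>With \<open>B = 0\<close> the quadratic is affine in \<open>l\<close>, and
        this choice of \<open>l\<close> would give it the value -1. In the other case
        \<open>C / B\<close> is its minimiser.\<close>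
      then show False
        using nonneg[of "(A + 1) / (2 * C)"] True by (simp add: field_simps)
    qed
    then show ?thesis using True by simp
  next
    case False
    then have "B > 0" using \<open>B \<ge> 0\<close> by simp
    then show ?thesis
      using nonneg[of "C / B"] by (simp add: field_simps power2_eq_square)
  qed
  then have "sqrt (C\<^sup>2) \<le> sqrt (A * B)"
    by (rule real_sqrt_le_mono)
  then show ?thesis
    unfolding A_B_C_def[symmetric] by (simp add: real_sqrt_mult)
qed

lemma abs_sqrt_integral_diff_le:
  fixes f g :: "'a \<Rightarrow> real"
  assumes [measurable]: "f \<in> borel_measurable M" "g \<in> borel_measurable M"
    and f: "integrable M (\<lambda>x. (f x)\<^sup>2)" and g: "integrable M (\<lambda>x. (g x)\<^sup>2)"
  shows "\<bar>sqrt (\<integral>x. (f x)\<^sup>2 \<partial>M) - sqrt (\<integral>x. (g x)\<^sup>2 \<partial>M)\<bar> \<le> sqrt (\<integral>x. (f x - g x)\<^sup>2 \<partial>M)"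
proof -
  have fg: "integrable M (\<lambda>x. f x * g x)"
    using assms by (rule integrable_mult_of_squares)
  have "(\<integral>x. (f x - g x)\<^sup>2 \<partial>M) = (\<integral>x. ((f x)\<^sup>2 - 2 * (f x * g x)) + (g x)\<^sup>2 \<partial>M)"
    by (intro Bochner_Integration.integral_cong) (auto simp: power2_eq_square algebra_simps)
  also have "\<dots> = (\<integral>x. (f x)\<^sup>2 \<partial>M) - 2 * (\<integral>x. f x * g x \<partial>M) + (\<integral>x. (g x)\<^sup>2 \<partial>M)"
    using f g fg by simp
  also have "\<dots> \<ge> (sqrt (\<integral>x. (f x)\<^sup>2 \<partial>M) - sqrt (\<integral>x. (g x)\<^sup>2 \<partial>M))\<^sup>2"
    using abs_integral_mult_le[OF assms] by (simp add: power2_diff)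
  finally show ?thesis
    by (metis real_sqrt_abs real_sqrt_le_mono)
qed

lemma (in prob_space) abs_expectation_le_sqrt:
  fixes f :: "'a \<Rightarrow> real"
  assumes "f \<in> borel_measurable M" "integrable M (\<lambda>x. (f x)\<^sup>2)"
  shows "expectation (\<lambda>x. \<bar>f x\<bar>) \<le> sqrt (expectation (\<lambda>x. (f x)\<^sup>2))"
  using abs_integral_mult_le[of "\<lambda>x. \<bar>f x\<bar>" M "\<lambda>_. 1"] assms by (simp add: prob_space)

text \<open>Since \<open>iexp\<close> is 1-Lipschitz, characteristic functions are Lipschitz for the
  L2 distance. This transfers mean square approximation to convergence in law.\<close>

lemma (in prob_space) char_distr_diff_le:
  fixes f g :: "'a \<Rightarrow> real"
  assumes [measurable]: "f \<in> borel_measurable M" "g \<in> borel_measurable M"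
    and f: "integrable M (\<lambda>x. (f x)\<^sup>2)" and g: "integrable M (\<lambda>x. (g x)\<^sup>2)"
  shows "cmod (char (distr M borel f) t - char (distr M borel g) t)
      \<le> \<bar>t\<bar> * sqrt (expectation (\<lambda>x. (f x - g x)\<^sup>2))"
proof -
  have fg: "integrable M (\<lambda>x. (f x - g x)\<^sup>2)"
    using integrable_mult_of_squares[OF assms] f g by (simp add: power2_diff mult.assoc)
  have int: "integrable M (\<lambda>x. iexp (t * f x))" "integrable M (\<lambda>x. iexp (t * g x))"
    by (intro integrable_const_bound[where B=1]; simp)+
  have "char (distr M borel f) t - char (distr M borel g) t = (\<integral>x. iexp (t * f x) - iexp (t * g x) \<partial>M)"
    using int by (simp add: char_def integral_distr)
  also have "cmod \<dots> \<le> (\<integral>x. \<bar>t\<bar> * \<bar>f x - g x\<bar> \<partial>M)"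
  proof (rule order_trans[OF integral_norm_bound integral_mono])
    show "integrable M (\<lambda>x. cmod (iexp (t * f x) - iexp (t * g x)))"
      using int by auto
    show "integrable M (\<lambda>x. \<bar>t\<bar> * \<bar>f x - g x\<bar>)"
      using square_integrable_imp_integrable[OF _ fg] by auto
    show "cmod (iexp (t * f x) - iexp (t * g x)) \<le> \<bar>t\<bar> * \<bar>f x - g x\<bar>" for x
    proof -
      have "iexp (t * f x) - iexp (t * g x) = iexp (t * g x) * (iexp (t * (f x - g x)) - 1)"
        by (simp add: right_diff_distrib exp_diff)
      also have "cmod \<dots> = cmod (iexp (t * (f x - g x)) - 1)"
        by (simp add: norm_mult)
      also have "\<dots> \<le> \<bar>t * (f x - g x)\<bar>"
        using iexp_approx1[of "t * (f x - g x)" 0] by simp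
      finally show ?thesis by (simp add: abs_mult)
    qed
  qed
  also have "\<dots> \<le> \<bar>t\<bar> * sqrt (expectation (\<lambda>x. (f x - g x)\<^sup>2))"
    using abs_expectation_le_sqrt[OF _ fg] by (auto intro: mult_left_mono)
  finally show ?thesis .
qed

section \<open>Normal laws and sums of bounded independent variables\<close>

lemma char_normal_law:
  assumes "s2 \<ge> 0"
  shows "char (normal_law s2) t = of_real (exp (- (s2 * t\<^sup>2) / 2))"
proof (cases "s2 = 0")
  case True
  then show ?thesis
    by (simp add: normal_law_def char_def integral_return)
next
  case False
  with assms have s: "s2 > 0" by simp
  interpret N: prob_space "density lborel (normal_density 0 (sqrt s2))"
    using s by (intro prob_space_normal_density) simp
  let ?N = "density lborel (normal_density 0 (sqrt s2))"
  have "distributed ?N lborel (\<lambda>x. x) (normal_density 0 (sqrt s2))"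
    by (auto simp: distributed_def intro!: distr_id2)
  then have "distributed ?N lborel (\<lambda>x. (x - 0) / sqrt s2) std_normal_density"
    using s by (subst (asm) N.normal_standard_normal_convert) auto
  then have "distr ?N lborel (\<lambda>x. x / sqrt s2) = std_normal_distribution"
    by (simp add: distributed_def)
  then have D: "distr ?N borel (\<lambda>x. x / sqrt s2) = std_normal_distribution"
    by (simp cong: distr_cong)
  have "char ?N t = char (distr ?N borel (\<lambda>x. x / sqrt s2)) (sqrt s2 * t)"
    unfolding char_def using s by (subst integral_distr) auto
  also have "\<dots> = of_real (exp (- (s2 * t\<^sup>2) / 2))"
    unfolding D char_std_normal_distribution using s by (simp add: power_mult_distrib)
  finally show ?thesis
    using False by (simp add: normal_law_def)
qed

lemma real_distribution_normal_law: "s2 \<ge> 0 \<Longrightarrow> real_distribution (normal_law s2)"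
  by (auto simp: normal_law_def real_distribution_def real_distribution_axioms_def
      intro!: prob_space_normal_density prob_space_return)

text \<open>The bases \<open>1 - a n\<close> and \<open>exp (- a n)\<close> differ by at most the
  square of \<open>a n\<close>, so the powers differ by at most \<open>N n * a n * a n\<close>,
  which tends to 0. The exponent is kept separate from the index because it will be the number of
  blocks.\<close>

lemma power_one_minus_tendsto_exp:
  fixes a :: "nat \<Rightarrow> real" and N :: "nat \<Rightarrow> nat"
  assumes a: "a \<longlonglongrightarrow> 0" "\<And>n. a n \<ge> 0" and Na: "(\<lambda>n. real (N n) * a n) \<longlonglongrightarrow> L"
  shows "(\<lambda>n. (1 - a n) ^ N n) \<longlonglongrightarrow> exp (- L)"
proof -
  have lim: "(\<lambda>n. exp (- a n) ^ N n) \<longlonglongrightarrow> exp (- L)"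
    using tendsto_exp[OF tendsto_minus[OF Na]] by (simp add: exp_of_nat_mult[of "N _" "- a _", simplified])
  have "\<forall>\<^sub>F n in sequentially. norm ((1 - a n) ^ N n - exp (- a n) ^ N n) \<le> real (N n) * a n * a n"
    using order_tendstoD(2)[OF a(1), of 1, simplified]
  proof eventually_elim
    case (elim n)
    have 1: "exp (- a n) \<ge> 1 - a n"
      using exp_ge_add_one_self[of "- a n"] by simp
    have "exp (- a n) \<le> 1 / (1 + a n)"
      using exp_ge_add_one_self[of "a n"] a(2)[of n] by (simp add: exp_minus field_simps)
    also have "\<dots> \<le> 1 - a n + a n * a n"
      using a(2)[of n] by (simp add: field_simps)
    finally have 2: "norm ((1 - a n) - exp (- a n)) \<le> a n * a n"
      using 1 by simp
    have "norm ((1 - a n) ^ N n - exp (- a n) ^ N n) \<le> real (N n) * norm ((1 - a n) - exp (- a n))"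
      using elim a(2)[of n] by (intro norm_power_diff) auto
    also have "\<dots> \<le> real (N n) * (a n * a n)"
      by (intro mult_left_mono 2) auto
    finally show ?case by (simp add: mult.assoc)
  qed
  moreover have "(\<lambda>n. real (N n) * a n * a n) \<longlonglongrightarrow> 0"
    using tendsto_mult[OF Na a(1)] by simp
  ultimately have "(\<lambda>n. (1 - a n) ^ N n - exp (- a n) ^ N n) \<longlonglongrightarrow> 0"
    by (rule Lim_null_comparison)
  from tendsto_add[OF this lim] show ?thesis by simp
qed

text \<open>A central limit theorem with the number of summands and the normalisation decoupled: the
  sums run over blocks while the scaling uses the volume of the window, and only the limit
  \<open>c\<close> of their combination is known.\<close>

lemma (in prob_space) char_indep_sum_tendsto:
  fixes X :: "'i \<Rightarrow> 'a \<Rightarrow> real" and J :: "nat \<Rightarrow> 'i set" and s :: "nat \<Rightarrow> real"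
  assumes indep: "\<And>n. indep_vars (\<lambda>_. borel) X (J n)"
    and bound: "\<And>i n x. i \<in> J n \<Longrightarrow> x \<in> space M \<Longrightarrow> \<bar>X i x\<bar> \<le> B"
    and mean: "\<And>i n. i \<in> J n \<Longrightarrow> expectation (X i) = 0"
    and var: "\<And>i n. i \<in> J n \<Longrightarrow> expectation (\<lambda>x. (X i x)\<^sup>2) = v"
    and s: "s \<longlonglongrightarrow> 0" and c: "(\<lambda>n. real (card (J n)) * (s n)\<^sup>2) \<longlonglongrightarrow> c"
  shows "(\<lambda>n. char (distr M borel (\<lambda>x. s n * (\<Sum>i\<in>J n. X i x))) t) \<longlonglongrightarrow> of_real (exp (- (c * v * t\<^sup>2) / 2))"
proof (cases "\<exists>n. J n \<noteq> {}")
  \<comment> \<open>If every index set is empty, nothing is known about \<open>v\<close>, not even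
    its sign; but then \<open>c\<close> is 0 and both sides are 1.\<close>
  case False
  then have "c = 0"
    using c by (simp add: tendsto_const_iff)
  moreover have "char (distr M borel (\<lambda>x. s n * (\<Sum>i\<in>J n. X i x))) t = 1" for n
    using False by (simp add: char_def integral_distr prob_space del: distr_const)
  ultimately show ?thesis by simp
next
  case True
  then obtain n0 i0 where i0: "i0 \<in> J n0" by auto
  have rv: "random_variable borel (X i)" if "i \<in> J n" for i n
    using indep[of n] that by (auto simp: indep_vars_def2)
  have "v \<ge> 0"
    using var[OF i0] by (metis Bochner_Integration.integral_nonneg zero_le_power2)
  obtain x0 where "x0 \<in> space M" using not_empty by auto
  then have "B \<ge> 0" using bound[OF i0] by fastforce
  \<comment> \<open>\<open>1 - a n\<close> is the second-order expansion of the characteristic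
    function of \<open>s n * X i\<close> at \<open>t\<close>. The third-order error per summand is a
    constant times the cube of \<open>\<bar>s n\<bar>\<close>; summed over \<open>J n\<close> it is
    a convergent factor times \<open>\<bar>s n\<bar>\<close>, hence tends to 0.\<close>
  define a where "a n = (t * s n)\<^sup>2 * v / 2" for n
  have a0: "a \<longlonglongrightarrow> 0"
    unfolding a_def by (rule tendsto_eq_intros s | simp)+
  have aN: "(\<lambda>n. real (card (J n)) * a n) \<longlonglongrightarrow> c * v * t\<^sup>2 / 2"
    unfolding a_def using tendsto_mult_right[OF c, of "t\<^sup>2 * v / 2"]
    by (simp add: power_mult_distrib algebra_simps)
  have lim: "(\<lambda>n. complex_of_real ((1 - a n) ^ card (J n))) \<longlonglongrightarrow> of_real (exp (- (c * v * t\<^sup>2 / 2)))"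
    using \<open>v \<ge> 0\<close> by (intro tendsto_of_real power_one_minus_tendsto_exp a0 aN) (simp add: a_def)
  let ?ch = "\<lambda>n. char (distr M borel (\<lambda>x. s n * (\<Sum>i\<in>J n. X i x))) t"
  have "\<forall>\<^sub>F n in sequentially. cmod (?ch n - of_real ((1 - a n) ^ card (J n)))
      \<le> (real (card (J n)) * (s n)\<^sup>2) * \<bar>s n\<bar> * (\<bar>t\<bar> ^ 3 * B ^ 3 / 6)"
    using order_tendstoD(2)[OF a0, of 1, simplified]
  proof eventually_elim
    case (elim n)
    have [simp]: "a n \<ge> 0" using \<open>v \<ge> 0\<close> by (simp add: a_def)
    have "?ch n = char (distr M borel (\<lambda>x. \<Sum>i\<in>J n. s n * X i x)) t"
      by (simp add: sum_distrib_left)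
    also have "\<dots> = (\<Prod>i\<in>J n. char (distr M borel (\<lambda>x. s n * X i x)) t)"
      by (intro char_distr_sum indep_vars_compose2[OF indep]) auto
    finally have eq: "?ch n = (\<Prod>i\<in>J n. char (distr M borel (\<lambda>x. s n * X i x)) t)" .
    have each: "cmod (char (distr M borel (\<lambda>x. s n * X i x)) t - of_real (1 - a n))
        \<le> (s n)\<^sup>2 * \<bar>s n\<bar> * (\<bar>t\<bar> ^ 3 * B ^ 3 / 6)" if i: "i \<in> J n" for i
    proof -
      note [measurable] = rv[OF i]
      have int: "integrable M (X i)"
        by (rule integrable_const_bound[of _ B]) (auto intro: bound[OF i])
      have int2: "integrable M (\<lambda>x. (X i x)\<^sup>2)"
        by (rule integrable_const_bound[of _ "B\<^sup>2"]) (auto intro: power_mono[OF bound[OF i], of _ 2, simplified])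
      have "char (distr M borel (\<lambda>x. s n * X i x)) t = char (distr M borel (X i)) (t * s n)"
        by (simp add: char_def integral_distr mult.assoc)
      moreover have "cmod (char (distr M borel (X i)) (t * s n) - (1 - (t * s n)\<^sup>2 * v / 2))
          \<le> ((t * s n)\<^sup>2 / 6) * expectation (\<lambda>x. min (6 * (X i x)\<^sup>2) (\<bar>t * s n\<bar> * \<bar>X i x\<bar> ^ 3))"
        using int int2 mean[OF i] var[OF i] by (intro char_approx3') auto
      moreover have "expectation (\<lambda>x. min (6 * (X i x)\<^sup>2) (\<bar>t * s n\<bar> * \<bar>X i x\<bar> ^ 3))
          \<le> expectation (\<lambda>x. \<bar>t * s n\<bar> * B ^ 3)"
      proof (rule integral_mono_AE)
        show "integrable M (\<lambda>x. min (6 * (X i x)\<^sup>2) (\<bar>t * s n\<bar> * \<bar>X i x\<bar> ^ 3))"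
          by (rule Bochner_Integration.integrable_bound[OF integrable_mult_right[OF int2, of 6]])
             (auto simp: abs_mult)
        show "AE x in M. min (6 * (X i x)\<^sup>2) (\<bar>t * s n\<bar> * \<bar>X i x\<bar> ^ 3) \<le> \<bar>t * s n\<bar> * B ^ 3"
        proof (rule AE_I2)
          fix x assume "x \<in> space M"
          then have "\<bar>X i x\<bar> ^ 3 \<le> B ^ 3" by (intro power_mono bound[OF i]) auto
          then show "min (6 * (X i x)\<^sup>2) (\<bar>t * s n\<bar> * \<bar>X i x\<bar> ^ 3) \<le> \<bar>t * s n\<bar> * B ^ 3"
            by (intro min.coboundedI2 mult_left_mono) auto
        qed
      qed simp
      ultimately have "cmod (char (distr M borel (\<lambda>x. s n * X i x)) t - of_real (1 - a n))
          \<le> ((t * s n)\<^sup>2 / 6) * (\<bar>t * s n\<bar> * B ^ 3)"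
        by (simp add: a_def prob_space) (erule order_trans, intro divide_right_mono mult_left_mono, auto)
      also have "\<dots> = (s n)\<^sup>2 * \<bar>s n\<bar> * (\<bar>t\<bar> ^ 3 * B ^ 3 / 6)"
        by (simp add: abs_mult power_mult_distrib power2_eq_square power3_eq_cube)
      finally show ?thesis .
    qed
    have "cmod (?ch n - of_real ((1 - a n) ^ card (J n)))
        = cmod ((\<Prod>i\<in>J n. char (distr M borel (\<lambda>x. s n * X i x)) t) - (\<Prod>i\<in>J n. of_real (1 - a n)))"
      unfolding eq by simp
    also have "\<dots> \<le> (\<Sum>i\<in>J n. cmod (char (distr M borel (\<lambda>x. s n * X i x)) t - of_real (1 - a n)))"
    proof (rule norm_prod_diff)
      fix i assume i: "i \<in> J n"
      note [measurable] = rv[OF i]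
      interpret D: real_distribution "distr M borel (\<lambda>x. s n * X i x)"
        by (rule real_distribution_distr) simp
      show "cmod (char (distr M borel (\<lambda>x. s n * X i x)) t) \<le> 1"
        by (rule D.cmod_char_le_1)
      show "cmod (complex_of_real (1 - a n)) \<le> 1"
        using elim \<open>a n \<ge> 0\<close> by (subst norm_of_real) simp
    qed
    also have "\<dots> \<le> (\<Sum>i\<in>J n. (s n)\<^sup>2 * \<bar>s n\<bar> * (\<bar>t\<bar> ^ 3 * B ^ 3 / 6))"
      by (intro sum_mono each)
    finally show ?case by (simp add: mult.assoc)
  qed
  moreover have "(\<lambda>n. (real (card (J n)) * (s n)\<^sup>2) * \<bar>s n\<bar> * (\<bar>t\<bar> ^ 3 * B ^ 3 / 6)) \<longlonglongrightarrow> c * \<bar>0\<bar> * (\<bar>t\<bar> ^ 3 * B ^ 3 / 6)"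
    by (intro tendsto_intros c s)
  then have "(\<lambda>n. (real (card (J n)) * (s n)\<^sup>2) * \<bar>s n\<bar> * (\<bar>t\<bar> ^ 3 * B ^ 3 / 6)) \<longlonglongrightarrow> 0"
    by simp
  ultimately have "(\<lambda>n. ?ch n - of_real ((1 - a n) ^ card (J n))) \<longlonglongrightarrow> 0"
    by (rule Lim_null_comparison)
  from tendsto_add[OF this lim] show ?thesis by simp
qed

text \<open>Nothing is assumed about how the variances \<open>v\<close> of the approximations behave
  as \<open>e\<close> tends to 0. The standard deviations of \<open>Y n\<close> are eventually
  within \<open>e\<close> of \<open>sqrt v\<close>, hence form a Cauchy sequence, and their limit
  defines the variance of the limit law. Levy's theorem then needs only that the Gaussian
  characteristic function is continuous in the standard deviation.\<close>

lemma (in prob_space) normal_limit_of_approximations: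
  fixes Y :: "nat \<Rightarrow> 'a \<Rightarrow> real"
  assumes Y[measurable]: "\<And>n. Y n \<in> borel_measurable M"
    and Y2: "\<And>n. integrable M (\<lambda>x. (Y n x)\<^sup>2)"
    and approx: "\<And>e. e > 0 \<Longrightarrow> \<exists>v\<ge>0. \<exists>S.
      (\<forall>n. S n \<in> borel_measurable M \<and> integrable M (\<lambda>x. (S n x)\<^sup>2)) \<and>
      (\<lambda>n. expectation (\<lambda>x. (S n x)\<^sup>2)) \<longlonglongrightarrow> v \<and>
      (\<forall>t. (\<lambda>n. char (distr M borel (S n)) t) \<longlonglongrightarrow> of_real (exp (- (v * t\<^sup>2) / 2))) \<and>
      (\<forall>\<^sub>F n in sequentially. expectation (\<lambda>x. (Y n x - S n x)\<^sup>2) \<le> e\<^sup>2)"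
  shows "\<exists>\<tau>2\<ge>0. (\<lambda>n. expectation (\<lambda>x. (Y n x)\<^sup>2)) \<longlonglongrightarrow> \<tau>2 \<and>
      weak_conv_m (\<lambda>n. distr M borel (Y n)) (normal_law \<tau>2)"
proof -
  define y where "y n = sqrt (expectation (\<lambda>x. (Y n x)\<^sup>2))" for n
  have appr: "\<exists>v\<ge>0. (\<forall>\<^sub>F n in sequentially. \<bar>y n - sqrt v\<bar> \<le> e) \<and>
      (\<forall>t. \<forall>\<^sub>F n in sequentially. cmod (char (distr M borel (Y n)) t - of_real (exp (- (v * t\<^sup>2) / 2))) \<le> e * (\<bar>t\<bar> + 1))"
    if e: "e > 0" for e
  proof -
    obtain v S where v: "v \<ge> 0" and S[measurable]: "\<And>n. S n \<in> borel_measurable M"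
      and S2: "\<And>n. integrable M (\<lambda>x. (S n x)\<^sup>2)"
      and lim: "(\<lambda>n. expectation (\<lambda>x. (S n x)\<^sup>2)) \<longlonglongrightarrow> v"
      and ch: "\<And>t. (\<lambda>n. char (distr M borel (S n)) t) \<longlonglongrightarrow> of_real (exp (- (v * t\<^sup>2) / 2))"
      and close: "\<forall>\<^sub>F n in sequentially. expectation (\<lambda>x. (Y n x - S n x)\<^sup>2) \<le> (e/2)\<^sup>2"
      using approx[of "e/2"] e by auto
    have close': "\<forall>\<^sub>F n in sequentially. sqrt (expectation (\<lambda>x. (Y n x - S n x)\<^sup>2)) \<le> e/2"
      using close
    proof eventually_elim
      case (elim n)
      show ?case
        using real_sqrt_le_mono[OF elim] e by simp
    qed
    have "(\<lambda>n. sqrt (expectation (\<lambda>x. (S n x)\<^sup>2))) \<longlonglongrightarrow> sqrt v"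
      by (intro tendsto_intros lim)
    then have "\<forall>\<^sub>F n in sequentially. dist (sqrt (expectation (\<lambda>x. (S n x)\<^sup>2))) (sqrt v) < e/2"
      using e by (intro tendstoD) auto
    with close' have 1: "\<forall>\<^sub>F n in sequentially. \<bar>y n - sqrt v\<bar> \<le> e"
    proof eventually_elim
      case (elim n)
      then show ?case
        using abs_sqrt_integral_diff_le[OF Y S Y2 S2, of n n]
        unfolding y_def dist_real_def by linarith
    qed
    have 2: "\<forall>\<^sub>F n in sequentially. cmod (char (distr M borel (Y n)) t - of_real (exp (- (v * t\<^sup>2) / 2))) \<le> e * (\<bar>t\<bar> + 1)" for t
    proof -
      have "\<forall>\<^sub>F n in sequentially. dist (char (distr M borel (S n)) t) (of_real (exp (- (v * t\<^sup>2) / 2))) < e"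
        using e by (intro tendstoD ch) auto
      with close' show ?thesis
      proof eventually_elim
        case (elim n)
        have "cmod (char (distr M borel (Y n)) t - char (distr M borel (S n)) t) \<le> \<bar>t\<bar> * e"
          by (rule order_trans[OF char_distr_diff_le[OF Y S Y2 S2]])
             (use elim e in \<open>auto intro!: mult_left_mono\<close>)
        then have "cmod ((char (distr M borel (Y n)) t - char (distr M borel (S n)) t)
          + (char (distr M borel (S n)) t - of_real (exp (- (v * t\<^sup>2) / 2)))) \<le> \<bar>t\<bar> * e + e"
          using elim by (intro norm_triangle_mono) (auto simp: dist_norm)
        then show ?case by (simp add: algebra_simps)
      qed
    qed
    show ?thesis using v 1 2 by auto
  qed
  have "Cauchy y"
  proof (rule metric_CauchyI)
    fix e :: real assume "e > 0"
    then obtain v where "\<forall>\<^sub>F n in sequentially. \<bar>y n - sqrt v\<bar> \<le> e/3"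
      using appr[of "e/3"] by auto
    then obtain N where N: "\<And>n. n \<ge> N \<Longrightarrow> \<bar>y n - sqrt v\<bar> \<le> e/3"
      by (auto simp: eventually_sequentially)
    have "dist (y m) (y n) < e" if "m \<ge> N" "n \<ge> N" for m n
      using N[OF that(1)] N[OF that(2)] \<open>e > 0\<close> unfolding dist_real_def by linarith
    then show "\<exists>N. \<forall>m\<ge>N. \<forall>n\<ge>N. dist (y m) (y n) < e" by blast
  qed
  then obtain \<tau> where \<tau>: "y \<longlonglongrightarrow> \<tau>"
    using Cauchy_convergent_iff convergent_def by blast
  have "\<tau> \<ge> 0"
    by (rule LIMSEQ_le_const[OF \<tau>]) (auto simp: y_def)
  have var: "(\<lambda>n. expectation (\<lambda>x. (Y n x)\<^sup>2)) \<longlonglongrightarrow> \<tau>\<^sup>2"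
    using tendsto_power[OF \<tau>, of 2] by (simp add: y_def)
  have ch: "(\<lambda>n. char (distr M borel (Y n)) t) \<longlonglongrightarrow> of_real (exp (- (\<tau>\<^sup>2 * t\<^sup>2) / 2))" for t
  proof (rule tendstoI)
    fix e :: real assume "e > 0"
    have "isCont (\<lambda>s. exp (- (s\<^sup>2 * t\<^sup>2) / 2)) \<tau>"
      by (intro continuous_intros) auto
    then obtain \<delta> where \<delta>: "\<delta> > 0" "\<And>s. \<bar>s - \<tau>\<bar> < \<delta> \<Longrightarrow> \<bar>exp (- (s\<^sup>2 * t\<^sup>2) / 2) - exp (- (\<tau>\<^sup>2 * t\<^sup>2) / 2)\<bar> < e/2"
      using \<open>e > 0\<close> unfolding continuous_at_real_range real_norm_def by (metis half_gt_zero)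
    \<comment> \<open>The first bound brings \<open>sqrt v\<close> into the neighbourhood of \<tau>
      given by continuity; the second keeps the approximation error
      \<open>\<epsilon> * (\<bar>t\<bar> + 1)\<close> below \<open>e / 4\<close>, leaving
      \<open>e / 2\<close> for the change of variance.\<close>
    define \<epsilon> where "\<epsilon> = min (\<delta>/2) (e / (4 * (\<bar>t\<bar> + 1)))"
    have "\<epsilon> > 0" using \<delta>(1) \<open>e > 0\<close> by (auto simp: \<epsilon>_def)
    then obtain v where v: "v \<ge> 0" "\<forall>\<^sub>F n in sequentially. \<bar>y n - sqrt v\<bar> \<le> \<epsilon>"
      "\<forall>\<^sub>F n in sequentially. cmod (char (distr M borel (Y n)) t - of_real (exp (- (v * t\<^sup>2) / 2))) \<le> \<epsilon> * (\<bar>t\<bar> + 1)"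
      using appr by blast
    have "\<bar>\<tau> - sqrt v\<bar> \<le> \<epsilon>"
      by (rule tendsto_upperbound[OF tendsto_rabs[OF tendsto_diff[OF \<tau> tendsto_const]] v(2)]) simp
    then have "\<bar>sqrt v - \<tau>\<bar> < \<delta>"
      using \<delta>(1) unfolding \<epsilon>_def by linarith
    from \<delta>(2)[OF this] v(1) have close: "\<bar>exp (- (v * t\<^sup>2) / 2) - exp (- (\<tau>\<^sup>2 * t\<^sup>2) / 2)\<bar> < e/2"
      by simp
    have "\<epsilon> * (\<bar>t\<bar> + 1) \<le> e / (4 * (\<bar>t\<bar> + 1)) * (\<bar>t\<bar> + 1)"
      by (intro mult_right_mono) (auto simp: \<epsilon>_def)
    also have "\<dots> = e / 4"
    proof -
      have "u \<noteq> 0 \<Longrightarrow> e / (4 * u) * u = e / 4" for u :: real by simp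
      moreover have "\<bar>t\<bar> + 1 \<noteq> 0" by linarith
      ultimately show ?thesis by blast
    qed
    finally have small: "\<epsilon> * (\<bar>t\<bar> + 1) \<le> e / 4" .
    show "\<forall>\<^sub>F n in sequentially. dist (char (distr M borel (Y n)) t) (of_real (exp (- (\<tau>\<^sup>2 * t\<^sup>2) / 2))) < e"
      using v(3)
    proof eventually_elim
      case (elim n)
      have "cmod ((char (distr M borel (Y n)) t - of_real (exp (- (v * t\<^sup>2) / 2)))
          + of_real (exp (- (v * t\<^sup>2) / 2) - exp (- (\<tau>\<^sup>2 * t\<^sup>2) / 2))) \<le> e / 4 + e / 2"
        using elim small close by (intro norm_triangle_mono) (auto simp del: of_real_diff)
      then show ?case
        using \<open>e > 0\<close> by (simp add: dist_norm)
    qed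
  qed
  have "weak_conv_m (\<lambda>n. distr M borel (Y n)) (normal_law (\<tau>\<^sup>2))"
    by (rule levy_continuity) (use ch in \<open>auto intro!: real_distribution_distr real_distribution_normal_law simp: char_normal_law\<close>)
  with var show ?thesis by (intro exI[of _ "\<tau>\<^sup>2"]) auto
qed

section \<open>The Efron-Stein inequality\<close>

lemma indep_vars_PiM_components:
  assumes M: "\<And>i. i \<in> I \<Longrightarrow> prob_space (M i)"
  shows "prob_space.indep_vars (PiM I M) M (\<lambda>i \<omega>. \<omega> i) I"
proof -
  interpret prob_space "PiM I M"
    by (intro prob_space_PiM M)
  show ?thesis
  proof (cases "I = {}")
    case True
    show ?thesis
      unfolding indep_vars_def indep_sets_def using True by simp
  next
    case False
    have "distr (PiM I M) (PiM I M) (\<lambda>x. \<lambda>i\<in>I. x i) = distr (PiM I M) (PiM I M) (\<lambda>x. x)"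
      by (intro distr_cong) (auto simp: space_PiM)
    also have "\<dots> = PiM I M"
      by (intro distr_id2) simp
    also have "\<dots> = PiM I (\<lambda>i. distr (PiM I M) (M i) (\<lambda>\<omega>. \<omega> i))"
      by (intro PiM_cong refl distr_PiM_component[symmetric] M)
    finally show ?thesis
      using False by (subst indep_vars_iff_distr_eq_PiM') auto
  qed
qed

section \<open>Two coupled copies of a product measure\<close>

definition doubled :: "'i set \<Rightarrow> ('i \<Rightarrow> 'b measure) \<Rightarrow> ('i \<times> bool \<Rightarrow> 'b) measure" where
  "doubled I \<mu> = PiM (I \<times> UNIV) (\<lambda>p. \<mu> (fst p))"

text \<open>Copy \<open>False\<close> is the original configuration and copy \<open>True\<close> an
  independent replacement; \<open>S\<close> is the set of resampled coordinates. All resamplings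
  thus live on one probability space.\<close>

definition pick :: "'i set \<Rightarrow> 'i set \<Rightarrow> ('i \<times> bool \<Rightarrow> 'b) \<Rightarrow> 'i \<Rightarrow> 'b" where
  "pick I S x = (\<lambda>i\<in>I. x (i, i \<in> S))"

definition swap_copies :: "'i set \<Rightarrow> 'i set \<Rightarrow> ('i \<times> bool \<Rightarrow> 'b) \<Rightarrow> 'i \<times> bool \<Rightarrow> 'b" where
  "swap_copies I S x = (\<lambda>p\<in>I \<times> UNIV. x (fst p, snd p \<noteq> (fst p \<in> S)))"

text \<open>Exchanging the copies acts on the resampled set by symmetric difference. As
  \<open>swap_copies\<close> preserves the measure, the resampled sets of all factors in an
  expectation can be changed simultaneously.\<close>

lemma pick_swap_copies: "pick I A (swap_copies I S x) = pick I (sym_diff A S) x"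
proof -
  have "(i \<in> A) \<noteq> (i \<in> S) \<longleftrightarrow> i \<in> sym_diff A S" for i
    by auto
  then show ?thesis
    by (simp add: pick_def swap_copies_def fun_eq_iff)
qed

locale doubled_product =
  fixes I :: "'i set" and \<mu> :: "'i \<Rightarrow> 'b measure"
  assumes prob: "\<And>i. i \<in> I \<Longrightarrow> prob_space (\<mu> i)"
begin

sublocale D: prob_space "doubled I \<mu>"
  unfolding doubled_def by (intro prob_space_PiM) (auto intro: prob)

sublocale P: prob_space "PiM I \<mu>"
  by (intro prob_space_PiM prob)

lemma measurable_pick[measurable]: "pick I S \<in> measurable (doubled I \<mu>) (PiM I \<mu>)"
  unfolding pick_def doubled_def
proof (rule measurable_restrict)
  fix i assume "i \<in> I"
  then have "(\<lambda>x. x (i, i \<in> S)) \<in> measurable (PiM (I \<times> UNIV) (\<lambda>p. \<mu> (fst p))) (\<mu> (fst (i, i \<in> S)))"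
    by (intro measurable_component_singleton) auto
  then show "(\<lambda>x. x (i, i \<in> S)) \<in> measurable (PiM (I \<times> UNIV) (\<lambda>p. \<mu> (fst p))) (\<mu> i)"
    by simp
qed

lemma distr_pick: "distr (doubled I \<mu>) (PiM I \<mu>) (pick I S) = PiM I \<mu>"
proof -
  have "distr (PiM (I \<times> UNIV) (\<lambda>p. \<mu> (fst p))) (PiM I (\<lambda>i. \<mu> (fst (i, i \<in> S)))) (\<lambda>\<omega>. \<lambda>n\<in>I. \<omega> (n, n \<in> S))
      = PiM I (\<lambda>i. \<mu> (fst (i, i \<in> S)))"
    by (rule distr_PiM_reindex) (auto intro: prob inj_onI)
  then show ?thesis
    by (simp add: pick_def[abs_def] doubled_def)
qed

lemma measurable_swap_copies[measurable]: "swap_copies I S \<in> measurable (doubled I \<mu>) (doubled I \<mu>)"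
  unfolding swap_copies_def doubled_def
proof (rule measurable_restrict)
  fix p :: "'i \<times> bool" assume "p \<in> I \<times> UNIV"
  then have "(\<lambda>x. x (fst p, snd p \<noteq> (fst p \<in> S))) \<in> measurable (PiM (I \<times> UNIV) (\<lambda>p. \<mu> (fst p))) (\<mu> (fst (fst p, snd p \<noteq> (fst p \<in> S))))"
    by (intro measurable_component_singleton) auto
  then show "(\<lambda>x. x (fst p, snd p \<noteq> (fst p \<in> S))) \<in> measurable (PiM (I \<times> UNIV) (\<lambda>p. \<mu> (fst p))) (\<mu> (fst p))"
    by simp
qed

lemma distr_swap_copies: "distr (doubled I \<mu>) (doubled I \<mu>) (swap_copies I S) = doubled I \<mu>"
proof -
  have "distr (PiM (I \<times> UNIV) (\<lambda>p. \<mu> (fst p)))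
      (PiM (I \<times> UNIV) (\<lambda>p. \<mu> (fst (fst p, snd p \<noteq> (fst p \<in> S)))))
      (\<lambda>\<omega>. \<lambda>p\<in>I \<times> UNIV. \<omega> (fst p, snd p \<noteq> (fst p \<in> S)))
      = PiM (I \<times> UNIV) (\<lambda>p. \<mu> (fst (fst p, snd p \<noteq> (fst p \<in> S))))"
    by (rule distr_PiM_reindex) (auto intro: prob intro!: inj_onI)
  then show ?thesis
    by (simp add: swap_copies_def[abs_def] doubled_def)
qed

lemma integral_pick:
  fixes f :: "('i \<Rightarrow> 'b) \<Rightarrow> real"
  assumes "f \<in> borel_measurable (PiM I \<mu>)"
  shows "D.expectation (\<lambda>x. f (pick I S x)) = P.expectation f"
  by (subst distr_pick[of S, symmetric], subst integral_distr) (use assms in auto)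

lemma integral_swap_copies:
  fixes f :: "('i \<times> bool \<Rightarrow> 'b) \<Rightarrow> real"
  assumes "f \<in> borel_measurable (doubled I \<mu>)"
  shows "D.expectation (\<lambda>x. f (swap_copies I S x)) = D.expectation f"
proof -
  have "D.expectation f = integral\<^sup>L (distr (doubled I \<mu>) (doubled I \<mu>) (swap_copies I S)) f"
    by (simp add: distr_swap_copies)
  also have "\<dots> = D.expectation (\<lambda>x. f (swap_copies I S x))"
    using assms by (subst integral_distr) auto
  finally show ?thesis by simp
qed

text \<open>Resampling nothing and resampling everything read disjoint halves of the doubled index
  set, so the two factors are independent.\<close>

lemma integral_pick_mult_pick:
  fixes f :: "('i \<Rightarrow> 'b) \<Rightarrow> real"
  assumes f[measurable]: "f \<in> borel_measurable (PiM I \<mu>)"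
    and bound: "\<And>\<omega>. \<omega> \<in> space (PiM I \<mu>) \<Longrightarrow> \<bar>f \<omega>\<bar> \<le> B"
  shows "D.expectation (\<lambda>x. f (pick I {} x) * f (pick I I x)) = (P.expectation f)\<^sup>2"
proof -
  let ?N = "\<lambda>p. \<mu> (fst p)"
  have ind: "D.indep_vars ?N (\<lambda>p x. x p) (I \<times> UNIV)"
    unfolding doubled_def by (intro indep_vars_PiM_components) (auto intro: prob)
  have ind2: "D.indep_var (PiM (I \<times> {False}) ?N) (\<lambda>x. \<lambda>p\<in>I \<times> {False}. x p)
      (PiM (I \<times> {True}) ?N) (\<lambda>x. \<lambda>p\<in>I \<times> {True}. x p)"
    by (rule D.indep_var_restrict[OF ind]) auto
  have meas: "(\<lambda>y. f (\<lambda>i\<in>I. y (i, b))) \<in> borel_measurable (PiM (I \<times> {b}) ?N)" for b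
  proof (rule measurable_compose[OF measurable_restrict f])
    fix i assume "i \<in> I"
    then have "(\<lambda>x. x (i, b)) \<in> measurable (PiM (I \<times> {b}) ?N) (\<mu> (fst (i, b)))"
      by (intro measurable_component_singleton) auto
    then show "(\<lambda>x. x (i, b)) \<in> measurable (PiM (I \<times> {b}) ?N) (\<mu> i)" by simp
  qed
  have "D.indep_var borel ((\<lambda>y. f (\<lambda>i\<in>I. y (i, False))) \<circ> (\<lambda>x. \<lambda>p\<in>I \<times> {False}. x p))
      borel ((\<lambda>y. f (\<lambda>i\<in>I. y (i, True))) \<circ> (\<lambda>x. \<lambda>p\<in>I \<times> {True}. x p))"
    by (rule D.indep_var_compose[OF ind2 meas meas])
  moreover have "(\<lambda>y. f (\<lambda>i\<in>I. y (i, False))) \<circ> (\<lambda>x. \<lambda>p\<in>I \<times> {False}. x p) = (\<lambda>x. f (pick I {} x))"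
    by (auto simp: fun_eq_iff pick_def intro!: arg_cong[of _ _ f])
  moreover have "(\<lambda>y. f (\<lambda>i\<in>I. y (i, True))) \<circ> (\<lambda>x. \<lambda>p\<in>I \<times> {True}. x p) = (\<lambda>x. f (pick I I x))"
    by (auto simp: fun_eq_iff pick_def intro!: arg_cong[of _ _ f])
  ultimately have "D.indep_var borel (\<lambda>x. f (pick I {} x)) borel (\<lambda>x. f (pick I I x))"
    by simp
  moreover have "integrable (doubled I \<mu>) (\<lambda>x. f (pick I S x))" for S
    by (rule D.integrable_const_bound[of _ B])
       (auto intro!: AE_I2 bound measurable_space[OF measurable_pick])
  ultimately show ?thesis
    by (subst D.indep_var_lebesgue_integral) (simp_all add: integral_pick power2_eq_square)
qed

text \<open>
  Instead of conditioning one coordinate at a time, the covariance of two coupled copies of \<open>f\<close> is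
  telescoped along the coordinates in \<open>A\<close>; exchanging the two copies of a single coordinate turns
  each increment into a product of two differences.
\<close>

lemma efron_stein_telescope:
  fixes f :: "('i \<Rightarrow> 'b) \<Rightarrow> real"
  assumes f[measurable]: "f \<in> borel_measurable (PiM I \<mu>)"
    and bound: "\<And>\<omega>. \<omega> \<in> space (PiM I \<mu>) \<Longrightarrow> \<bar>f \<omega>\<bar> \<le> B"
    and "finite A"
  shows "D.expectation (\<lambda>x. f (pick I {} x) * f (pick I {} x))
      - D.expectation (\<lambda>x. f (pick I {} x) * f (pick I A x))
      \<le> (\<Sum>i\<in>A. D.expectation (\<lambda>x. (f (pick I {} x) - f (pick I {i} x))\<^sup>2)) / 2"
  using \<open>finite A\<close>
proof induction
  case empty
  then show ?case by simp
next
  case (insert i A)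
  let ?F = "\<lambda>S x. f (pick I S x)"
  let ?E = "D.expectation"
  have bd: "\<bar>?F S x\<bar> \<le> B" if "x \<in> space (doubled I \<mu>)" for S x
    using that by (intro bound measurable_space[OF measurable_pick])
  have int: "integrable (doubled I \<mu>) (\<lambda>x. ?F S x * ?F T x)" for S T
  proof (rule D.integrable_const_bound[of _ "B * B"])
    show "AE x in doubled I \<mu>. norm (?F S x * ?F T x) \<le> B * B"
    proof (rule AE_I2)
      fix x assume "x \<in> space (doubled I \<mu>)"
      then show "norm (?F S x * ?F T x) \<le> B * B"
        using bd[of x S] bd[of x T] by (auto simp: abs_mult intro!: mult_mono)
    qed
  qed simp
  have sd1: "sym_diff {} {i} = {i}" "sym_diff A {i} = insert i A" "sym_diff (insert i A) {i} = A"
    "sym_diff {} A = A" "sym_diff {i} A = insert i A"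
    using insert.hyps by auto
  define d where "d = ?E (\<lambda>x. ?F {} x * ?F A x) - ?E (\<lambda>x. ?F {} x * ?F (insert i A) x)"
  have d1: "d = ?E (\<lambda>x. ?F {} x * (?F A x - ?F (insert i A) x))"
    unfolding d_def right_diff_distrib by (simp add: int)
  also have "\<dots> = ?E (\<lambda>x. ?F {} (swap_copies I {i} x) * (?F A (swap_copies I {i} x) - ?F (insert i A) (swap_copies I {i} x)))"
    by (rule integral_swap_copies[symmetric]) simp
  also have "\<dots> = ?E (\<lambda>x. ?F {i} x * (?F (insert i A) x - ?F A x))"
    unfolding pick_swap_copies sd1 ..
  finally have d2: "d = ?E (\<lambda>x. ?F {i} x * (?F (insert i A) x - ?F A x))" .
  \<comment> \<open>Adding the two expressions for \<open>d\<close> gives the mean of a product of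
    two increments in coordinate \<open>i\<close>: one with nothing else resampled, the other with
    \<open>A\<close> resampled. The elementary inequality
    \<open>2 * u * v \<le> u * u + v * v\<close> then separates them.\<close>
  have "2 * d = ?E (\<lambda>x. ?F {} x * (?F A x - ?F (insert i A) x)) + ?E (\<lambda>x. ?F {i} x * (?F (insert i A) x - ?F A x))"
    using d1 d2 by simp
  also have "\<dots> = ?E (\<lambda>x. ?F {} x * (?F A x - ?F (insert i A) x) + ?F {i} x * (?F (insert i A) x - ?F A x))"
    by (rule Bochner_Integration.integral_add[symmetric]) (auto simp: right_diff_distrib int)
  also have "\<dots> \<le> ?E (\<lambda>x. (?F {} x - ?F {i} x)\<^sup>2 / 2 + (?F A x - ?F (insert i A) x)\<^sup>2 / 2)"
  proof (rule integral_mono)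
    fix x
    show "?F {} x * (?F A x - ?F (insert i A) x) + ?F {i} x * (?F (insert i A) x - ?F A x)
        \<le> (?F {} x - ?F {i} x)\<^sup>2 / 2 + (?F A x - ?F (insert i A) x)\<^sup>2 / 2"
      using sum_squares_bound[of "?F {} x - ?F {i} x" "?F A x - ?F (insert i A) x"]
      by (simp add: algebra_simps)
  qed (auto simp: right_diff_distrib int power2_eq_square left_diff_distrib)
  also have "\<dots> = ?E (\<lambda>x. (?F {} x - ?F {i} x)\<^sup>2) / 2 + ?E (\<lambda>x. (?F A x - ?F (insert i A) x)\<^sup>2) / 2"
    by (subst Bochner_Integration.integral_add) (auto simp: right_diff_distrib int power2_eq_square left_diff_distrib)
  \<comment> \<open>Swapping along \<open>A\<close> carries the pair \<open>{}\<close>,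
    \<open>{i}\<close> to the pair \<open>A\<close>, \<open>insert i A\<close>, so both squares have
    the same mean.\<close>
  also have "?E (\<lambda>x. (?F A x - ?F (insert i A) x)\<^sup>2)
      = ?E (\<lambda>x. (?F {} (swap_copies I A x) - ?F {i} (swap_copies I A x))\<^sup>2)"
    unfolding pick_swap_copies sd1 ..
  also have "\<dots> = ?E (\<lambda>x. (?F {} x - ?F {i} x)\<^sup>2)"
    by (rule integral_swap_copies) simp
  finally have "d \<le> ?E (\<lambda>x. (?F {} x - ?F {i} x)\<^sup>2) / 2" by simp
  then show ?case
    using insert unfolding d_def by (simp add: add_divide_distrib)
qed

text \<open>Since \<open>f\<close> reads only \<open>J\<close>, resampling \<open>J\<close> has the
  same effect as resampling the whole, possibly infinite, index set. The telescoped difference over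
  the finite set \<open>J\<close> is therefore the second moment minus the squared mean.\<close>

theorem efron_stein:
  fixes f :: "('i \<Rightarrow> 'b) \<Rightarrow> real"
  assumes f[measurable]: "f \<in> borel_measurable (PiM I \<mu>)"
    and bound: "\<And>\<omega>. \<omega> \<in> space (PiM I \<mu>) \<Longrightarrow> \<bar>f \<omega>\<bar> \<le> B"
    and "finite J" "J \<subseteq> I"
    and local: "\<And>\<omega> \<omega>'. \<omega> \<in> space (PiM I \<mu>) \<Longrightarrow> \<omega>' \<in> space (PiM I \<mu>) \<Longrightarrow>
      (\<And>i. i \<in> J \<Longrightarrow> \<omega> i = \<omega>' i) \<Longrightarrow> f \<omega> = f \<omega>'"
  shows "P.variance f \<le> (\<Sum>i\<in>J. D.expectation (\<lambda>x. (f (pick I {} x) - f (pick I {i} x))\<^sup>2)) / 2"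
proof -
  have int: "integrable (PiM I \<mu>) f"
    by (rule P.integrable_const_bound[of _ B]) (auto intro: bound)
  have int2: "integrable (PiM I \<mu>) (\<lambda>x. (f x)\<^sup>2)"
    by (rule P.integrable_const_bound[of _ "B\<^sup>2"]) (auto intro: power_mono[OF bound, of _ 2, simplified])
  have "D.expectation (\<lambda>x. f (pick I {} x) * f (pick I {} x)) = P.expectation (\<lambda>x. (f x)\<^sup>2)"
    using integral_pick[of "\<lambda>\<omega>. f \<omega> * f \<omega>" "{}"] by (simp add: power2_eq_square)
  moreover have "D.expectation (\<lambda>x. f (pick I {} x) * f (pick I J x)) = D.expectation (\<lambda>x. f (pick I {} x) * f (pick I I x))"
  proof (rule Bochner_Integration.integral_cong[OF refl])
    fix x assume "x \<in> space (doubled I \<mu>)"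
    then have "f (pick I J x) = f (pick I I x)"
      using \<open>J \<subseteq> I\<close> by (intro local measurable_space[OF measurable_pick]) (auto simp: pick_def)
    then show "f (pick I {} x) * f (pick I J x) = f (pick I {} x) * f (pick I I x)" by simp
  qed
  ultimately show ?thesis
    using efron_stein_telescope[OF f bound \<open>finite J\<close>] integral_pick_mult_pick[OF f bound]
      P.variance_eq[OF int int2] by simp
qed

end

section \<open>Linear algebra in finitely generated subspaces\<close>

context vector_space
begin

lemma finite_of_independent_span:
  assumes "finite W" "S \<subseteq> span W" "independent S"
  shows "finite S" "card S \<le> card W"
  using independent_span_bound[OF assms(1,3,2)] by auto

lemma dim_mono_finite:
  assumes "finite W" "V \<subseteq> span W"
  shows "dim V \<le> dim W"
proof -
  obtain B where B: "B \<subseteq> W" "independent B" "W \<subseteq> span B" "card B = dim W"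
    by (rule basis_exists)
  have "V \<subseteq> span B"
    using assms(2) B(3) span_minimal[OF B(3) subspace_span] by blast
  then show ?thesis
    using dim_le_card[of V B] B finite_subset[OF B(1) assms(1)] by simp
qed

lemma dim_insert_finite:
  assumes "finite S"
  shows "dim (insert x S) = (if x \<in> span S then dim S else dim S + 1)"
proof (cases "x \<in> span S")
  case True
  then show ?thesis by (metis dim_span span_redundant)
next
  case False
  obtain B where B: "B \<subseteq> S" "independent B" "S \<subseteq> span B" "card B = dim S"
    by (rule basis_exists)
  have fin: "finite B" using B(1) assms by (rule finite_subset)
  have xB: "x \<notin> span B" using False span_mono[OF B(1)] by auto
  have "dim (insert x S) = card (insert x B)"
  proof (rule dim_unique)
    show "insert x B \<subseteq> insert x S" using B by auto
    show "insert x S \<subseteq> span (insert x B)"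
      using B(3) span_mono[of B "insert x B"] by (auto intro: span_base)
    show "independent (insert x B)" using B(2) xB by (rule independent_insertI[rotated])
  qed simp
  then show ?thesis
    using False B(4) fin xB span_base[of x B] by (auto simp: card_insert_if)
qed

text \<open>A vector that is new to the larger span is new to the smaller one. This is submodularity
  of a linear matroid, the source of all monotonicity in the probabilistic part.\<close>

lemma dim_insert_submodular:
  assumes "finite T" "S \<subseteq> T"
  shows "dim (insert x T) + dim S \<le> dim (insert x S) + dim T"
  using assms finite_subset[OF assms(2,1)] span_mono[OF assms(2)]
  by (auto simp: dim_insert_finite)

text \<open>Coefficients are indexed by \<open>K\<close> and not by the vectors, because
  \<open>v\<close> may identify indices: different cubes can have the same boundary, for instance
  the zero boundary of a vertex.\<close>

lemma in_span_image_finite: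
  assumes "finite K" "x \<in> span (v ` K)"
  shows "\<exists>u. x = (\<Sum>k\<in>K. scale (u k) (v k))"
  using assms
proof (induction K arbitrary: x)
  case (insert k K)
  then obtain c where "x - scale c (v k) \<in> span (v ` K)"
    by (auto simp: span_insert)
  with insert.IH obtain u where u: "x - scale c (v k) = (\<Sum>j\<in>K. scale (u j) (v j))"
    by blast
  have "(\<Sum>j\<in>K. scale ((u(k := c)) j) (v j)) = (\<Sum>j\<in>K. scale (u j) (v j))"
    using insert.hyps by (intro sum.cong) auto
  then have "x = (\<Sum>j\<in>insert k K. scale ((u(k := c)) j) (v j))"
    using insert.hyps u[symmetric] by simp
  then show ?case by blast
qed simp

end

context vector_space_pair
begin

lemma dim_image_le_finite:
  assumes f: "Vector_Spaces.linear s1 s2 f" and "finite W"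
  shows "vs2.dim (f ` W) \<le> vs1.dim W"
proof -
  interpret f: Vector_Spaces.linear s1 s2 f by fact
  obtain B where B: "B \<subseteq> W" "vs1.independent B" "W \<subseteq> vs1.span B" "card B = vs1.dim W"
    by (rule vs1.basis_exists)
  have fin: "finite B" using B(1) assms(2) by (rule finite_subset)
  have "f ` W \<subseteq> vs2.span (f ` B)"
    using B(3) by (auto simp: f.span_image)
  then have "vs2.dim (f ` W) \<le> card (f ` B)"
    using fin by (intro vs2.dim_le_card) auto
  also have "\<dots> \<le> card B" using fin by (rule card_image_le)
  finally show ?thesis using B by simp
qed

text \<open>Rank-nullity inside an infinite-dimensional ambient space. A basis \<open>A\<close> of
  the kernel within \<open>span B\<close> is extended to a basis \<open>E\<close>; \<open>f\<close>
  is injective on the span of \<open>E - A\<close> and kills \<open>A\<close>.\<close>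

lemma dim_kernel_plus_dim_image:
  assumes f: "Vector_Spaces.linear s1 s2 f" and B: "finite B" "vs1.independent B"
  shows "vs1.dim {x \<in> vs1.span B. f x = 0} + vs2.dim (f ` B) = card B"
proof -
  interpret f: Vector_Spaces.linear s1 s2 f by fact
  let ?Z = "{x \<in> vs1.span B. f x = 0}"
  obtain A where A: "A \<subseteq> ?Z" "vs1.independent A" "?Z \<subseteq> vs1.span A" "card A = vs1.dim ?Z"
    by (rule vs1.basis_exists)
  have "A \<subseteq> vs1.span B" using A(1) by auto
  then obtain E where E: "A \<subseteq> E" "E \<subseteq> vs1.span B" "vs1.independent E" "vs1.span B \<subseteq> vs1.span E"
    using vs1.maximal_independent_subset_extend[OF _ A(2)] by metis
  have finE: "finite E" using vs1.finite_of_independent_span[OF B(1) E(2,3)] by simp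
  have cardE: "card E = card B"
    using vs1.basis_card_eq_dim[OF E(2,4,3)] vs1.dim_span_eq_card_independent[OF B(2)] by simp
  let ?A' = "E - A"
  have ker: "x = 0" if x: "x \<in> vs1.span ?A'" "f x = 0" for x
  proof -
    have "x \<in> vs1.span E" using x(1) vs1.span_mono[of ?A' E] by auto
    also have "\<dots> \<subseteq> vs1.span B" using E(2) by (rule vs1.span_minimal) simp
    finally have xA: "x \<in> vs1.span A" using x A(3) by auto
    obtain u where u: "x = (\<Sum>a\<in>?A'. s1 (u a) a)"
      using vs1.in_span_image_finite[of ?A' x id] finE x(1) by auto
    obtain w where w: "x = (\<Sum>a\<in>A. s1 (w a) a)"
      using vs1.in_span_image_finite[of A x id] finite_subset[OF E(1) finE] xA by auto
    \<comment> \<open>A kernel vector in the span of \<open>E - A\<close> also lies in the span of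
      \<open>A\<close>. Subtracting its two expansions gives a linear relation on the independent
      set \<open>E\<close>, so all coefficients vanish.\<close>
    define g where "g a = (if a \<in> A then w a else - u a)" for a
    have "(\<Sum>a\<in>E. s1 (g a) a) = (\<Sum>a\<in>E - A. s1 (g a) a) + (\<Sum>a\<in>A. s1 (g a) a)"
      by (rule sum.subset_diff[OF E(1) finE])
    also have "(\<Sum>a\<in>E - A. s1 (g a) a) = - x"
      unfolding u by (simp add: g_def sum_negf)
    also have "(\<Sum>a\<in>A. s1 (g a) a) = x"
      unfolding w by (simp add: g_def)
    finally have "(\<Sum>a\<in>E. s1 (g a) a) = 0" by simp
    then have "g a = 0" if "a \<in> E" for a
      using E(3) finE that unfolding vs1.dependent_finite[OF finE] by blast
    then have "w a = 0" if "a \<in> A" for a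
      using that E(1) unfolding g_def by (metis subsetD)
    then show ?thesis using w by simp
  qed
  have "inj_on f (vs1.span ?A')"
  proof (rule inj_onI)
    fix x y assume "x \<in> vs1.span ?A'" "y \<in> vs1.span ?A'" "f x = f y"
    then have "x - y = 0" by (intro ker) (auto simp: vs1.span_diff f.diff)
    then show "x = y" by simp
  qed
  moreover have "vs1.independent ?A'"
    using E(3) by (rule vs1.independent_mono) auto
  ultimately have ind: "vs2.independent (f ` ?A')" and inj: "inj_on f ?A'"
    using f.dependent_inj_imageD vs1.span_superset[of ?A'] by (auto intro: inj_on_subset)
  have "vs2.dim (f ` B) = card (f ` ?A')"
  proof (rule vs2.dim_unique[where V = "vs2.span (f ` B)", simplified])
    show "f ` ?A' \<subseteq> vs2.span (f ` B)"
      using E(2) by (auto simp: f.span_image)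
    have 0: "f a = 0" if "a \<in> A" for a using A(1) that by auto
    have "f ` E \<subseteq> vs2.span (f ` ?A')"
    proof
      fix y assume "y \<in> f ` E"
      then obtain e where "e \<in> E" "y = f e" by auto
      then show "y \<in> vs2.span (f ` ?A')"
        using 0[of e] by (cases "e \<in> A") (auto intro: vs2.span_base vs2.span_zero)
    qed
    then have "vs2.span (f ` E) \<subseteq> vs2.span (f ` ?A')"
      by (rule vs2.span_minimal) simp
    then show "vs2.span (f ` B) \<subseteq> vs2.span (f ` ?A')"
      using E(4) by (auto simp: f.span_image)
    show "vs2.independent (f ` ?A')" by (rule ind)
  qed simp
  also have "\<dots> = card E - card A"
    using inj finE E(1) by (simp add: card_image card_Diff_subset finite_subset)
  finally show ?thesis
    using cardE A(4) card_mono[OF finE E(1)] by simp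
qed

end

global_interpretation rat_fun: vector_space "\<lambda>(a::rat) (f::'a \<Rightarrow> rat) x. a * f x"
  by unfold_locales (auto simp: fun_eq_iff algebra_simps)

global_interpretation rat_fun: vector_space_pair "\<lambda>(a::rat) (f::'a \<Rightarrow> rat) x. a * f x" "\<lambda>(a::rat) (f::'b \<Rightarrow> rat) x. a * f x"
  by unfold_locales

section \<open>Betti numbers as differences of ranks\<close>

abbreviation nondegenerate :: "cube \<Rightarrow> nat set" where
  "nondegenerate Q \<equiv> {i. i < length Q \<and> snd (Q ! i)}"

definition face :: "cube \<Rightarrow> nat \<Rightarrow> bool \<Rightarrow> cube" where
  "face Q i e = Q[i := (fst (Q ! i) + (if e then 1 else 0), False)]"

definition face_sign :: "cube \<Rightarrow> nat \<Rightarrow> int" where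
  "face_sign Q i = (-1) ^ card {j. j < i \<and> snd (Q ! j)}"

lemma length_face[simp]: "length (face Q i e) = length Q"
  by (simp add: face_def)

lemma bd_cube_eq:
  "bd_cube Q P = (\<Sum>i\<in>nondegenerate Q. face_sign Q i *
      ((if P = face Q i True then 1 else 0) - (if P = face Q i False then 1 else 0)))"
  by (simp add: bd_cube_def face_sign_def face_def)

lemma nondegenerate_face:
  "nondegenerate (face Q i e) = nondegenerate Q - {i}"
proof (intro set_eqI)
  fix x
  show "x \<in> nondegenerate (face Q i e) \<longleftrightarrow> x \<in> nondegenerate Q - {i}"
    by (cases "x = i") (auto simp: face_def)
qed

lemma cdim_face:
  assumes "i \<in> nondegenerate Q"
  shows "Suc (cdim (face Q i e)) = cdim Q"
proof -
  have "cdim (face Q i e) = card (nondegenerate Q - {i})"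
    unfolding cdim_def nondegenerate_face ..
  also have "Suc \<dots> = cdim Q"
    unfolding cdim_def using assms by (intro card_Suc_Diff1) auto
  finally show ?thesis .
qed

lemma face_commute: "i \<noteq> j \<Longrightarrow> face (face Q i e) j e' = face (face Q j e') i e"
  by (simp add: face_def list_update_swap)

text \<open>Collapsing direction \<open>i\<close> removes it from the directions counted before
  \<open>j\<close> exactly when \<open>i < j\<close>. This single sign change makes the boundary of
  a boundary vanish.\<close>

lemma face_sign_face:
  assumes "i \<in> nondegenerate Q" "j \<in> nondegenerate Q" "i \<noteq> j"
  shows "face_sign (face Q i e) j = (if i < j then - face_sign Q j else face_sign Q j)"
proof (cases "i < j")
  case True
  have "{k. k < j \<and> snd (face Q i e ! k)} = {k. k < j \<and> snd (Q ! k)} - {i}"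
    using assms by (auto simp: face_def nth_list_update)
  moreover have "card {k. k < j \<and> snd (Q ! k)} = Suc (card ({k. k < j \<and> snd (Q ! k)} - {i}))"
    using True assms by (intro card_Suc_Diff1[symmetric]) auto
  ultimately show ?thesis using True by (simp add: face_sign_def)
next
  case False
  then have "{k. k < j \<and> snd (face Q i e ! k)} = {k. k < j \<and> snd (Q ! k)}"
    by (auto simp: face_def nth_list_update)
  then show ?thesis using False by (simp add: face_sign_def)
qed

lemma cube_set_face:
  assumes "i \<in> nondegenerate Q"
  shows "cube_set (face Q i e) \<subseteq> cube_set Q"
proof
  fix p assume p: "p \<in> cube_set (face Q i e)"
  show "p \<in> cube_set Q"
    unfolding cube_set_def
  proof (intro CollectI conjI allI impI)
    show "length p = length Q" using p by (simp add: cube_set_def)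
    fix j assume j: "j < length Q"
    have "real_of_int (fst (face Q i e ! j)) \<le> p ! j"
      "p ! j \<le> real_of_int (fst (face Q i e ! j)) + (if snd (face Q i e ! j) then 1 else 0)"
      using p j by (auto simp: cube_set_def)
    then show "real_of_int (fst (Q ! j)) \<le> p ! j"
      "p ! j \<le> real_of_int (fst (Q ! j)) + (if snd (Q ! j) then 1 else 0)"
      using assms j by (auto simp: face_def nth_list_update split: if_splits)
  qed
qed

lemma face_in_cubes_in:
  assumes "Q \<in> cubes_in d (Suc k) S" "i \<in> nondegenerate Q"
  shows "face Q i e \<in> cubes_in d k S"
  using assms cube_set_face[OF assms(2), of e] cdim_face[OF assms(2), of e] by (auto simp: cubes_in_def)

lemma bd_cube_nonzero_face:
  assumes "bd_cube Q P \<noteq> 0"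
  shows "\<exists>i\<in>nondegenerate Q. \<exists>e. P = face Q i e"
proof (rule ccontr)
  assume "\<not> ?thesis"
  then have "bd_cube Q P = 0"
    unfolding bd_cube_eq by (intro sum.neutral) auto
  with assms show False by simp
qed

lemma sum_bd_cube_mult:
  fixes g :: "cube \<Rightarrow> int"
  assumes "finite K" "\<And>i e. i \<in> nondegenerate Q \<Longrightarrow> face Q i e \<in> K"
  shows "(\<Sum>P\<in>K. bd_cube Q P * g P)
    = (\<Sum>i\<in>nondegenerate Q. face_sign Q i * (g (face Q i True) - g (face Q i False)))"
proof -
  have "(\<Sum>P\<in>K. bd_cube Q P * g P) = (\<Sum>P\<in>K. \<Sum>i\<in>nondegenerate Q. face_sign Q i *
      ((if P = face Q i True then g P else 0) - (if P = face Q i False then g P else 0)))"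
    unfolding bd_cube_eq sum_distrib_right
    by (intro sum.cong refl) (auto simp: algebra_simps)
  also have "\<dots> = (\<Sum>i\<in>nondegenerate Q. \<Sum>P\<in>K. face_sign Q i *
      ((if P = face Q i True then g P else 0) - (if P = face Q i False then g P else 0)))"
    by (rule sum.swap)
  also have "\<dots> = (\<Sum>i\<in>nondegenerate Q. face_sign Q i * (g (face Q i True) - g (face Q i False)))"
    using assms by (intro sum.cong refl) (simp add: sum_subtractf flip: sum_distrib_left)
  finally show ?thesis .
qed

text \<open>A face of codimension two is reached by collapsing two directions in either order, with
  opposite signs. The double sum over pairs of directions is thus antisymmetric and equals its own
  negative.\<close>

lemma bd_cube_bd_cube:
  assumes "finite K" "\<And>i e. i \<in> nondegenerate Q \<Longrightarrow> face Q i e \<in> K"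
  shows "(\<Sum>P\<in>K. bd_cube Q P * bd_cube P R) = 0"
proof -
  let ?D = "nondegenerate Q"
  define ind :: "bool \<Rightarrow> bool \<Rightarrow> nat \<Rightarrow> nat \<Rightarrow> int"
    where "ind e e' i j = (if R = face (face Q i e) j e' then 1 else 0)" for e e' i j
  define T where "T i j = ind True True i j - ind True False i j - ind False True i j + ind False False i j" for i j
  define a where "a i j = (if i = j then 0 else face_sign Q i * face_sign Q j * (if i < j then -1 else 1) * T i j)" for i j
  have sym: "a i j = - a j i" for i j
  proof (cases "i = j")
    case False
    have "ind e e' i j = ind e' e j i" for e e'
      unfolding ind_def face_commute[OF False] ..
    then have "T i j = T j i" by (simp add: T_def)
    then show ?thesis using False by (simp add: a_def)
  qed (simp add: a_def)
  have bdf: "bd_cube (face Q i e) R = (\<Sum>j\<in>?D - {i}. (if i < j then - face_sign Q j else face_sign Q j) * (ind e True i j - ind e False i j))"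
    if "i \<in> ?D" for i e
    unfolding bd_cube_eq nondegenerate_face ind_def
    using that by (intro sum.cong refl) (subst face_sign_face, auto)
  have "(\<Sum>P\<in>K. bd_cube Q P * bd_cube P R) = (\<Sum>i\<in>?D. face_sign Q i * (bd_cube (face Q i True) R - bd_cube (face Q i False) R))"
    by (rule sum_bd_cube_mult) (use assms in auto)
  also have "\<dots> = (\<Sum>i\<in>?D. \<Sum>j\<in>?D. a i j)"
  proof (rule sum.cong[OF refl])
    fix i assume i: "i \<in> ?D"
    have "face_sign Q i * (bd_cube (face Q i True) R - bd_cube (face Q i False) R) = (\<Sum>j\<in>?D - {i}. a i j)"
      unfolding bdf[OF i] sum_subtractf[symmetric] sum_distrib_left
      by (intro sum.cong refl) (auto simp: a_def T_def algebra_simps)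
    also have "\<dots> = (\<Sum>j\<in>?D. a i j)"
      using i by (subst sum.remove[of ?D i]) (auto simp: a_def)
    finally show "face_sign Q i * (bd_cube (face Q i True) R - bd_cube (face Q i False) R) = (\<Sum>j\<in>?D. a i j)" .
  qed
  finally have eq: "(\<Sum>P\<in>K. bd_cube Q P * bd_cube P R) = (\<Sum>i\<in>?D. \<Sum>j\<in>?D. a i j)" .
  have "(\<Sum>i\<in>?D. \<Sum>j\<in>?D. a i j) = (\<Sum>i\<in>?D. \<Sum>j\<in>?D. - a j i)"
    by (intro sum.cong refl sym)
  also have "\<dots> = - (\<Sum>i\<in>?D. \<Sum>j\<in>?D. a i j)"
    unfolding sum_negf by (subst sum.swap) simp
  finally show ?thesis using eq by simp
qed

section \<open>Rational chains and the rank of homology\<close>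

definition bd_vec :: "cube \<Rightarrow> cube \<Rightarrow> rat" where
  "bd_vec Q P = of_int (bd_cube Q P)"

text \<open>The boundary vectors live in the space of all rational functions on cubes, so the rank
  makes sense for any set \<open>S\<close>, whether or not it is closed under faces. Submodularity
  would not be usable if only complexes were allowed, since cubes are added one at a time.\<close>

definition bd_rank :: "nat \<Rightarrow> cube set \<Rightarrow> nat" where
  "bd_rank k S = rat_fun.dim (bd_vec ` {Q\<in>S. cdim Q = k})"

definition rat_chain :: "('a \<Rightarrow> int) \<Rightarrow> 'a \<Rightarrow> rat" where
  "rat_chain c Q = of_int (c Q)"

lemma common_denominator:
  fixes u :: "'a \<Rightarrow> rat"
  assumes "finite K"
  shows "\<exists>N::int. N > 0 \<and> (\<forall>k\<in>K. \<exists>z::int. of_int N * u k = of_int z)"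
  using assms
proof induction
  case empty
  then show ?case by (intro exI[of _ 1]) auto
next
  case (insert k K)
  then obtain N :: int where N: "N > 0" "\<And>j. j \<in> K \<Longrightarrow> \<exists>z::int. of_int N * u j = of_int z"
    by auto
  obtain a b where ab: "u k = Fract a b" "b > 0"
    by (metis Rat_cases)
  have "\<exists>z::int. of_int (N * b) * u j = of_int z" if j: "j \<in> insert k K" for j
  proof (cases "j = k")
    case True
    have "of_int (N * b) * u k = of_int (N * a)"
      using ab by (simp add: Fract_of_int_quotient)
    then show ?thesis using True by blast
  next
    case False
    then obtain z :: int where z: "of_int N * u j = of_int z"
      using N(2)[of j] j by blast
    have "of_int (N * b) * u j = of_int b * (of_int N * u j)"
      by simp
    also have "\<dots> = of_int (b * z)" by (simp add: z)
    finally show ?thesis by blast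
  qed
  moreover have "N * b > 0" using N(1) ab(2) by simp
  ultimately show ?case by blast
qed

lemma bd_eq_sum:
  assumes "finite K" "\<And>Q. c Q \<noteq> 0 \<Longrightarrow> Q \<in> K"
  shows "bd c P = (\<Sum>Q\<in>K. c Q * bd_cube Q P)"
  unfolding bd_def using assms by (intro sum.mono_neutral_left) auto

locale finite_cubical =
  fixes d q :: nat and S :: "real list set"
  assumes finite_q: "finite (cubes_in d q S)" and finite_Suc_q: "finite (cubes_in d (Suc q) S)"
begin

abbreviation "K \<equiv> cubes_in d q S"
abbreviation "K' \<equiv> cubes_in d (Suc q) S"

text \<open>Values outside \<open>K\<close> are ignored, so the map is linear on the whole function
  space; membership in the span of the unit chains is imposed separately in
  \<open>rat_cycles\<close>.\<close>

definition rat_bd :: "(cube \<Rightarrow> rat) \<Rightarrow> cube \<Rightarrow> rat" where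
  "rat_bd x = (\<Sum>Q\<in>K. (\<lambda>P. x Q * bd_vec Q P))"

definition unit_chain :: "cube \<Rightarrow> cube \<Rightarrow> rat" where
  "unit_chain Q P = (if P = Q then 1 else 0)"

definition rat_cycles :: "(cube \<Rightarrow> rat) set" where
  "rat_cycles = {x \<in> rat_fun.span (unit_chain ` K). rat_bd x = 0}"

abbreviation bds :: "(cube \<Rightarrow> rat) set" where
  "bds \<equiv> bd_vec ` K'"

lemma sum_fun_apply: "(\<Sum>a\<in>A. f a) x = (\<Sum>a\<in>A. f a x)" for f :: "'b \<Rightarrow> 'c \<Rightarrow> rat"
  by (induction A rule: infinite_finite_induct) auto

lemma rat_bd_apply: "rat_bd x P = (\<Sum>Q\<in>K. x Q * bd_vec Q P)"
  by (simp add: rat_bd_def sum_fun_apply)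

lemma linear_rat_bd: "Vector_Spaces.linear (\<lambda>a f x. a * f x) (\<lambda>a f x. a * f x) rat_bd"
  by (intro Vector_Spaces.linear.intro module_hom.intro module_hom_axioms.intro
        rat_fun.module_axioms rat_fun.vector_space_axioms)
     (auto simp: fun_eq_iff rat_bd_apply sum.distrib sum_distrib_left algebra_simps)

lemma span_unit_chain: "rat_fun.span (unit_chain ` K) = {x. \<forall>Q. x Q \<noteq> 0 \<longrightarrow> Q \<in> K}"
proof (intro set_eqI iffI CollectI allI impI)
  fix x Q assume x: "x \<in> rat_fun.span (unit_chain ` K)" and "x Q \<noteq> 0"
  obtain u where "x = (\<Sum>k\<in>K. (\<lambda>P. u k * unit_chain k P))"
    using rat_fun.in_span_image_finite[OF finite_q x] by auto
  then have "x Q = (\<Sum>k\<in>K. u k * unit_chain k Q)"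
    by (simp add: sum_fun_apply)
  with \<open>x Q \<noteq> 0\<close> have "(\<Sum>k\<in>K. u k * unit_chain k Q) \<noteq> 0" by simp
  then obtain k where "k \<in> K" "u k * unit_chain k Q \<noteq> 0"
    by (rule sum.not_neutral_contains_not_neutral)
  then show "Q \<in> K" by (auto simp: unit_chain_def split: if_splits)
next
  fix x :: "cube \<Rightarrow> rat" assume x: "x \<in> {x. \<forall>Q. x Q \<noteq> 0 \<longrightarrow> Q \<in> K}"
  have "x = (\<Sum>k\<in>K. (\<lambda>P. x k * unit_chain k P))"
  proof
    fix P
    have "(\<Sum>k\<in>K. (\<lambda>P. x k * unit_chain k P)) P = (\<Sum>k\<in>K. if P = k then x k else 0)"
      unfolding sum_fun_apply by (intro sum.cong) (auto simp: unit_chain_def)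
    also have "\<dots> = (if P \<in> K then x P else 0)"
      using finite_q by (simp add: sum.delta')
    also have "\<dots> = x P" using x by auto
    finally show "x P = (\<Sum>k\<in>K. (\<lambda>P. x k * unit_chain k P)) P" ..
  qed
  also have "\<dots> \<in> rat_fun.span (unit_chain ` K)"
    by (intro rat_fun.span_sum rat_fun.span_scale rat_fun.span_base) auto
  finally show "x \<in> rat_fun.span (unit_chain ` K)" .
qed

lemma inj_unit_chain: "inj unit_chain"
proof (rule injI)
  fix Q R assume "unit_chain Q = unit_chain R"
  from fun_cong[OF this, of Q] show "Q = R"
    by (simp add: unit_chain_def split: if_splits)
qed

lemma independent_unit_chain: "rat_fun.independent (unit_chain ` K)"
proof -
  have "u k = 0" if sum0: "(\<Sum>v\<in>unit_chain ` K. (\<lambda>P. u v * v P)) = 0" and k: "k \<in> unit_chain ` K" for u k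
  proof -
    obtain Q where Q: "Q \<in> K" "k = unit_chain Q" using k by auto
    have "0 = (\<Sum>v\<in>unit_chain ` K. (\<lambda>P. u v * v P)) Q"
      using sum0 by simp
    also have "\<dots> = (\<Sum>R\<in>K. u (unit_chain R) * unit_chain R Q)"
      unfolding sum_fun_apply by (subst sum.reindex) (auto intro: inj_on_subset[OF inj_unit_chain])
    also have "\<dots> = u k"
      using Q finite_q by (simp add: unit_chain_def if_distrib[of "\<lambda>y. _ * y"] sum.delta' cong: if_cong)
    finally show ?thesis by simp
  qed
  then show ?thesis
    using finite_q by (subst rat_fun.dependent_finite) auto
qed

lemma rat_bd_unit_chain: "Q \<in> K \<Longrightarrow> rat_bd (unit_chain Q) = bd_vec Q"
  using finite_q by (auto simp: fun_eq_iff rat_bd_apply unit_chain_def if_distrib[of "\<lambda>y. y * _"] sum.delta cong: if_cong)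

lemma filter_cdim: "{Q \<in> cubes_in d k S. cdim Q = k} = cubes_in d k S"
  by (auto simp: cubes_in_def)

lemma dim_rat_cycles: "rat_fun.dim rat_cycles + bd_rank q K = card K"
proof -
  have "rat_bd ` unit_chain ` K = bd_vec ` K"
    using rat_bd_unit_chain by (auto simp: image_iff)
  moreover have "rat_fun.dim rat_cycles + rat_fun.dim (rat_bd ` unit_chain ` K) = card (unit_chain ` K)"
    unfolding rat_cycles_def using finite_q
    by (intro rat_fun.dim_kernel_plus_dim_image linear_rat_bd independent_unit_chain) auto
  moreover have "card (unit_chain ` K) = card K"
    by (intro card_image inj_on_subset[OF inj_unit_chain]) auto
  ultimately show ?thesis by (simp add: bd_rank_def filter_cdim)
qed

lemma bds_subset_rat_cycles: "bds \<subseteq> rat_cycles"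
proof
  fix y assume "y \<in> bds"
  then obtain Q where Q: "Q \<in> K'" "y = bd_vec Q" by auto
  have face: "face Q i e \<in> K" if "i \<in> nondegenerate Q" for i e
    using face_in_cubes_in[OF Q(1) that] .
  have "P \<in> K" if "y P \<noteq> 0" for P
    using that bd_cube_nonzero_face[of Q P] face by (auto simp: Q(2) bd_vec_def)
  moreover have "rat_bd y P = 0" for P
  proof -
    have "rat_bd y P = of_int (\<Sum>R\<in>K. bd_cube Q R * bd_cube R P)"
      by (simp add: rat_bd_apply Q(2) bd_vec_def)
    also have "\<dots> = 0" by (simp only: bd_cube_bd_cube[OF finite_q face] of_int_0)
    finally show ?thesis .
  qed
  ultimately show "y \<in> rat_cycles"
    unfolding rat_cycles_def span_unit_chain by (auto simp: fun_eq_iff)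
qed

lemma subspace_rat_cycles: "rat_fun.subspace rat_cycles"
proof -
  interpret b: Vector_Spaces.linear "\<lambda>a f x. a * f x" "\<lambda>a f x. a * f x" rat_bd
    by (rule linear_rat_bd)
  show ?thesis
    unfolding rat_cycles_def
    by (intro rat_fun.subspaceI)
       (auto simp: rat_fun.span_zero rat_fun.span_add rat_fun.span_scale b.add b.scale b.zero)
qed

lemma rat_chain_cycles:
  "rat_chain c \<in> rat_cycles \<longleftrightarrow> c \<in> cycles d q S"
proof -
  have "c \<in> chains d q S \<longleftrightarrow> (\<forall>Q. c Q \<noteq> 0 \<longrightarrow> Q \<in> K)"
    using finite_subset[OF _ finite_q, of "{Q. c Q \<noteq> 0}"] by (auto simp: chains_def)
  moreover have "rat_bd (rat_chain c) P = of_int (bd c P)" if "\<forall>Q. c Q \<noteq> 0 \<longrightarrow> Q \<in> K" for P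
    using that by (simp add: rat_bd_apply rat_chain_def bd_vec_def bd_eq_sum[OF finite_q])
  ultimately show ?thesis
    unfolding rat_cycles_def cycles_def span_unit_chain by (auto simp: rat_chain_def fun_eq_iff)
qed

lemma rat_chain_boundary:
  assumes "b \<in> boundaries d q S"
  shows "rat_chain b \<in> rat_fun.span bds"
proof -
  obtain c where c: "c \<in> chains d (Suc q) S" "b = bd c"
    using assms by (auto simp: boundaries_def)
  have "rat_chain b = (\<Sum>Q\<in>K'. (\<lambda>P. of_int (c Q) * bd_vec Q P))"
    using c bd_eq_sum[OF finite_Suc_q, of c] by (auto simp: fun_eq_iff sum_fun_apply rat_chain_def bd_vec_def chains_def)
  also have "\<dots> \<in> rat_fun.span bds"
    by (intro rat_fun.span_sum rat_fun.span_scale rat_fun.span_base) auto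
  finally show ?thesis .
qed

text \<open>Clearing denominators turns a rational boundary into an integral one. Torsion in the
  quotient is therefore invisible to linear independence modulo boundaries.\<close>

lemma multiple_in_boundaries:
  assumes "y \<in> rat_fun.span bds"
  shows "\<exists>N::int. N > 0 \<and> (\<exists>b\<in>boundaries d q S. \<forall>P. of_int N * y P = of_int (b P))"
proof -
  obtain u where u: "y = (\<Sum>Q\<in>K'. (\<lambda>P. u Q * bd_vec Q P))"
    using rat_fun.in_span_image_finite[OF finite_Suc_q assms] by auto
  obtain N :: int where N: "N > 0" "\<forall>k\<in>K'. \<exists>z::int. of_int N * u k = of_int z"
    using common_denominator[OF finite_Suc_q] by blast
  then obtain z :: "cube \<Rightarrow> int" where z: "\<And>k. k \<in> K' \<Longrightarrow> of_int N * u k = of_int (z k)"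
    by metis
  define c where "c Q = (if Q \<in> K' then z Q else 0)" for Q
  have c: "c \<in> chains d (Suc q) S"
    unfolding chains_def
  proof (intro CollectI conjI allI impI)
    show supp: "Q \<in> K'" if "c Q \<noteq> 0" for Q
      using that by (auto simp: c_def split: if_splits)
    show "finite {Q. c Q \<noteq> 0}"
      by (rule finite_subset[OF _ finite_Suc_q]) (use supp in auto)
  qed
  have "of_int N * y P = of_int (bd c P)" for P
  proof -
    have "of_int N * y P = (\<Sum>Q\<in>K'. (of_int N * u Q) * bd_vec Q P)"
      by (simp add: u sum_fun_apply sum_distrib_left mult.assoc)
    also have "\<dots> = (\<Sum>Q\<in>K'. of_int (c Q * bd_cube Q P))"
      by (intro sum.cong) (auto simp: z c_def bd_vec_def)
    also have "\<dots> = of_int (bd c P)"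
      by (subst bd_eq_sum[OF finite_Suc_q]) (auto simp: c_def split: if_splits)
    finally show ?thesis .
  qed
  with N(1) c show ?thesis
    unfolding boundaries_def by blast
qed

definition indep_mod_boundaries :: "(cube \<Rightarrow> int) list \<Rightarrow> bool" where
  "indep_mod_boundaries zs \<longleftrightarrow> set zs \<subseteq> cycles d q S \<and>
      (\<forall>cs. length cs = length zs \<and> lincomb cs zs \<in> boundaries d q S \<longrightarrow> set cs \<subseteq> {0})"

lemma lincomb_append: "length cs = length zs \<Longrightarrow> lincomb (cs @ [c]) (zs @ [z]) = (\<lambda>Q. lincomb cs zs Q + c * z Q)"
  by (auto simp: lincomb_def nth_append fun_eq_iff)

lemma in_span_bds_list:
  assumes "x \<in> rat_fun.span (bds \<union> rat_chain ` set zs)"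
  shows "\<exists>u. x - (\<Sum>i<length zs. (\<lambda>P. u i * rat_chain (zs ! i) P)) \<in> rat_fun.span bds"
  using assms
proof (induction zs arbitrary: x rule: rev_induct)
  case Nil
  then show ?case by (simp add: zero_fun_def)
next
  case (snoc z zs)
  then have "x \<in> rat_fun.span (insert (rat_chain z) (bds \<union> rat_chain ` set zs))"
    by simp
  then obtain c where "x - (\<lambda>P. c * rat_chain z P) \<in> rat_fun.span (bds \<union> rat_chain ` set zs)"
    unfolding rat_fun.span_insert by auto
  then obtain u where u: "x - (\<lambda>P. c * rat_chain z P) - (\<Sum>i<length zs. (\<lambda>P. u i * rat_chain (zs ! i) P)) \<in> rat_fun.span bds"
    using snoc.IH by blast
  have "(\<Sum>i<length (zs @ [z]). (\<lambda>P. (u(length zs := c)) i * rat_chain ((zs @ [z]) ! i) P))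
      = (\<Sum>i<length zs. (\<lambda>P. u i * rat_chain (zs ! i) P)) + (\<lambda>P. c * rat_chain z P)"
    by (auto simp: nth_append intro!: sum.cong)
  then have "x - (\<Sum>i<length (zs @ [z]). (\<lambda>P. (u(length zs := c)) i * rat_chain ((zs @ [z]) ! i) P)) \<in> rat_fun.span bds"
    using u by (simp add: algebra_simps)
  then show ?case by blast
qed

lemma rat_chain_lincomb_in_span:
  "length cs = length zs \<Longrightarrow> rat_chain (lincomb cs zs) \<in> rat_fun.span (bds \<union> rat_chain ` set zs)"
proof -
  assume "length cs = length zs"
  have "rat_chain (lincomb cs zs) = (\<Sum>i<length zs. (\<lambda>P. of_int (cs ! i) * rat_chain (zs ! i) P))"
    by (simp add: fun_eq_iff sum_fun_apply lincomb_def rat_chain_def)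
  also have "\<dots> \<in> rat_fun.span (bds \<union> rat_chain ` set zs)"
    by (intro rat_fun.span_sum rat_fun.span_scale rat_fun.span_base) auto
  finally show ?thesis .
qed

text \<open>Integral independence in the quotient is translated into a rational condition on one new
  cycle at a time. Each admissible cycle then raises a rational dimension by exactly one, which
  turns the supremum in \<open>betti\<close> into a dimension count.\<close>

lemma indep_mod_boundaries_snoc:
  "indep_mod_boundaries (zs @ [z]) \<longleftrightarrow> indep_mod_boundaries zs \<and> z \<in> cycles d q S \<and>
     rat_chain z \<notin> rat_fun.span (bds \<union> rat_chain ` set zs)"
proof (intro iffI conjI; (elim conjE)?)
  assume ind: "indep_mod_boundaries (zs @ [z])"
  show "z \<in> cycles d q S" using ind by (simp add: indep_mod_boundaries_def)
  have "set cs \<subseteq> {0}" if "length cs = length zs" "lincomb cs zs \<in> boundaries d q S" for cs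
  proof -
    have "lincomb (cs @ [0]) (zs @ [z]) \<in> boundaries d q S"
      using that by (simp add: lincomb_append)
    then have "set (cs @ [0]) \<subseteq> {0}"
      using ind that(1) unfolding indep_mod_boundaries_def by (metis length_append_singleton)
    then show ?thesis by simp
  qed
  then show "indep_mod_boundaries zs"
    using ind by (auto simp: indep_mod_boundaries_def)
  show "rat_chain z \<notin> rat_fun.span (bds \<union> rat_chain ` set zs)"
  proof
    assume "rat_chain z \<in> rat_fun.span (bds \<union> rat_chain ` set zs)"
    from in_span_bds_list[OF this] obtain u
      where u: "rat_chain z - (\<Sum>i<length zs. (\<lambda>P. u i * rat_chain (zs ! i) P)) \<in> rat_fun.span bds" ..
    obtain N :: int where N: "N > 0" "\<forall>i\<in>{..<length zs}. \<exists>w::int. of_int N * u i = of_int w"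
      using common_denominator[of "{..<length zs}" u] by auto
    then obtain w :: "nat \<Rightarrow> int" where w: "\<And>i. i < length zs \<Longrightarrow> of_int N * u i = of_int (w i)"
      by (metis lessThan_iff)
    obtain N' :: int and b where N': "N' > 0" "b \<in> boundaries d q S"
      "\<And>P. of_int N' * (rat_chain z - (\<Sum>i<length zs. (\<lambda>P. u i * rat_chain (zs ! i) P))) P = of_int (b P)"
      using multiple_in_boundaries[OF u] by blast
    obtain c where c: "c \<in> chains d (Suc q) S" "b = bd c"
      using N'(2) by (auto simp: boundaries_def)
    \<comment> \<open>\<open>N\<close> clears the denominators of the coefficients \<open>u\<close>,
      and \<open>N'\<close> those of the boundary. Multiplying the rational relation by
      \<open>N * N'\<close> gives an integral one whose last coefficient \<open>N * N'\<close> is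
      nonzero.\<close>
    define cs where "cs = map (\<lambda>i. - (N' * w i)) [0..<length zs]"
    have "lincomb (cs @ [N * N']) (zs @ [z]) = (\<lambda>P. N * b P)"
    proof
      fix P
      have "(of_int (lincomb (cs @ [N * N']) (zs @ [z]) P) :: rat)
          = of_int N * (of_int N' * rat_chain z P) - (\<Sum>i<length zs. of_int N' * of_int (w i) * rat_chain (zs ! i) P)"
        by (simp add: lincomb_append cs_def) (simp add: lincomb_def rat_chain_def sum_negf)
      also have "(\<Sum>i<length zs. of_int N' * of_int (w i) * rat_chain (zs ! i) P)
          = (\<Sum>i<length zs. of_int N * (of_int N' * (u i * rat_chain (zs ! i) P)))"
        by (intro sum.cong refl) (simp add: w[symmetric])
      also have "of_int N * (of_int N' * rat_chain z P) - \<dots> = of_int N * (of_int N' * (rat_chain z - (\<Sum>i<length zs. (\<lambda>P. u i * rat_chain (zs ! i) P))) P)"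
        by (simp add: sum_fun_apply right_diff_distrib sum_distrib_left)
      also have "\<dots> = of_int (N * b P)" unfolding N'(3) by simp
      finally show "lincomb (cs @ [N * N']) (zs @ [z]) P = N * b P"
        by (simp only: of_int_eq_iff)
    qed
    also have "\<dots> = bd (\<lambda>Q. N * c Q)"
    proof
      fix P
      have "finite {Q. c Q \<noteq> 0}" using c by (simp add: chains_def)
      then show "N * b P = bd (\<lambda>Q. N * c Q) P"
        unfolding c(2) by (subst (1 2) bd_eq_sum[of "{Q. c Q \<noteq> 0}"]) (auto simp: sum_distrib_left mult.assoc)
    qed
    also have "\<dots> \<in> boundaries d q S"
    proof -
      have "{Q. N * c Q \<noteq> 0} = {Q. c Q \<noteq> 0}" using N(1) by auto
      then have "(\<lambda>Q. N * c Q) \<in> chains d (Suc q) S"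
        using c(1) by (auto simp: chains_def)
      then show ?thesis by (auto simp: boundaries_def)
    qed
    finally have "set (cs @ [N * N']) \<subseteq> {0}"
      using ind unfolding indep_mod_boundaries_def
      by (metis (no_types, lifting) cs_def length_append_singleton length_map length_upt minus_nat.diff_0)
    then show False using N(1) N'(1) by simp
  qed
next
  assume ind: "indep_mod_boundaries zs" and z: "z \<in> cycles d q S"
    and span: "rat_chain z \<notin> rat_fun.span (bds \<union> rat_chain ` set zs)"
  show "indep_mod_boundaries (zs @ [z])"
    unfolding indep_mod_boundaries_def
  proof (intro conjI allI impI; (elim conjE)?)
    show "set (zs @ [z]) \<subseteq> cycles d q S"
      using ind z by (simp add: indep_mod_boundaries_def)
    fix cs :: "int list" assume len: "length cs = length (zs @ [z])" and lc: "lincomb cs (zs @ [z]) \<in> boundaries d q S"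
    obtain cs' c where cs: "cs = cs' @ [c]"
      using len by (cases cs rule: rev_cases) auto
    have len': "length cs' = length zs" using len cs by simp
    \<comment> \<open>Otherwise dividing by \<open>c\<close> would put the new cycle into the
      rational span of the boundaries and the earlier cycles.\<close>
    have "c = 0"
    proof (rule ccontr)
      assume "c \<noteq> 0"
      have "rat_chain (lincomb cs (zs @ [z])) \<in> rat_fun.span (bds \<union> rat_chain ` set zs)"
        using rat_chain_boundary[OF lc] rat_fun.span_mono[of bds "bds \<union> rat_chain ` set zs"] by auto
      then have "rat_chain (lincomb cs (zs @ [z])) - rat_chain (lincomb cs' zs) \<in> rat_fun.span (bds \<union> rat_chain ` set zs)"
        by (intro rat_fun.span_diff rat_chain_lincomb_in_span len')
      then have "(\<lambda>P. inverse (of_int c) * (rat_chain (lincomb cs (zs @ [z])) - rat_chain (lincomb cs' zs)) P) \<in> rat_fun.span (bds \<union> rat_chain ` set zs)"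
        by (rule rat_fun.span_scale)
      moreover have "(\<lambda>P. inverse (of_int c) * (rat_chain (lincomb cs (zs @ [z])) - rat_chain (lincomb cs' zs)) P) = rat_chain z"
        using \<open>c \<noteq> 0\<close> by (auto simp: cs fun_eq_iff lincomb_append[OF len'] rat_chain_def)
      ultimately show False using span by simp
    qed
    then have "lincomb cs' zs \<in> boundaries d q S"
      using lc by (simp add: cs lincomb_append[OF len'])
    then show "set cs \<subseteq> {0}"
      using ind len' \<open>c = 0\<close> unfolding indep_mod_boundaries_def cs by auto
  qed
qed

lemma dim_indep_mod_boundaries:
  assumes "indep_mod_boundaries zs"
  shows "rat_fun.dim (bds \<union> rat_chain ` set zs) = rat_fun.dim bds + length zs"
  using assms
proof (induction zs rule: rev_induct)
  case (snoc z zs)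
  then have *: "indep_mod_boundaries zs" "rat_chain z \<notin> rat_fun.span (bds \<union> rat_chain ` set zs)"
    by (metis indep_mod_boundaries_snoc)+
  have "rat_fun.dim (insert (rat_chain z) (bds \<union> rat_chain ` set zs)) = rat_fun.dim (bds \<union> rat_chain ` set zs) + 1"
    using * finite_Suc_q by (subst rat_fun.dim_insert_finite) auto
  then show ?case using snoc.IH[OF *(1)] by simp
qed simp

lemma span_bds_list_subset:
  assumes "indep_mod_boundaries zs"
  shows "rat_fun.span (bds \<union> rat_chain ` set zs) \<subseteq> rat_cycles"
proof (rule rat_fun.span_minimal[OF _ subspace_rat_cycles])
  show "bds \<union> rat_chain ` set zs \<subseteq> rat_cycles"
    using assms bds_subset_rat_cycles rat_chain_cycles by (auto simp: indep_mod_boundaries_def)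
qed

lemma length_indep_mod_boundaries_le:
  assumes "indep_mod_boundaries zs"
  shows "rat_fun.dim bds + length zs \<le> rat_fun.dim rat_cycles"
proof -
  have sub: "rat_cycles \<subseteq> rat_fun.span (unit_chain ` K)" by (auto simp: rat_cycles_def)
  obtain Z where Z: "Z \<subseteq> rat_cycles" "rat_fun.independent Z" "rat_cycles \<subseteq> rat_fun.span Z" "card Z = rat_fun.dim rat_cycles"
    by (rule rat_fun.basis_exists)
  have "finite Z"
    using rat_fun.finite_of_independent_span(1)[OF _ _ Z(2), of "unit_chain ` K"] finite_q Z(1) sub by auto
  have "bds \<union> rat_chain ` set zs \<subseteq> rat_fun.span Z"
    using span_bds_list_subset[OF assms] Z(3) rat_fun.span_superset[of "bds \<union> rat_chain ` set zs"] by blast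
  then have "rat_fun.dim (bds \<union> rat_chain ` set zs) \<le> card Z"
    using \<open>finite Z\<close> by (rule rat_fun.dim_le_card)
  then show ?thesis using dim_indep_mod_boundaries[OF assms] Z(4) by simp
qed

text \<open>While the dimension is not exhausted, some rational cycle lies outside the current span.
  Scaling it to an integral cycle does not move it into the span, so the list can be
  extended.\<close>

lemma exists_indep_mod_boundaries:
  assumes "rat_fun.dim bds + m \<le> rat_fun.dim rat_cycles"
  shows "\<exists>zs. indep_mod_boundaries zs \<and> length zs = m"
  using assms
proof (induction m)
  case 0
  then show ?case by (intro exI[of _ "[]"]) (simp add: indep_mod_boundaries_def)
next
  case (Suc m)
  then obtain zs where zs: "indep_mod_boundaries zs" "length zs = m" by auto
  have "\<not> rat_cycles \<subseteq> rat_fun.span (bds \<union> rat_chain ` set zs)"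
  proof
    assume "rat_cycles \<subseteq> rat_fun.span (bds \<union> rat_chain ` set zs)"
    then have "rat_fun.dim rat_cycles \<le> rat_fun.dim (bds \<union> rat_chain ` set zs)"
      using finite_Suc_q by (intro rat_fun.dim_mono_finite) auto
    then show False using dim_indep_mod_boundaries[OF zs(1)] zs(2) Suc.prems by simp
  qed
  then obtain y where y: "y \<in> rat_cycles" "y \<notin> rat_fun.span (bds \<union> rat_chain ` set zs)" by auto
  obtain N :: int where N: "N > 0" "\<forall>k\<in>K. \<exists>z::int. of_int N * y k = of_int z"
    using common_denominator[OF finite_q] by blast
  then obtain w :: "cube \<Rightarrow> int" where w: "\<And>k. k \<in> K \<Longrightarrow> of_int N * y k = of_int (w k)" by metis
  define z where "z Q = (if Q \<in> K then w Q else 0)" for Q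
  have z: "rat_chain z = (\<lambda>P. of_int N * y P)"
    using y(1) w unfolding rat_cycles_def span_unit_chain by (auto simp: fun_eq_iff rat_chain_def z_def)
  have "rat_chain z \<in> rat_cycles"
    unfolding z by (rule rat_fun.subspace_scale[OF subspace_rat_cycles y(1)])
  then have "z \<in> cycles d q S" by (simp add: rat_chain_cycles)
  moreover have "rat_chain z \<notin> rat_fun.span (bds \<union> rat_chain ` set zs)"
  proof
    assume "rat_chain z \<in> rat_fun.span (bds \<union> rat_chain ` set zs)"
    then have "(\<lambda>P. inverse (of_int N) * rat_chain z P) \<in> rat_fun.span (bds \<union> rat_chain ` set zs)"
      by (rule rat_fun.span_scale)
    moreover have "(\<lambda>P. inverse (of_int N) * rat_chain z P) = y"
      using N(1) by (simp add: z fun_eq_iff)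
    ultimately show False using y(2) by simp
  qed
  ultimately have "indep_mod_boundaries (zs @ [z])"
    using zs(1) by (simp add: indep_mod_boundaries_snoc)
  then show ?case using zs(2) by (intro exI[of _ "zs @ [z]"]) simp
qed

text \<open>The supremum is attained at \<open>dim rat_cycles - dim bds\<close>: independent lists
  cannot be longer, and shorter ones can be extended. Rank-nullity then replaces the dimension of
  the cycles.\<close>

theorem betti_eq: "real (betti d q S) = real (card K) - real (bd_rank q K) - real (bd_rank (Suc q) K')"
proof -
  have le: "rat_fun.dim bds \<le> rat_fun.dim rat_cycles"
    using length_indep_mod_boundaries_le[of "[]"] by (simp add: indep_mod_boundaries_def)
  define m where "m = rat_fun.dim rat_cycles - rat_fun.dim bds"
  have "betti d q S = Sup {length zs | zs. indep_mod_boundaries zs}"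
    by (simp add: betti_def indep_mod_boundaries_def)
  also have "\<dots> = m"
  proof (rule cSup_eq_maximum)
    show "m \<in> {length zs |zs. indep_mod_boundaries zs}"
      using exists_indep_mod_boundaries[of m] le unfolding m_def mem_Collect_eq by (metis le_add_diff_inverse order_refl)
    show "x \<le> m" if "x \<in> {length zs |zs. indep_mod_boundaries zs}" for x
      using that length_indep_mod_boundaries_le by (fastforce simp: m_def)
  qed
  finally show ?thesis
    using le dim_rat_cycles by (simp add: m_def bd_rank_def filter_cdim of_nat_diff)
qed

end

section \<open>Submodularity and translations\<close>

text \<open>Submodularity in the form of diminishing returns, for monotone set functions whose
  one-element increments are at most \<open>c\<close>.\<close>

definition bounded_submodular :: "real \<Rightarrow> ('a set \<Rightarrow> real) \<Rightarrow> bool" where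
  "bounded_submodular c h \<longleftrightarrow>
     (\<forall>S x. finite S \<longrightarrow> h S \<le> h (insert x S) \<and> h (insert x S) \<le> h S + c) \<and>
     (\<forall>S T x. finite T \<longrightarrow> S \<subseteq> T \<longrightarrow> h (insert x T) - h T \<le> h (insert x S) - h S)"

lemma bounded_submodular_union:
  assumes "bounded_submodular c h" "finite S" "finite X"
  shows "h S \<le> h (S \<union> X)" "h (S \<union> X) \<le> h S + c * card X"
proof -
  have step: "h S \<le> h (insert x S)" "h (insert x S) \<le> h S + c" if "finite S" for S x
    using assms(1) that by (auto simp: bounded_submodular_def)
  have "h S \<le> h (S \<union> X) \<and> h (S \<union> X) \<le> h S + c * card X"
    using \<open>finite X\<close>
  proof induction
    case (insert x X)
    then show ?case
      using step[of "S \<union> X" x] \<open>finite S\<close> by (auto simp: algebra_simps)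
  qed simp
  then show "h S \<le> h (S \<union> X)" "h (S \<union> X) \<le> h S + c * card X" by auto
qed

lemma bounded_submodular_increment:
  assumes "bounded_submodular c h" "finite T" "S \<subseteq> T" "finite X"
  shows "h (T \<union> X) - h T \<le> h (S \<union> X) - h S"
  using \<open>finite X\<close>
proof induction
  case (insert x X)
  have "h (insert x (T \<union> X)) - h (T \<union> X) \<le> h (insert x (S \<union> X)) - h (S \<union> X)"
    using assms insert.hyps unfolding bounded_submodular_def
    by (meson Un_mono finite_UnI order_refl)
  then show ?case using insert.IH by simp
qed simp

lemma bounded_submodular_add:
  assumes "bounded_submodular c h" "bounded_submodular c' h'"
  shows "bounded_submodular (c + c') (\<lambda>S. h S + h' S)"
  unfolding bounded_submodular_def
proof (intro conjI allI impI)
  fix S :: "'a set" and x :: 'a assume "finite S"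
  then have "h S \<le> h (insert x S)" "h (insert x S) \<le> h S + c" "h' S \<le> h' (insert x S)" "h' (insert x S) \<le> h' S + c'"
    using assms by (auto simp: bounded_submodular_def)
  then show "h S + h' S \<le> h (insert x S) + h' (insert x S)"
    "h (insert x S) + h' (insert x S) \<le> h S + h' S + (c + c')" by auto
next
  fix S T :: "'a set" and x :: 'a assume "finite T" "S \<subseteq> T"
  then have "h (insert x T) - h T \<le> h (insert x S) - h S" "h' (insert x T) - h' T \<le> h' (insert x S) - h' S"
    using assms by (auto simp: bounded_submodular_def)
  then show "h (insert x T) + h' (insert x T) - (h T + h' T) \<le> h (insert x S) + h' (insert x S) - (h S + h' S)"
    by auto
qed

lemma bounded_submodular_mono_const:
  "bounded_submodular c h \<Longrightarrow> c \<le> c' \<Longrightarrow> bounded_submodular c' h"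
  unfolding bounded_submodular_def by (metis add_left_mono order.trans)

lemma bounded_submodular_count: "bounded_submodular 1 (\<lambda>S. real (card {Q\<in>S. p Q}))"
proof -
  have eq: "{Q\<in>insert x S. p Q} = (if p x then insert x {Q\<in>S. p Q} else {Q\<in>S. p Q})" for x and S :: "'a set"
    by auto
  show ?thesis
    unfolding bounded_submodular_def
  proof (intro conjI allI impI)
    fix S :: "'a set" and x assume "finite S"
    then show "real (card {Q\<in>S. p Q}) \<le> real (card {Q\<in>insert x S. p Q})"
      "real (card {Q\<in>insert x S. p Q}) \<le> real (card {Q\<in>S. p Q}) + 1"
      unfolding eq by (auto simp: card_insert_if)
  next
    fix S T :: "'a set" and x assume T: "finite T" "S \<subseteq> T"
    then have "finite S" by (metis finite_subset)
    with T show "real (card {Q\<in>insert x T. p Q}) - real (card {Q\<in>T. p Q})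
        \<le> real (card {Q\<in>insert x S. p Q}) - real (card {Q\<in>S. p Q})"
      unfolding eq by (auto simp: card_insert_if)
  qed
qed

lemma bounded_submodular_bd_rank: "bounded_submodular 1 (\<lambda>S. real (bd_rank k S))"
proof -
  let ?v = "\<lambda>S. bd_vec ` {Q\<in>S. cdim Q = k}"
  have eq: "?v (insert x S) = (if cdim x = k then insert (bd_vec x) (?v S) else ?v S)" for x S
    by auto
  have step: "bd_rank k S \<le> bd_rank k (insert x S) \<and> bd_rank k (insert x S) \<le> bd_rank k S + 1" if "finite S" for S x
    unfolding bd_rank_def eq using that by (auto simp: rat_fun.dim_insert_finite)
  have "bd_rank k (insert x T) + bd_rank k S \<le> bd_rank k (insert x S) + bd_rank k T"
    if "finite T" "S \<subseteq> T" for S T x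
    unfolding bd_rank_def eq using that rat_fun.dim_insert_submodular[of "?v T" "?v S"] by auto
  then have sub: "real (bd_rank k (insert x T)) - real (bd_rank k T) \<le> real (bd_rank k (insert x S)) - real (bd_rank k S)"
    if "finite T" "S \<subseteq> T" for S T x
    using that by (smt (verit) of_nat_add of_nat_mono)
  show ?thesis
    unfolding bounded_submodular_def
  proof (intro conjI allI impI)
    fix S :: "cube set" and x assume "finite S"
    from step[OF this, of x] show "real (bd_rank k S) \<le> real (bd_rank k (insert x S))"
      "real (bd_rank k (insert x S)) \<le> real (bd_rank k S) + 1" by linarith+
  qed (rule sub)
qed

section \<open>Translations of cubes\<close>

lemma length_shift_cube[simp]: "length (shift_cube x Q) = min (length Q) (length x)"
  by (simp add: shift_cube_def)

lemma nth_shift_cube: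
  "i < length Q \<Longrightarrow> i < length x \<Longrightarrow> shift_cube x Q ! i = (fst (Q ! i) + x ! i, snd (Q ! i))"
  by (simp add: shift_cube_def split_beta)

lemma shift_cube_uminus:
  assumes "length Q = length x"
  shows "shift_cube (map uminus x) (shift_cube x Q) = Q" "shift_cube x (shift_cube (map uminus x) Q) = Q"
  using assms by (auto simp: list_eq_iff_nth_eq nth_shift_cube)

lemma shift_cube_eq_iff:
  assumes "length P = length x" "length Q = length x"
  shows "shift_cube x P = Q \<longleftrightarrow> P = shift_cube (map uminus x) Q"
  using assms shift_cube_uminus[of P x] shift_cube_uminus[of Q x] by auto

lemma inj_on_shift_cube: "inj_on (shift_cube x) (cubes_all (length x))"
  by (rule inj_on_inverseI[of _ "shift_cube (map uminus x)"]) (simp add: cubes_all_def shift_cube_uminus)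

lemma shift_cube_in_cubes_all: "length x = d \<Longrightarrow> Q \<in> cubes_all d \<Longrightarrow> shift_cube x Q \<in> cubes_all d"
  by (simp add: cubes_all_def)

lemma image_shift_cubes_all: "length x = d \<Longrightarrow> shift_cube x ` cubes_all d = cubes_all d"
proof (intro equalityI subsetI)
  fix Q assume "length x = d" "Q \<in> cubes_all d"
  then show "Q \<in> shift_cube x ` cubes_all d"
    using shift_cube_uminus(2)[of Q x] by (intro image_eqI[of _ _ "shift_cube (map uminus x) Q"]) (auto simp: cubes_all_def)
qed (auto simp: shift_cube_in_cubes_all)

lemma nondegenerate_shift_cube: "length Q = length x \<Longrightarrow> nondegenerate (shift_cube x Q) = nondegenerate Q"
  by (auto simp: nth_shift_cube)

lemma cdim_shift_cube: "length Q = length x \<Longrightarrow> cdim (shift_cube x Q) = cdim Q"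
  unfolding cdim_def by (simp only: nondegenerate_shift_cube)

lemma face_shift_cube:
  assumes "length Q = length x" "i < length Q"
  shows "face (shift_cube x Q) i e = shift_cube x (face Q i e)"
  using assms by (auto simp: list_eq_iff_nth_eq nth_shift_cube face_def nth_list_update)

lemma face_sign_shift_cube:
  assumes "length Q = length x" "i < length Q"
  shows "face_sign (shift_cube x Q) i = face_sign Q i"
proof -
  have "{j. j < i \<and> snd (shift_cube x Q ! j)} = {j. j < i \<and> snd (Q ! j)}"
    using assms by (auto simp: nth_shift_cube)
  then show ?thesis by (simp add: face_sign_def)
qed

text \<open>The case distinction is needed because \<open>shift_cube\<close> truncates to the
  shorter list: a cube \<open>P\<close> of a different length could be shifted onto a genuine face
  although it is no face of the translate.\<close>

lemma bd_vec_shift_cube: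
  assumes "length Q = length x"
  shows "bd_vec (shift_cube x Q) P = (if length P = length x then bd_vec Q (shift_cube (map uminus x) P) else 0)"
proof (cases "length P = length x")
  case True
  have "bd_cube (shift_cube x Q) P = bd_cube Q (shift_cube (map uminus x) P)"
    unfolding bd_cube_eq nondegenerate_shift_cube[OF assms]
  proof (intro sum.cong refl)
    fix i assume "i \<in> nondegenerate Q"
    then have i: "i < length Q" by simp
    have "P = face (shift_cube x Q) i e \<longleftrightarrow> shift_cube (map uminus x) P = face Q i e" for e
      unfolding face_shift_cube[OF assms i] using shift_cube_eq_iff[of "face Q i e" x P] assms True by auto
    then show "face_sign (shift_cube x Q) i * ((if P = face (shift_cube x Q) i True then 1 else 0) - (if P = face (shift_cube x Q) i False then 1 else 0))
      = face_sign Q i * ((if shift_cube (map uminus x) P = face Q i True then 1 else 0) - (if shift_cube (map uminus x) P = face Q i False then 1 else 0))"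
      by (simp add: face_sign_shift_cube[OF assms i])
  qed
  then show ?thesis using True by (simp add: bd_vec_def)
next
  case False
  then have "bd_cube (shift_cube x Q) P = 0"
    using bd_cube_nonzero_face[of "shift_cube x Q" P] assms
    by (metis length_face length_shift_cube min.idem)
  then show ?thesis using False by (simp add: bd_vec_def)
qed

text \<open>Translation extends to a linear map \<open>T\<close> on chains commuting with the
  boundary, and linear maps do not increase dimension. Equality follows by translating back.\<close>

lemma bd_rank_shift_le:
  assumes "length x = d" "finite S" "S \<subseteq> cubes_all d"
  shows "bd_rank k (shift_cube x ` S) \<le> bd_rank k S"
proof -
  define T where "T f P = (if length P = d then f (shift_cube (map uminus x) P) else 0)"
    for f :: "cube \<Rightarrow> rat" and P
  have lin: "Vector_Spaces.linear (\<lambda>a f x. a * f x) (\<lambda>a f x. a * f x) T"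
    by (intro Vector_Spaces.linear.intro module_hom.intro module_hom_axioms.intro
          rat_fun.module_axioms rat_fun.vector_space_axioms)
       (auto simp: fun_eq_iff T_def)
  have len: "length Q = length x" if "Q \<in> S" for Q
    using that assms by (auto simp: cubes_all_def)
  have sh: "bd_vec (shift_cube x Q) = T (bd_vec Q)" if "Q \<in> S" for Q
    using bd_vec_shift_cube[OF len[OF that]] assms(1) by (auto simp: T_def fun_eq_iff)
  have "bd_vec ` {Q \<in> shift_cube x ` S. cdim Q = k} = (\<lambda>Q. bd_vec (shift_cube x Q)) ` {Q\<in>S. cdim Q = k}"
    using cdim_shift_cube[OF len] by auto
  also have "\<dots> = T ` bd_vec ` {Q\<in>S. cdim Q = k}"
    unfolding image_image by (intro image_cong refl) (auto simp: sh)
  finally have "bd_rank k (shift_cube x ` S) = rat_fun.dim (T ` bd_vec ` {Q\<in>S. cdim Q = k})"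
    by (simp add: bd_rank_def)
  also have "\<dots> \<le> bd_rank k S"
    unfolding bd_rank_def using assms(2) by (intro rat_fun.dim_image_le_finite[OF lin]) auto
  finally show ?thesis .
qed

lemma bd_rank_shift:
  assumes "length x = d" "finite S" "S \<subseteq> cubes_all d"
  shows "bd_rank k (shift_cube x ` S) = bd_rank k S"
proof (rule antisym)
  have "shift_cube (map uminus x) ` shift_cube x ` S = S"
    unfolding image_image using assms shift_cube_uminus(1)[of _ x]
    by (subst image_cong[OF refl, of S _ id]) (auto simp: cubes_all_def)
  then show "bd_rank k S \<le> bd_rank k (shift_cube x ` S)"
    using bd_rank_shift_le[of "map uminus x" d "shift_cube x ` S" k] assms
      image_shift_cubes_all[OF assms(1)] by (metis finite_imageI image_mono length_map)
qed (rule bd_rank_shift_le[OF assms])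

section \<open>Inclusions between cubes and the cubes contained in X(t)\<close>

lemma cube_set_subset_iff:
  "cube_set R \<subseteq> cube_set Q \<longleftrightarrow> length R = length Q \<and> (\<forall>i<length Q. fst (Q ! i) \<le> fst (R ! i) \<and>
     fst (R ! i) + (if snd (R ! i) then 1 else 0) \<le> fst (Q ! i) + (if snd (Q ! i) then 1 else 0))"
  (is "_ \<longleftrightarrow> ?rhs")
proof
  assume sub: "cube_set R \<subseteq> cube_set Q"
  define lo where "lo = map (\<lambda>(l, b). real_of_int l) R"
  define hi where "hi = map (\<lambda>(l, b). real_of_int (l + (if b then 1 else 0))) R"
  have "lo \<in> cube_set R" "hi \<in> cube_set R"
    by (auto simp: cube_set_def lo_def hi_def split_beta)
  then have lh: "lo \<in> cube_set Q" "hi \<in> cube_set Q" using sub by auto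
  then have len: "length R = length Q" by (auto simp: cube_set_def lo_def)
  moreover have "fst (Q ! i) \<le> fst (R ! i) \<and>
     fst (R ! i) + (if snd (R ! i) then 1 else 0) \<le> fst (Q ! i) + (if snd (Q ! i) then 1 else 0)" if "i < length Q" for i
  proof -
    have "real_of_int (fst (Q ! i)) \<le> real_of_int (fst (R ! i))"
      "real_of_int (fst (R ! i) + (if snd (R ! i) then 1 else 0)) \<le> real_of_int (fst (Q ! i)) + (if snd (Q ! i) then 1 else 0)"
      using lh that len by (auto simp: cube_set_def lo_def hi_def split_beta)
    then show ?thesis by (auto split: if_splits)
  qed
  ultimately show ?rhs by simp
next
  assume r: ?rhs
  show "cube_set R \<subseteq> cube_set Q"
  proof
    fix p assume p: "p \<in> cube_set R"
    show "p \<in> cube_set Q"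
      unfolding cube_set_def
    proof (intro CollectI conjI allI impI)
      show "length p = length Q" using p r by (simp add: cube_set_def)
      fix i assume i: "i < length Q"
      have "real_of_int (fst (R ! i)) \<le> p ! i" "p ! i \<le> real_of_int (fst (R ! i)) + (if snd (R ! i) then 1 else 0)"
        using p i r by (auto simp: cube_set_def)
      moreover have "fst (Q ! i) \<le> fst (R ! i)"
        "fst (R ! i) + (if snd (R ! i) then 1 else 0) \<le> fst (Q ! i) + (if snd (Q ! i) then 1 else 0)"
        using r i by auto
      ultimately show "real_of_int (fst (Q ! i)) \<le> p ! i" "p ! i \<le> real_of_int (fst (Q ! i)) + (if snd (Q ! i) then 1 else 0)"
        by (auto split: if_splits)
    qed
  qed
qed

lemma cube_set_subset_shift_iff:
  assumes "length R = length x" "length Q = length x"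
  shows "cube_set (shift_cube x R) \<subseteq> cube_set (shift_cube x Q) \<longleftrightarrow> cube_set R \<subseteq> cube_set Q"
  unfolding cube_set_subset_iff using assms by (auto simp: nth_shift_cube)

text \<open>The midpoint of \<open>R\<close> is in its relative interior, and an interval with
  integer ends that contains a half-integer contains the whole unit interval around it. Hence a cube
  covered by a union of cubes is already contained in one of them, namely one containing its
  midpoint.\<close>

lemma center_in_cube_set:
  assumes "length R = length Q"
    and "map (\<lambda>(l, b). real_of_int l + (if b then 1/2 else 0)) R \<in> cube_set Q"
  shows "cube_set R \<subseteq> cube_set Q"
  unfolding cube_set_subset_iff
proof (intro conjI allI impI)
  fix i assume i: "i < length Q"
  have "real_of_int (fst (Q ! i)) \<le> real_of_int (fst (R ! i)) + (if snd (R ! i) then 1/2 else 0)"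
    "real_of_int (fst (R ! i)) + (if snd (R ! i) then 1/2 else 0) \<le> real_of_int (fst (Q ! i)) + (if snd (Q ! i) then 1 else 0)"
    using assms i by (auto simp: cube_set_def split_beta)
  then show "fst (Q ! i) \<le> fst (R ! i)"
    "fst (R ! i) + (if snd (R ! i) then 1 else 0) \<le> fst (Q ! i) + (if snd (Q ! i) then 1 else 0)"
    by (cases "snd (R ! i)"; cases "snd (Q ! i)"; simp; linarith)+
qed (rule assms)

text \<open>Only the lower corners are constrained, so both types of factor occur over each of them.
  This keeps the count a pure power, unlike that of \<open>window\<close>, which also bounds the
  upper ends.\<close>

definition cube_box :: "nat \<Rightarrow> int \<Rightarrow> int \<Rightarrow> cube set" where
  "cube_box d a b = {Q. set Q \<subseteq> {a..b} \<times> UNIV \<and> length Q = d}"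

lemma in_box_iff: "Q \<in> cube_box d a b \<longleftrightarrow> length Q = d \<and> (\<forall>i<d. a \<le> fst (Q ! i) \<and> fst (Q ! i) \<le> b)"
  unfolding cube_box_def subset_eq all_set_conv_all_nth mem_Times_iff by auto

lemma finite_box[simp]: "finite (cube_box d a b)"
  unfolding cube_box_def by (rule finite_lists_length_eq) simp

lemma card_box: "card (cube_box d a b) = (2 * nat (b - a + 1)) ^ d"
  unfolding cube_box_def by (subst card_lists_length_eq) (auto simp: card_cartesian_product)

lemma box_subset_cubes_all: "cube_box d a b \<subseteq> cubes_all d"
  by (auto simp: cube_box_def cubes_all_def)

definition window :: "nat \<Rightarrow> nat \<Rightarrow> cube set" where
  "window d n = {R. length R = d \<and> (\<forall>i<d. - int n \<le> fst (R ! i) \<and> fst (R ! i) + (if snd (R ! i) then 1 else 0) \<le> int n)}"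

lemma window_subset_box: "window d n \<subseteq> cube_box d (- int n) (int n)"
proof
  fix R assume R: "R \<in> window d n"
  have "fst (R ! i) \<le> int n" if "i < d" for i
  proof -
    have "fst (R ! i) + (if snd (R ! i) then 1 else 0) \<le> int n"
      using R that by (simp add: window_def)
    then show ?thesis by (cases "snd (R ! i)") auto
  qed
  then show "R \<in> cube_box d (- int n) (int n)"
    using R by (simp add: window_def in_box_iff)
qed

lemma finite_window[simp]: "finite (window d n)"
  by (rule finite_subset[OF window_subset_box]) simp

lemma window_subset_cubes_all: "window d n \<subseteq> cubes_all d"
  by (auto simp: window_def cubes_all_def)

lemma cube_set_subset_Lambda_iff:
  assumes "length R = d"
  shows "cube_set R \<subseteq> Lambda d n \<longleftrightarrow> R \<in> window d n"
proof
  assume sub: "cube_set R \<subseteq> Lambda d n"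
  define lo where "lo = map (\<lambda>(l, b). real_of_int l) R"
  define hi where "hi = map (\<lambda>(l, b). real_of_int (l + (if b then 1 else 0))) R"
  have "lo \<in> cube_set R" "hi \<in> cube_set R"
    by (auto simp: cube_set_def lo_def hi_def split_beta)
  then have lh: "lo \<in> Lambda d n" "hi \<in> Lambda d n" using sub by auto
  have "- int n \<le> fst (R ! i) \<and> fst (R ! i) + (if snd (R ! i) then 1 else 0) \<le> int n" if "i < d" for i
  proof -
    have "- real n \<le> real_of_int (fst (R ! i))" "real_of_int (fst (R ! i) + (if snd (R ! i) then 1 else 0)) \<le> real n"
      using lh that assms by (auto simp: Lambda_def lo_def hi_def split_beta)
    then show ?thesis by linarith
  qed
  then show "R \<in> window d n" using assms by (simp add: window_def)
next
  assume R: "R \<in> window d n"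
  show "cube_set R \<subseteq> Lambda d n"
  proof
    fix p assume p: "p \<in> cube_set R"
    have "- real n \<le> p ! i \<and> p ! i \<le> real n" if "i < d" for i
    proof -
      have "real_of_int (fst (R ! i)) \<le> p ! i" "p ! i \<le> real_of_int (fst (R ! i)) + (if snd (R ! i) then 1 else 0)"
        using p that assms by (auto simp: cube_set_def)
      moreover have "- int n \<le> fst (R ! i)" "fst (R ! i) + (if snd (R ! i) then 1 else 0) \<le> int n"
        using R that by (auto simp: window_def)
      ultimately show ?thesis by (auto split: if_splits)
    qed
    then show "p \<in> Lambda d n" using p assms by (simp add: Lambda_def cube_set_def)
  qed
qed

text \<open>The combinatorial form of X(t). The coface \<open>Q\<close> ranges over all cubes and
  not only over those of a window, since X(t) is built before it is cut.\<close>

definition complex_at :: "nat \<Rightarrow> (cube \<Rightarrow> real) \<Rightarrow> real \<Rightarrow> cube set" where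
  "complex_at d \<omega> t = {R\<in>cubes_all d. \<exists>Q\<in>cubes_all d. cube_set R \<subseteq> cube_set Q \<and> \<omega> Q \<le> t}"

lemma cubes_in_Xt:
  "cubes_in d k (Xt d \<omega> t \<inter> Lambda d n) = {R \<in> complex_at d \<omega> t \<inter> window d n. cdim R = k}"
proof (intro set_eqI iffI)
  fix R assume R: "R \<in> cubes_in d k (Xt d \<omega> t \<inter> Lambda d n)"
  then have len: "length R = d" and k: "cdim R = k" and sub: "cube_set R \<subseteq> Xt d \<omega> t" "cube_set R \<subseteq> Lambda d n"
    by (auto simp: cubes_in_def)
  have "map (\<lambda>(l, b). real_of_int l + (if b then 1/2 else 0)) R \<in> cube_set R"
    by (auto simp: cube_set_def split_beta)
  then obtain Q where Q: "Q \<in> cubes_all d" "\<omega> Q \<le> t"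
    "map (\<lambda>(l, b). real_of_int l + (if b then 1/2 else 0)) R \<in> cube_set Q"
    using sub(1) by (auto simp: Xt_def)
  have "cube_set R \<subseteq> cube_set Q"
    using Q len by (intro center_in_cube_set) (auto simp: cubes_all_def)
  then show "R \<in> {R \<in> complex_at d \<omega> t \<inter> window d n. cdim R = k}"
    using Q len k sub(2) cube_set_subset_Lambda_iff[OF len] by (auto simp: complex_at_def cubes_all_def)
next
  fix R assume R: "R \<in> {R \<in> complex_at d \<omega> t \<inter> window d n. cdim R = k}"
  then have len: "length R = d" by (simp add: complex_at_def cubes_all_def)
  from R have "cube_set R \<subseteq> Xt d \<omega> t" by (auto simp: complex_at_def Xt_def)
  then show "R \<in> cubes_in d k (Xt d \<omega> t \<inter> Lambda d n)"
    using R len cube_set_subset_Lambda_iff[OF len] by (auto simp: cubes_in_def)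
qed

text \<open>The two ranks are bracketed together so that the right-hand side is a difference of two
  monotone submodular functions of the same set of cubes.\<close>

lemma betti_n_eq:
  "real (betti_n d q n \<omega> t) = real (card {R \<in> complex_at d \<omega> t \<inter> window d n. cdim R = q})
     - (real (bd_rank q (complex_at d \<omega> t \<inter> window d n)) + real (bd_rank (Suc q) (complex_at d \<omega> t \<inter> window d n)))"
proof -
  let ?S = "Xt d \<omega> t \<inter> Lambda d n"
  interpret finite_cubical d q ?S
    by unfold_locales (simp_all add: cubes_in_Xt)
  have "{Q \<in> cubes_in d k ?S. cdim Q = k} = {Q \<in> complex_at d \<omega> t \<inter> window d n. cdim Q = k}" for k
    unfolding cubes_in_Xt by auto
  then have "bd_rank k (cubes_in d k ?S) = bd_rank k (complex_at d \<omega> t \<inter> window d n)" for k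
    by (simp add: bd_rank_def)
  then show ?thesis
    unfolding betti_n_def betti_eq by (simp add: cubes_in_Xt)
qed

section \<open>Level integrals of set functions\<close>

definition level_integral :: "nat \<Rightarrow> (cube set \<Rightarrow> real) \<Rightarrow> cube set \<Rightarrow> (cube \<Rightarrow> real) \<Rightarrow> real" where
  "level_integral d h A \<omega> = (LINT t:{0..1}|lborel. h (complex_at d \<omega> t \<inter> A))"

definition shift_invariant :: "nat \<Rightarrow> (cube set \<Rightarrow> real) \<Rightarrow> bool" where
  "shift_invariant d h \<longleftrightarrow>
     (\<forall>x S. length x = d \<longrightarrow> finite S \<longrightarrow> S \<subseteq> cubes_all d \<longrightarrow> h (shift_cube x ` S) = h S)"

text \<open>The trace on the finite set \<open>A\<close> takes finitely many values, and the
  presence of a cube is a countable union of events. Field and level both depend on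
  \<open>z\<close>, so that the lemma covers measurability in the level alone as well as joint
  measurability.\<close>

lemma measurable_complex_at:
  assumes w: "\<And>Q. Q \<in> cubes_all d \<Longrightarrow> (\<lambda>z. w z Q) \<in> borel_measurable M"
    and T: "T \<in> borel_measurable M" and "finite A"
  shows "(\<lambda>z. h (complex_at d (w z) (T z) \<inter> A) :: real) \<in> borel_measurable M"
proof -
  have in_complex: "{z \<in> space M. R \<in> complex_at d (w z) (T z)} \<in> sets M" for R
  proof -
    have "{z \<in> space M. w z Q \<le> T z} \<in> sets M" if "Q \<in> cubes_all d" for Q
      using w[OF that] T by measurable
    then have "(\<Union>Q\<in>{Q\<in>cubes_all d. R \<in> cubes_all d \<and> cube_set R \<subseteq> cube_set Q}. {z \<in> space M. w z Q \<le> T z}) \<in> sets M"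
      by (intro sets.countable_UN'') auto
    also have "(\<Union>Q\<in>{Q\<in>cubes_all d. R \<in> cubes_all d \<and> cube_set R \<subseteq> cube_set Q}. {z \<in> space M. w z Q \<le> T z})
        = {z \<in> space M. R \<in> complex_at d (w z) (T z)}"
      by (auto simp: complex_at_def)
    finally show ?thesis .
  qed
  have "(\<lambda>z. complex_at d (w z) (T z) \<inter> A) \<in> measurable M (count_space (Pow A))"
  proof (subst measurable_count_space_eq2)
    show "finite (Pow A)" using \<open>finite A\<close> by simp
    show "(\<lambda>z. complex_at d (w z) (T z) \<inter> A) \<in> space M \<rightarrow> Pow A \<and>
      (\<forall>a\<in>Pow A. (\<lambda>z. complex_at d (w z) (T z) \<inter> A) -` {a} \<inter> space M \<in> sets M)"
    proof (intro conjI ballI)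
      fix S assume "S \<in> Pow A"
      then have "(\<lambda>z. complex_at d (w z) (T z) \<inter> A) -` {S} \<inter> space M
          = {z \<in> space M. \<forall>R\<in>A. R \<in> complex_at d (w z) (T z) \<longleftrightarrow> R \<in> S}"
        by auto
      also have "\<dots> \<in> sets M"
      proof (rule sets.sets_Collect_finite_All[OF _ \<open>finite A\<close>])
        fix R
        have "{z \<in> space M. R \<in> complex_at d (w z) (T z) \<longleftrightarrow> R \<in> S}
            = (if R \<in> S then {z \<in> space M. R \<in> complex_at d (w z) (T z)} else space M - {z \<in> space M. R \<in> complex_at d (w z) (T z)})"
          by auto
        then show "{z \<in> space M. R \<in> complex_at d (w z) (T z) \<longleftrightarrow> R \<in> S} \<in> sets M"
          using in_complex[of R] by auto
      qed
      finally show "(\<lambda>z. complex_at d (w z) (T z) \<inter> A) -` {S} \<inter> space M \<in> sets M" .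
    qed auto
  qed
  then show ?thesis
    by (rule measurable_compose) simp
qed

lemma abs_le_sum_Pow:
  fixes h :: "'a set \<Rightarrow> real"
  assumes "finite A" "S \<subseteq> A"
  shows "\<bar>h S\<bar> \<le> (\<Sum>S\<in>Pow A. \<bar>h S\<bar>)"
  using assms by (intro member_le_sum) auto

lemma set_integrable_complex_at:
  assumes "finite A"
  shows "set_integrable lborel {0..1} (\<lambda>t. h (complex_at d \<omega> t \<inter> A) :: real)"
  unfolding set_integrable_def
proof (rule integrableI_bounded_set_indicator)
  show "(\<lambda>t. h (complex_at d \<omega> t \<inter> A)) \<in> borel_measurable lborel"
    by (rule measurable_complex_at) (use assms in auto)
  show "AE t in lborel. t \<in> {0..1} \<longrightarrow> norm (h (complex_at d \<omega> t \<inter> A)) \<le> (\<Sum>S\<in>Pow A. \<bar>h S\<bar>)"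
    using abs_le_sum_Pow[OF assms, of _ h] by auto
qed auto

lemma set_integral_const_01: "(LINT t:{0..1::real}|lborel. c) = (c::real)"
  by (simp add: set_lebesgue_integral_def)

lemma set_integral_diff_le:
  fixes f g :: "real \<Rightarrow> real"
  assumes "set_integrable lborel {0..1} f" "set_integrable lborel {0..1} g"
    and "\<And>t. t \<in> {0..1} \<Longrightarrow> f t - g t \<le> c"
  shows "(LINT t:{0..1}|lborel. f t) - (LINT t:{0..1}|lborel. g t) \<le> c"
proof -
  have "(LINT t:{0..1}|lborel. f t - g t) \<le> (LINT t:{0..1::real}|lborel. c)"
    using assms by (intro set_integral_mono set_integral_diff(1)) (auto simp: set_integrable_def)
  then show ?thesis
    using set_integral_diff(2)[OF assms(1,2)] by (simp add: set_integral_const_01)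
qed

lemma abs_level_integral_le:
  assumes "finite A"
  shows "\<bar>level_integral d h A \<omega>\<bar> \<le> (\<Sum>S\<in>Pow A. \<bar>h S\<bar>)"
proof -
  have 0: "set_integrable lborel {0..1} (\<lambda>t::real. 0::real)" by (simp add: set_integrable_def)
  have *: "\<bar>h (complex_at d \<omega> t \<inter> A)\<bar> \<le> (\<Sum>S\<in>Pow A. \<bar>h S\<bar>)" for t
    using abs_le_sum_Pow[OF assms] by auto
  have "h (complex_at d \<omega> t \<inter> A) - 0 \<le> (\<Sum>S\<in>Pow A. \<bar>h S\<bar>)" "0 - h (complex_at d \<omega> t \<inter> A) \<le> (\<Sum>S\<in>Pow A. \<bar>h S\<bar>)" for t
    using *[of t] by linarith+
  note le = this
  have "(LINT t:{0..1}|lborel. h (complex_at d \<omega> t \<inter> A)) - (LINT t:{0..1::real}|lborel. 0) \<le> (\<Sum>S\<in>Pow A. \<bar>h S\<bar>)"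
    by (intro set_integral_diff_le set_integrable_complex_at assms 0 le)
  moreover have "(LINT t:{0..1::real}|lborel. 0) - (LINT t:{0..1}|lborel. h (complex_at d \<omega> t \<inter> A)) \<le> (\<Sum>S\<in>Pow A. \<bar>h S\<bar>)"
    by (intro set_integral_diff_le set_integrable_complex_at assms 0 le)
  ultimately show ?thesis
    unfolding level_integral_def set_integral_const_01 by linarith
qed

lemma level_integral_diff:
  assumes "finite A"
  shows "level_integral d (\<lambda>S. h S - h' S) A \<omega> = level_integral d h A \<omega> - level_integral d h' A \<omega>"
  unfolding level_integral_def
  by (rule set_integral_diff(2)) (rule set_integrable_complex_at[OF assms])+

lemma complex_at_cong:
  assumes "\<And>Q. Q \<in> cubes_all d \<Longrightarrow> (\<exists>R\<in>A. cube_set R \<subseteq> cube_set Q) \<Longrightarrow> \<omega> Q = \<omega>' Q"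
  shows "complex_at d \<omega> t \<inter> A = complex_at d \<omega>' t \<inter> A"
proof -
  have "R \<in> complex_at d \<omega> t \<longleftrightarrow> R \<in> complex_at d \<omega>' t" if "R \<in> A" for R
  proof -
    have "\<omega> Q = \<omega>' Q" if "Q \<in> cubes_all d" "cube_set R \<subseteq> cube_set Q" for Q
      using assms that \<open>R \<in> A\<close> by blast
    then show ?thesis
      unfolding complex_at_def by (intro iffI; clarsimp; metis)
  qed
  then show ?thesis by blast
qed

lemma level_integral_cong:
  assumes "\<And>Q. Q \<in> cubes_all d \<Longrightarrow> (\<exists>R\<in>A. cube_set R \<subseteq> cube_set Q) \<Longrightarrow> \<omega> Q = \<omega>' Q"
  shows "level_integral d h A \<omega> = level_integral d h A \<omega>'"
proof -
  have "complex_at d \<omega> t \<inter> A = complex_at d \<omega>' t \<inter> A" for t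
    using assms by (rule complex_at_cong)
  then show ?thesis by (simp add: level_integral_def)
qed

lemma complex_at_tau:
  assumes "length x = d"
  shows "complex_at d (tau d x \<omega>) t = shift_cube x ` complex_at d \<omega> t"
proof (intro set_eqI iffI)
  fix R assume "R \<in> complex_at d (tau d x \<omega>) t"
  then obtain Q where R: "R \<in> cubes_all d" "Q \<in> cubes_all d" "cube_set R \<subseteq> cube_set Q" "\<omega> (shift_cube (map uminus x) Q) \<le> t"
    by (auto simp: complex_at_def tau_def)
  then have "shift_cube (map uminus x) R \<in> complex_at d \<omega> t"
    unfolding complex_at_def using assms cube_set_subset_shift_iff[of R "map uminus x" Q]
    by (intro CollectI conjI bexI[of _ "shift_cube (map uminus x) Q"]) (simp_all add: cubes_all_def)
  moreover have "R = shift_cube x (shift_cube (map uminus x) R)"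
    using R(1) assms by (simp add: shift_cube_uminus cubes_all_def)
  ultimately show "R \<in> shift_cube x ` complex_at d \<omega> t" by blast
next
  fix R assume "R \<in> shift_cube x ` complex_at d \<omega> t"
  then obtain R' Q where R: "R = shift_cube x R'" "R' \<in> cubes_all d" "Q \<in> cubes_all d" "cube_set R' \<subseteq> cube_set Q" "\<omega> Q \<le> t"
    by (auto simp: complex_at_def)
  have len: "length R' = length x" "length Q = length x" using R assms by (auto simp: cubes_all_def)
  show "R \<in> complex_at d (tau d x \<omega>) t"
    unfolding complex_at_def
  proof (intro CollectI conjI bexI[of _ "shift_cube x Q"])
    show "R \<in> cubes_all d" "shift_cube x Q \<in> cubes_all d"
      using R assms by (auto simp: cubes_all_def)
    show "cube_set R \<subseteq> cube_set (shift_cube x Q)"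
      unfolding R(1) cube_set_subset_shift_iff[OF len] by (rule R)
    show "tau d x \<omega> (shift_cube x Q) \<le> t"
      using R len assms by (simp add: tau_def cubes_all_def shift_cube_uminus)
  qed
qed

lemma level_integral_tau:
  assumes "length x = d" "shift_invariant d h" "finite A" "A \<subseteq> cubes_all d"
  shows "level_integral d h (shift_cube x ` A) (tau d x \<omega>) = level_integral d h A \<omega>"
proof -
  have "h (complex_at d (tau d x \<omega>) t \<inter> shift_cube x ` A) = h (complex_at d \<omega> t \<inter> A)" for t
  proof -
    have "shift_cube x ` complex_at d \<omega> t \<inter> shift_cube x ` A = shift_cube x ` (complex_at d \<omega> t \<inter> A)"
      using inj_on_image_Int[OF inj_on_shift_cube[of x], of "complex_at d \<omega> t" A] assms(1,4)
      by (auto simp: complex_at_def)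
    moreover have "finite (complex_at d \<omega> t \<inter> A)" "complex_at d \<omega> t \<inter> A \<subseteq> cubes_all d"
      using assms by auto
    ultimately show ?thesis
      using assms(1,2) unfolding complex_at_tau[OF assms(1)] shift_invariant_def by simp
  qed
  then show ?thesis by (simp add: level_integral_def)
qed

text \<open>A cube can only appear through a coface whose value has dropped, and \<open>Q\<close> is
  the only candidate.\<close>

lemma complex_at_resample:
  assumes agree: "\<And>R. R \<in> cubes_all d \<Longrightarrow> R \<noteq> Q \<Longrightarrow> \<omega> R = \<omega>' R" and le: "\<omega>' Q \<le> \<omega> Q"
  shows "complex_at d \<omega> t \<subseteq> complex_at d \<omega>' t"
    and "complex_at d \<omega>' t - complex_at d \<omega> t \<subseteq> {R. cube_set R \<subseteq> cube_set Q}"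
proof -
  have "\<omega>' R \<le> \<omega> R" if "R \<in> cubes_all d" for R
    using agree[OF that] le by (cases "R = Q") auto
  then show "complex_at d \<omega> t \<subseteq> complex_at d \<omega>' t"
    unfolding complex_at_def by (blast intro: order_trans)
  show "complex_at d \<omega>' t - complex_at d \<omega> t \<subseteq> {R. cube_set R \<subseteq> cube_set Q}"
  proof
    fix R assume R: "R \<in> complex_at d \<omega>' t - complex_at d \<omega> t"
    then obtain Q' where Q': "Q' \<in> cubes_all d" "cube_set R \<subseteq> cube_set Q'" "\<omega>' Q' \<le> t"
      by (auto simp: complex_at_def)
    have "\<not> \<omega> Q' \<le> t"
      using R Q' by (auto simp: complex_at_def)
    then have "Q' = Q"
      using agree[OF Q'(1)] Q'(3) by metis
    then show "R \<in> {R. cube_set R \<subseteq> cube_set Q}" using Q' by simp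
  qed
qed

text \<open>
  Lowering \<open>\<omega> Q\<close> only adds faces of \<open>Q\<close> to the complex, so by submodularity the resulting increment
  shrinks when the window grows.
\<close>

lemma level_integral_resample_mono:
  assumes h: "bounded_submodular c h" and B: "finite B" "A \<subseteq> B"
    and agree: "\<And>R. R \<in> cubes_all d \<Longrightarrow> R \<noteq> Q \<Longrightarrow> \<omega> R = \<omega>' R" and le: "\<omega>' Q \<le> \<omega> Q"
    and faces: "\<And>R. R \<in> cubes_all d \<Longrightarrow> cube_set R \<subseteq> cube_set Q \<Longrightarrow> R \<in> A"
  shows "level_integral d h B \<omega> \<le> level_integral d h B \<omega>'"
    and "level_integral d h B \<omega>' - level_integral d h B \<omega> \<le> level_integral d h A \<omega>' - level_integral d h A \<omega>"
proof -
  have A: "finite A" using B by (metis finite_subset)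
  let ?K = "complex_at d \<omega>" and ?K' = "complex_at d \<omega>'"
  note K = complex_at_resample[of d Q \<omega> \<omega>', OF agree le]
  have new: "?K' t - ?K t \<subseteq> A" for t
    using K(2)[of t] faces by (auto simp: complex_at_def)
  \<comment> \<open>The new cubes are faces of \<open>Q\<close>, all of which lie in
    \<open>A\<close>. So the very same set is added in both windows, and submodularity compares the
    two increments.\<close>
  have eqs: "?K' t \<inter> B = (?K t \<inter> B) \<union> (?K' t - ?K t)" "?K' t \<inter> A = (?K t \<inter> A) \<union> (?K' t - ?K t)" for t
    using K(1)[of t] new[of t] B(2) by auto
  have fin: "finite (?K' t - ?K t)" for t
    using new[of t] A by (rule finite_subset)
  have 1: "h (?K t \<inter> B) \<le> h (?K' t \<inter> B)" for t
    unfolding eqs(1) using B fin by (intro bounded_submodular_union(1)[OF h]) auto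
  have 2: "h (?K' t \<inter> B) - h (?K t \<inter> B) \<le> h (?K' t \<inter> A) - h (?K t \<inter> A)" for t
    unfolding eqs using B fin by (intro bounded_submodular_increment[OF h]) auto
  note int = set_integrable_complex_at[OF A] set_integrable_complex_at[OF B(1)]
  show "level_integral d h B \<omega> \<le> level_integral d h B \<omega>'"
    unfolding level_integral_def by (intro set_integral_mono int 1)
  have "(LINT t:{0..1}|lborel. h (?K' t \<inter> B) - h (?K t \<inter> B)) \<le> (LINT t:{0..1}|lborel. h (?K' t \<inter> A) - h (?K t \<inter> A))"
    by (intro set_integral_mono set_integral_diff(1) int 2)
  then show "level_integral d h B \<omega>' - level_integral d h B \<omega> \<le> level_integral d h A \<omega>' - level_integral d h A \<omega>"
    unfolding level_integral_def by (subst (asm) (1 2) set_integral_diff(2)) (auto intro: int)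
qed

text \<open>Here the window need not contain the faces of \<open>Q\<close>; only those inside it can
  be added, at cost at most \<open>c\<close> each. The absolute value is handled by exchanging the
  two configurations.\<close>

lemma level_integral_resample_le:
  assumes h: "bounded_submodular c h" and A: "finite A" and "c \<ge> 0"
    and agree: "\<And>R. R \<in> cubes_all d \<Longrightarrow> R \<noteq> Q \<Longrightarrow> \<omega> R = \<omega>' R"
  shows "\<bar>level_integral d h A \<omega> - level_integral d h A \<omega>'\<bar> \<le> c * card {R\<in>A. cube_set R \<subseteq> cube_set Q}"
proof -
  have main: "level_integral d h A \<omega>' - level_integral d h A \<omega> \<le> c * card {R\<in>A. cube_set R \<subseteq> cube_set Q} \<and>
      level_integral d h A \<omega> - level_integral d h A \<omega>' \<le> 0"
    if agree: "\<And>R. R \<in> cubes_all d \<Longrightarrow> R \<noteq> Q \<Longrightarrow> \<omega> R = \<omega>' R" and le: "\<omega>' Q \<le> \<omega> Q" for \<omega> \<omega>'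
  proof -
    let ?K = "complex_at d \<omega>" and ?K' = "complex_at d \<omega>'"
    note K = complex_at_resample[of d Q \<omega> \<omega>', OF agree le]
    have eq: "?K' t \<inter> A = (?K t \<inter> A) \<union> ((?K' t - ?K t) \<inter> A)" for t
      using K(1)[of t] by auto
    have fin: "finite ((?K' t - ?K t) \<inter> A)" "finite (?K t \<inter> A)" for t
      using A by auto
    have 1: "h (?K t \<inter> A) - h (?K' t \<inter> A) \<le> 0" for t
      using bounded_submodular_union(1)[OF h fin(2,1), of t t] unfolding eq[symmetric] by simp
    have 2: "h (?K' t \<inter> A) - h (?K t \<inter> A) \<le> c * card {R\<in>A. cube_set R \<subseteq> cube_set Q}" for t
    proof -
      have "card ((?K' t - ?K t) \<inter> A) \<le> card {R\<in>A. cube_set R \<subseteq> cube_set Q}"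
        using K(2)[of t] A by (intro card_mono) auto
      then have "c * card ((?K' t - ?K t) \<inter> A) \<le> c * card {R\<in>A. cube_set R \<subseteq> cube_set Q}"
        using \<open>c \<ge> 0\<close> by (intro mult_left_mono) auto
      then show ?thesis
        using bounded_submodular_union(2)[OF h fin(2,1), of t t] unfolding eq[symmetric] by simp
    qed
    note int = set_integrable_complex_at[OF A]
    show ?thesis
      unfolding level_integral_def by (intro conjI set_integral_diff_le int 1 2)
  qed
  have "0 \<le> c * card {R\<in>A. cube_set R \<subseteq> cube_set Q}"
    using \<open>c \<ge> 0\<close> by simp
  then show ?thesis
    using main[of \<omega> \<omega>'] main[of \<omega>' \<omega>] agree by (cases "\<omega>' Q \<le> \<omega> Q") auto
qed

text \<open>For a product measure, stationarity is invariance of the marginals under translation.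
  Cubes of different types may still have different laws.\<close>

locale cubical_field =
  fixes d :: nat and \<mu> :: "cube \<Rightarrow> real measure"
  assumes prob_\<mu>: "\<And>Q. Q \<in> cubes_all d \<Longrightarrow> prob_space (\<mu> Q)"
    and sets_\<mu>: "\<And>Q. Q \<in> cubes_all d \<Longrightarrow> sets (\<mu> Q) = sets (restrict_space borel {0..1})"
    and shift_\<mu>: "\<And>x Q. length x = d \<Longrightarrow> Q \<in> cubes_all d \<Longrightarrow> \<mu> (shift_cube x Q) = \<mu> Q"
begin

sublocale doubled_product "cubes_all d" \<mu>
  by (rule doubled_product.intro) (rule prob_\<mu>)

lemma measurable_coordinate:
  assumes "Q \<in> cubes_all d" "cubes_all d \<supseteq> J" "Q \<in> J"
  shows "(\<lambda>\<omega>. \<omega> Q) \<in> borel_measurable (PiM J \<mu>)"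
proof -
  have "(\<lambda>x. x) \<in> measurable (\<mu> Q) borel"
    unfolding measurable_cong_sets[OF sets_\<mu>[OF assms(1)] refl]
    by (rule measurable_restrict_space1) simp
  with measurable_component_singleton[OF assms(3), of \<mu>] show ?thesis
    by (rule measurable_compose)
qed

lemma measurable_level_integral:
  assumes "finite A" "J \<subseteq> cubes_all d" "\<And>R Q. R \<in> A \<Longrightarrow> Q \<in> cubes_all d \<Longrightarrow> cube_set R \<subseteq> cube_set Q \<Longrightarrow> Q \<in> J"
  shows "level_integral d h A \<in> borel_measurable (PiM J \<mu>)"
proof -
  \<comment> \<open>Extending by 0 outside \<open>J\<close> makes every coordinate measurable on the
    smaller product. The integral is unaffected, because it reads only cofaces of \<open>A\<close>,
    and these lie in \<open>J\<close>.\<close>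
  define e where "e \<omega> Q = (if Q \<in> J then \<omega> Q else 0)" for \<omega> :: "cube \<Rightarrow> real" and Q
  have "level_integral d h A \<omega> = level_integral d h A (e \<omega>)" for \<omega>
    using assms(3) by (intro level_integral_cong) (auto simp: e_def)
  then have e: "level_integral d h A = (\<lambda>\<omega>. level_integral d h A (e \<omega>))"
    by (rule ext)
  have "(\<lambda>z. h (complex_at d (e (fst z)) (snd z) \<inter> A)) \<in> borel_measurable (PiM J \<mu> \<Otimes>\<^sub>M lborel)"
  proof (rule measurable_complex_at[OF _ _ assms(1)])
    fix Q assume Q: "Q \<in> cubes_all d"
    show "(\<lambda>z. e (fst z) Q) \<in> borel_measurable (PiM J \<mu> \<Otimes>\<^sub>M lborel)"
    proof (cases "Q \<in> J")
      case True
      then show ?thesis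
        using measurable_coordinate[OF Q assms(2) True]
        by (auto simp: e_def intro: measurable_compose[OF measurable_fst])
    qed (simp add: e_def)
  qed simp
  then have "(\<lambda>\<omega>. \<integral>t. indicator {0..1} t *\<^sub>R h (complex_at d (e \<omega>) t \<inter> A) \<partial>lborel) \<in> borel_measurable (PiM J \<mu>)"
    by (intro lborel.borel_measurable_lebesgue_integral) (simp add: split_beta')
  then show ?thesis
    by (subst e) (simp add: level_integral_def set_lebesgue_integral_def)
qed

lemma measurable_level_integral'[measurable]:
  "finite A \<Longrightarrow> level_integral d h A \<in> borel_measurable (PiM (cubes_all d) \<mu>)"
  by (rule measurable_level_integral) auto

end

section \<open>Stabilisation of increments\<close>

text \<open>A sup-norm ball measured between lower corners, hence a translate of a box that depends
  on \<open>Q\<close> only through its position.\<close>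

definition ball_at :: "nat \<Rightarrow> nat \<Rightarrow> cube \<Rightarrow> cube set" where
  "ball_at d r Q = shift_cube (map fst Q) ` cube_box d (- int r) (int r)"

lemma in_shift_box_iff:
  assumes "length y = d"
  shows "R \<in> shift_cube y ` cube_box d a b \<longleftrightarrow> length R = d \<and> (\<forall>i<d. a \<le> fst (R ! i) - y ! i \<and> fst (R ! i) - y ! i \<le> b)"
proof
  assume "R \<in> shift_cube y ` cube_box d a b"
  then show "length R = d \<and> (\<forall>i<d. a \<le> fst (R ! i) - y ! i \<and> fst (R ! i) - y ! i \<le> b)"
    using assms by (auto simp: in_box_iff nth_shift_cube)
next
  assume R: "length R = d \<and> (\<forall>i<d. a \<le> fst (R ! i) - y ! i \<and> fst (R ! i) - y ! i \<le> b)"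
  then have "shift_cube (map uminus y) R \<in> cube_box d a b"
    using assms by (auto simp: in_box_iff nth_shift_cube)
  moreover have "R = shift_cube y (shift_cube (map uminus y) R)"
    using R assms by (simp add: shift_cube_uminus)
  ultimately show "R \<in> shift_cube y ` cube_box d a b" by blast
qed

lemma in_ball_at_iff:
  assumes "length Q = d"
  shows "R \<in> ball_at d r Q \<longleftrightarrow> length R = d \<and> (\<forall>i<d. \<bar>fst (R ! i) - fst (Q ! i)\<bar> \<le> int r)"
  unfolding ball_at_def using assms by (subst in_shift_box_iff) (auto simp: abs_le_iff)

lemma finite_ball_at[simp]: "finite (ball_at d r Q)"
  by (simp add: ball_at_def)

lemma ball_at_mono: "length Q = d \<Longrightarrow> r \<le> s \<Longrightarrow> ball_at d r Q \<subseteq> ball_at d s Q"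
  by (force simp: in_ball_at_iff)

lemma ball_at_subset_cubes_all: "length Q = d \<Longrightarrow> ball_at d r Q \<subseteq> cubes_all d"
  by (auto simp: in_ball_at_iff cubes_all_def)

lemma face_coordinate:
  assumes "cube_set R \<subseteq> cube_set Q" "i < length Q"
  shows "fst (Q ! i) \<le> fst (R ! i)" "fst (R ! i) \<le> fst (Q ! i) + 1"
proof -
  have "fst (Q ! i) \<le> fst (R ! i) \<and>
     fst (R ! i) + (if snd (R ! i) then 1 else 0) \<le> fst (Q ! i) + (if snd (Q ! i) then 1 else 0)"
    using assms by (simp add: cube_set_subset_iff)
  then show "fst (Q ! i) \<le> fst (R ! i)" "fst (R ! i) \<le> fst (Q ! i) + 1"
    by (auto split: if_splits)
qed

lemma faces_in_ball_at:
  assumes "length Q = d" "cube_set R \<subseteq> cube_set Q" "r \<ge> 1"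
  shows "R \<in> ball_at d r Q"
proof -
  have "length R = d" using assms by (simp add: cube_set_subset_iff)
  moreover have "\<bar>fst (R ! i) - fst (Q ! i)\<bar> \<le> int r" if "i < d" for i
    using face_coordinate[OF assms(2), of i] that assms by auto
  ultimately show ?thesis using assms(1) by (simp add: in_ball_at_iff)
qed

lemma finite_subset_ball_at:
  assumes "finite B" "B \<subseteq> cubes_all d" "length Q = d"
  shows "\<exists>s. B \<subseteq> ball_at d s Q"
  using assms
proof (induction B)
  case (insert R B)
  then obtain s where s: "B \<subseteq> ball_at d s Q" by auto
  define u where "u = (\<Sum>i<d. nat \<bar>fst (R ! i) - fst (Q ! i)\<bar>)"
  have "\<bar>fst (R ! i) - fst (Q ! i)\<bar> \<le> int u" if "i < d" for i
  proof -
    have "nat \<bar>fst (R ! i) - fst (Q ! i)\<bar> \<le> u"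
      unfolding u_def using that by (intro member_le_sum) auto
    then show ?thesis by linarith
  qed
  then have "R \<in> ball_at d u Q"
    using insert.prems by (simp add: in_ball_at_iff cubes_all_def)
  then have "insert R B \<subseteq> ball_at d (max s u) Q"
    using s ball_at_mono[OF insert.prems(2), of s "max s u"] ball_at_mono[OF insert.prems(2), of u "max s u"] by auto
  then show ?case ..
qed simp

context cubical_field
begin

definition increment :: "(cube set \<Rightarrow> real) \<Rightarrow> cube \<Rightarrow> cube set \<Rightarrow> (cube \<times> bool \<Rightarrow> real) \<Rightarrow> real" where
  "increment h Q A x = level_integral d h A (pick (cubes_all d) {} x) - level_integral d h A (pick (cubes_all d) {Q} x)"

definition mean_increment :: "(cube set \<Rightarrow> real) \<Rightarrow> cube \<Rightarrow> cube set \<Rightarrow> real" where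
  "mean_increment h Q A = D.expectation (\<lambda>x. \<bar>increment h Q A x\<bar>)"

lemma measurable_increment[measurable]:
  "finite A \<Longrightarrow> increment h Q A \<in> borel_measurable (doubled (cubes_all d) \<mu>)"
  unfolding increment_def by measurable

lemma pick_agree: "R \<in> cubes_all d \<Longrightarrow> R \<noteq> Q \<Longrightarrow> pick (cubes_all d) {} x R = pick (cubes_all d) {Q} x R"
  by (simp add: pick_def)

lemma integrable_increment:
  assumes "finite A"
  shows "integrable (doubled (cubes_all d) \<mu>) (increment h Q A)"
proof (rule D.integrable_const_bound[of _ "2 * (\<Sum>S\<in>Pow A. \<bar>h S\<bar>)"])
  have "\<bar>increment h Q A x\<bar> \<le> 2 * (\<Sum>S\<in>Pow A. \<bar>h S\<bar>)" for x
    using abs_level_integral_le[OF assms, of d h "pick (cubes_all d) {} x"]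
      abs_level_integral_le[OF assms, of d h "pick (cubes_all d) {Q} x"]
    unfolding increment_def by linarith
  then show "AE x in doubled (cubes_all d) \<mu>. norm (increment h Q A x) \<le> 2 * (\<Sum>S\<in>Pow A. \<bar>h S\<bar>)"
    by auto
qed (use assms in simp)

text \<open>Whether the value at \<open>Q\<close> goes up or down does not depend on the window, so
  both increments have the same sign and the one in the larger window is smaller in size.\<close>

lemma increment_window_mono:
  assumes h: "bounded_submodular c h" and B: "finite B" "A \<subseteq> B"
    and faces: "\<And>R. R \<in> cubes_all d \<Longrightarrow> cube_set R \<subseteq> cube_set Q \<Longrightarrow> R \<in> A"
  shows "\<bar>increment h Q A x - increment h Q B x\<bar> = \<bar>increment h Q A x\<bar> - \<bar>increment h Q B x\<bar>"
    and "\<bar>increment h Q B x\<bar> \<le> \<bar>increment h Q A x\<bar>"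
proof -
  let ?w = "pick (cubes_all d) {} x" and ?w' = "pick (cubes_all d) {Q} x"
  have agree: "\<And>R. R \<in> cubes_all d \<Longrightarrow> R \<noteq> Q \<Longrightarrow> ?w R = ?w' R"
    "\<And>R. R \<in> cubes_all d \<Longrightarrow> R \<noteq> Q \<Longrightarrow> ?w' R = ?w R"
    by (simp_all add: pick_agree)
  have "\<bar>increment h Q A x - increment h Q B x\<bar> = \<bar>increment h Q A x\<bar> - \<bar>increment h Q B x\<bar> \<and>
      \<bar>increment h Q B x\<bar> \<le> \<bar>increment h Q A x\<bar>"
  proof (cases "?w' Q \<le> ?w Q")
    case True
    have "level_integral d h B ?w \<le> level_integral d h B ?w'"
      "level_integral d h B ?w' - level_integral d h B ?w \<le> level_integral d h A ?w' - level_integral d h A ?w"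
      using level_integral_resample_mono[of c h B A d Q ?w ?w'] h B agree(1) True faces by blast+
    then show ?thesis unfolding increment_def by linarith
  next
    case False
    then have "?w Q \<le> ?w' Q" by simp
    then have "level_integral d h B ?w' \<le> level_integral d h B ?w"
      "level_integral d h B ?w - level_integral d h B ?w' \<le> level_integral d h A ?w - level_integral d h A ?w'"
      using level_integral_resample_mono[of c h B A d Q ?w' ?w] h B agree(2) faces by blast+
    then show ?thesis unfolding increment_def by linarith
  qed
  then show "\<bar>increment h Q A x - increment h Q B x\<bar> = \<bar>increment h Q A x\<bar> - \<bar>increment h Q B x\<bar>"
    "\<bar>increment h Q B x\<bar> \<le> \<bar>increment h Q A x\<bar>" by auto
qed

text \<open>The second part is the gain: an L1 distance becomes a difference of two numbers, which
  convergence of a monotone sequence controls.\<close>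

lemma mean_increment_antimono:
  assumes h: "bounded_submodular c h" and B: "finite B" "A \<subseteq> B"
    and faces: "\<And>R. R \<in> cubes_all d \<Longrightarrow> cube_set R \<subseteq> cube_set Q \<Longrightarrow> R \<in> A"
  shows "mean_increment h Q B \<le> mean_increment h Q A"
    and "D.expectation (\<lambda>x. \<bar>increment h Q A x - increment h Q B x\<bar>) = mean_increment h Q A - mean_increment h Q B"
proof -
  have A: "finite A" using B by (metis finite_subset)
  have mono: "\<bar>increment h Q A x - increment h Q B x\<bar> = \<bar>increment h Q A x\<bar> - \<bar>increment h Q B x\<bar>"
    "\<bar>increment h Q B x\<bar> \<le> \<bar>increment h Q A x\<bar>" for x
    by (rule increment_window_mono[OF h B faces]; assumption)+
  show "mean_increment h Q B \<le> mean_increment h Q A"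
    unfolding mean_increment_def using A B mono(2)
    by (intro integral_mono integrable_abs integrable_increment) auto
  show "D.expectation (\<lambda>x. \<bar>increment h Q A x - increment h Q B x\<bar>) = mean_increment h Q A - mean_increment h Q B"
    unfolding mean_increment_def mono(1)
    by (intro Bochner_Integration.integral_diff integrable_abs integrable_increment A B)
qed

definition shift_doubled :: "int list \<Rightarrow> (cube \<times> bool \<Rightarrow> real) \<Rightarrow> cube \<times> bool \<Rightarrow> real" where
  "shift_doubled y x = (\<lambda>p\<in>cubes_all d \<times> UNIV. x (shift_cube (map uminus y) (fst p), snd p))"

lemma distr_shift_doubled:
  assumes "length y = d"
  shows "distr (doubled (cubes_all d) \<mu>) (doubled (cubes_all d) \<mu>) (shift_doubled y) = doubled (cubes_all d) \<mu>"
    and "shift_doubled y \<in> measurable (doubled (cubes_all d) \<mu>) (doubled (cubes_all d) \<mu>)"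
proof -
  let ?f = "\<lambda>p::cube \<times> bool. (shift_cube (map uminus y) (fst p), snd p)"
  let ?I = "cubes_all d \<times> (UNIV::bool set)"
  have in_I: "?f \<in> ?I \<rightarrow> ?I"
    using assms by (auto simp: shift_cube_in_cubes_all)
  have inj: "inj_on ?f ?I"
    using inj_on_shift_cube[of "map uminus y"] assms by (auto simp: inj_on_def)
  have eq: "PiM ?I (\<lambda>p. \<mu> (fst (?f p))) = doubled (cubes_all d) \<mu>"
    unfolding doubled_def using assms by (intro PiM_cong refl) (auto simp: shift_\<mu>)
  have "distr (PiM ?I (\<lambda>p. \<mu> (fst p))) (PiM ?I (\<lambda>p. \<mu> (fst (?f p)))) (\<lambda>\<omega>. \<lambda>p\<in>?I. \<omega> (?f p)) = PiM ?I (\<lambda>p. \<mu> (fst (?f p)))"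
    by (rule distr_PiM_reindex[OF _ inj in_I]) (auto intro: prob_\<mu>)
  then show "distr (doubled (cubes_all d) \<mu>) (doubled (cubes_all d) \<mu>) (shift_doubled y) = doubled (cubes_all d) \<mu>"
    unfolding eq shift_doubled_def[abs_def] unfolding doubled_def .
  have "(\<lambda>\<omega>. \<lambda>p\<in>?I. \<omega> (?f p)) \<in> measurable (PiM ?I (\<lambda>p. \<mu> (fst p))) (PiM ?I (\<lambda>p. \<mu> (fst (?f p))))"
    by (rule measurable_restrict, rule measurable_component_singleton) (use in_I in auto)
  then show "shift_doubled y \<in> measurable (doubled (cubes_all d) \<mu>) (doubled (cubes_all d) \<mu>)"
    unfolding eq shift_doubled_def[abs_def] unfolding doubled_def .
qed

lemma pick_shift_doubled:
  assumes "length y = d" "S \<subseteq> cubes_all d"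
  shows "pick (cubes_all d) (shift_cube y ` S) (shift_doubled y x) = tau d y (pick (cubes_all d) S x)"
proof
  fix R
  show "pick (cubes_all d) (shift_cube y ` S) (shift_doubled y x) R = tau d y (pick (cubes_all d) S x) R"
  proof (cases "R \<in> cubes_all d")
    case True
    then have len: "length R = length y" using assms by (simp add: cubes_all_def)
    have "R \<in> shift_cube y ` S \<longleftrightarrow> shift_cube (map uminus y) R \<in> S"
    proof
      assume "R \<in> shift_cube y ` S"
      then show "shift_cube (map uminus y) R \<in> S"
        using assms by (auto simp: shift_cube_uminus cubes_all_def subset_iff)
    next
      assume "shift_cube (map uminus y) R \<in> S"
      then show "R \<in> shift_cube y ` S"
        using shift_cube_uminus(2)[OF len] by (metis imageI)
    qed
    then show ?thesis
      using True assms(1) by (simp add: pick_def tau_def shift_doubled_def shift_cube_in_cubes_all)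
  qed (simp add: pick_def tau_def)
qed

lemma mean_increment_shift:
  assumes "length y = d" "shift_invariant d h" "Q \<in> cubes_all d" "finite A" "A \<subseteq> cubes_all d"
  shows "mean_increment h (shift_cube y Q) (shift_cube y ` A) = mean_increment h Q A"
proof -
  let ?D = "doubled (cubes_all d) \<mu>"
  have inc: "increment h (shift_cube y Q) (shift_cube y ` A) (shift_doubled y x) = increment h Q A x" for x
    using pick_shift_doubled[OF assms(1), of "{}" x] pick_shift_doubled[OF assms(1), of "{Q}" x] assms(3)
      level_integral_tau[OF assms(1,2,4,5)]
    by (simp add: increment_def)
  have "mean_increment h (shift_cube y Q) (shift_cube y ` A)
      = integral\<^sup>L (distr ?D ?D (shift_doubled y)) (\<lambda>x. \<bar>increment h (shift_cube y Q) (shift_cube y ` A) x\<bar>)"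
    unfolding distr_shift_doubled(1)[OF assms(1)] mean_increment_def ..
  also have "\<dots> = D.expectation (\<lambda>x. \<bar>increment h (shift_cube y Q) (shift_cube y ` A) (shift_doubled y x)\<bar>)"
    using assms(4) by (intro integral_distr distr_shift_doubled(2)[OF assms(1)]) auto
  finally show ?thesis
    unfolding inc mean_increment_def .
qed

text \<open>Mean increments over growing balls decrease and are nonnegative, hence converge. Any two
  nested windows containing a large ball are squeezed between that ball and a still larger one, and
  translation invariance makes the radius independent of \<open>Q\<close>.\<close>

lemma increment_stabilises:
  assumes h: "bounded_submodular c h" "shift_invariant d h" and "e > 0"
  shows "\<exists>r\<ge>1. \<forall>Q\<in>cubes_all d. \<forall>A B. finite B \<longrightarrow> B \<subseteq> cubes_all d \<longrightarrow> ball_at d r Q \<subseteq> A \<longrightarrow> A \<subseteq> B \<longrightarrow>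
    D.expectation (\<lambda>x. \<bar>increment h Q A x - increment h Q B x\<bar>) \<le> e"
proof -
  \<comment> \<open>Radius \<open>Suc n\<close> because a ball contains all faces of its centre only
    from radius 1 on.\<close>
  define a where "a Q n = mean_increment h Q (ball_at d (Suc n) Q)" for Q n
  have dec: "a Q n \<le> a Q m" if "length Q = d" "m \<le> n" for Q m n
    unfolding a_def using that
    by (intro mean_increment_antimono(1)[OF h(1)] ball_at_mono finite_ball_at faces_in_ball_at) auto
  have ev: "\<forall>\<^sub>F n in sequentially. \<forall>m. a Q n - a Q m \<le> e" if "length Q = d" for Q
  proof -
    have "decseq (a Q)" using dec[OF that] by (auto simp: decseq_def)
    moreover have "0 \<le> a Q n" for n by (simp add: a_def mean_increment_def)
    ultimately obtain L where L: "a Q \<longlonglongrightarrow> L" "\<And>n. L \<le> a Q n"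
      using decseq_convergent[of "a Q" 0] by metis
    have "\<forall>\<^sub>F n in sequentially. a Q n < L + e"
      using L(1) \<open>e > 0\<close> by (intro order_tendstoD) auto
    then show ?thesis
    proof eventually_elim
      case (elim n)
      show ?case
      proof
        fix m show "a Q n - a Q m \<le> e" using elim L(2)[of m] by linarith
      qed
    qed
  qed
  \<comment> \<open>Over the origin there is one cube for each choice of nondegenerate directions,
    so finitely many eventual statements are combined into one.\<close>
  have "\<forall>\<^sub>F n in sequentially. \<forall>Q\<in>cube_box d 0 0. \<forall>m. a Q n - a Q m \<le> e"
    by (intro eventually_ball_finite ballI ev) (auto simp: in_box_iff)
  then obtain n where n: "\<And>Q m. Q \<in> cube_box d 0 0 \<Longrightarrow> a Q n - a Q m \<le> e"
    by (auto simp: eventually_sequentially)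
  have "D.expectation (\<lambda>x. \<bar>increment h Q A x - increment h Q B x\<bar>) \<le> e"
    if Q: "Q \<in> cubes_all d" and B: "finite B" "B \<subseteq> cubes_all d" and AB: "ball_at d (Suc n) Q \<subseteq> A" "A \<subseteq> B" for Q A B
  proof -
    have len: "length Q = d" using Q by (simp add: cubes_all_def)
    have A: "finite A" using B AB by (metis finite_subset)
    obtain s where s: "B \<subseteq> ball_at d s Q"
      using finite_subset_ball_at[OF B len] by auto
    define m where "m = max s n"
    have Bm: "B \<subseteq> ball_at d (Suc m) Q"
      using s ball_at_mono[OF len, of s "Suc m"] unfolding m_def by (meson le_SucI max.cobounded1 order_trans)
    have faces: "R \<in> ball_at d (Suc n) Q" if "cube_set R \<subseteq> cube_set Q" for R
      by (rule faces_in_ball_at[OF len that]) simp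
    have "D.expectation (\<lambda>x. \<bar>increment h Q A x - increment h Q B x\<bar>) = mean_increment h Q A - mean_increment h Q B"
      using faces AB by (intro mean_increment_antimono(2)[OF h(1)] B) auto
    also have "\<dots> \<le> a Q n - a Q m"
      unfolding a_def using faces AB Bm A
      by (intro diff_mono mean_increment_antimono(1)[OF h(1)] A finite_ball_at) auto
    also have "\<dots> \<le> e"
    proof -
      define Q0 where "Q0 = map (\<lambda>p. (0::int, snd p)) Q"
      define y where "y = map fst Q"
      have y: "length y = d" and Q0: "Q0 \<in> cube_box d 0 0" "Q0 \<in> cubes_all d"
        using len by (auto simp: y_def Q0_def in_box_iff cubes_all_def)
      have QQ0: "Q = shift_cube y Q0"
        using len by (auto simp: list_eq_iff_nth_eq nth_shift_cube y_def Q0_def)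
      have ball0: "ball_at d r Q0 = cube_box d (- int r) (int r)" for r
      proof (rule set_eqI)
        fix R
        show "R \<in> ball_at d r Q0 \<longleftrightarrow> R \<in> cube_box d (- int r) (int r)"
          using len by (subst in_ball_at_iff) (auto simp: in_box_iff Q0_def abs_le_iff)
      qed
      have "a Q k = a Q0 k" for k
      proof -
        have "ball_at d (Suc k) Q = shift_cube y ` ball_at d (Suc k) Q0"
          unfolding ball0 by (simp add: ball_at_def y_def)
        then have "a Q k = mean_increment h (shift_cube y Q0) (shift_cube y ` ball_at d (Suc k) Q0)"
          unfolding a_def by (simp add: QQ0[symmetric])
        also have "\<dots> = a Q0 k"
          unfolding a_def using Q0(2)
          by (intro mean_increment_shift y h(2) ball_at_subset_cubes_all finite_ball_at) (auto simp: cubes_all_def)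
        finally show ?thesis .
      qed
      then show ?thesis using n[OF Q0(1), of m] by simp
    qed
    finally show ?thesis .
  qed
  then show ?thesis by (intro exI[of _ "Suc n"] conjI ballI allI impI) auto
qed

end

section \<open>Blocks\<close>

lemma (in prob_space) expectation_square_indep_sum:
  fixes X :: "'i \<Rightarrow> 'a \<Rightarrow> real"
  assumes "finite J" and indep: "indep_vars (\<lambda>_. borel) X J"
    and bound: "\<And>i x. i \<in> J \<Longrightarrow> x \<in> space M \<Longrightarrow> \<bar>X i x\<bar> \<le> B"
    and mean: "\<And>i. i \<in> J \<Longrightarrow> expectation (X i) = 0"
  shows "expectation (\<lambda>x. (\<Sum>i\<in>J. X i x)\<^sup>2) = (\<Sum>i\<in>J. expectation (\<lambda>x. (X i x)\<^sup>2))"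
proof -
  have rv[measurable]: "random_variable borel (X i)" if "i \<in> J" for i
    using indep that by (auto simp: indep_vars_def2)
  have int: "integrable M (X i)" if "i \<in> J" for i
    using that by (intro integrable_const_bound[of _ B]) (auto intro: bound)
  have int2: "integrable M (\<lambda>x. X i x * X j x)" if "i \<in> J" "j \<in> J" for i j
  proof (rule integrable_const_bound[of _ "B * B"])
    show "AE x in M. norm (X i x * X j x) \<le> B * B"
    proof (rule AE_I2)
      fix x assume "x \<in> space M"
      then show "norm (X i x * X j x) \<le> B * B"
        using bound[OF that(1), of x] bound[OF that(2), of x] by (auto simp: abs_mult intro!: mult_mono)
    qed
  qed (use that in simp)
  have cross: "expectation (\<lambda>x. X i x * X j x) = (if i = j then expectation (\<lambda>x. (X i x)\<^sup>2) else 0)"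
    if "i \<in> J" "j \<in> J" for i j
  proof (cases "i = j")
    case False
    have "expectation (\<lambda>x. \<Prod>k\<in>{i, j}. X k x) = (\<Prod>k\<in>{i, j}. expectation (X k))"
      using that int by (intro indep_vars_lebesgue_integral indep_vars_subset[OF indep]) auto
    then show ?thesis
      using False that mean by simp
  qed (simp add: power2_eq_square)
  have "expectation (\<lambda>x. (\<Sum>i\<in>J. X i x)\<^sup>2) = expectation (\<lambda>x. \<Sum>i\<in>J. \<Sum>j\<in>J. X i x * X j x)"
    by (simp add: power2_eq_square sum_product)
  also have "\<dots> = (\<Sum>i\<in>J. \<Sum>j\<in>J. expectation (\<lambda>x. X i x * X j x))"
    using int2 by (subst Bochner_Integration.integral_sum) (auto intro!: Bochner_Integration.integrable_sum)
  also have "\<dots> = (\<Sum>i\<in>J. \<Sum>j\<in>J. if i = j then expectation (\<lambda>x. (X i x)\<^sup>2) else 0)"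
    by (intro sum.cong refl cross) auto
  finally show ?thesis using \<open>finite J\<close> by (simp add: sum.delta)
qed

section \<open>Geometry of blocks, cells and cores\<close>

definition grid :: "nat \<Rightarrow> nat \<Rightarrow> int list set" where
  "grid d k = {z. set z \<subseteq> {- int k..int k} \<and> length z = d}"

lemma in_grid_iff: "z \<in> grid d k \<longleftrightarrow> length z = d \<and> (\<forall>i<d. \<bar>z ! i\<bar> \<le> int k)"
  unfolding grid_def subset_eq all_set_conv_all_nth by (auto simp: abs_le_iff)

lemma finite_grid[simp]: "finite (grid d k)"
  unfolding grid_def by (rule finite_lists_length_eq) simp

lemma card_grid: "card (grid d k) = (2 * k + 1) ^ d"
  unfolding grid_def by (subst card_lists_length_eq) (auto intro!: arg_cong[of _ _ "\<lambda>x. x ^ d"])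

text \<open>A block extends \<open>m\<close> in each direction, and cofaces of its cubes have lower
  corners from \<open>- m - 1\<close> to \<open>m\<close> relative to the centre:
  \<open>2 * m + 2\<close> integers per direction. With this spacing the cells are disjoint and
  leave no gap.\<close>

definition center :: "nat \<Rightarrow> int list \<Rightarrow> int list" where
  "center m z = map (\<lambda>l. (2 * int m + 2) * l) z"

definition block :: "nat \<Rightarrow> nat \<Rightarrow> int list \<Rightarrow> cube set" where
  "block d m z = shift_cube (center m z) ` window d m"

text \<open>It contains all coordinates that the functional of the block can read; see
  \<open>coface_in_cell\<close>.\<close>

definition cell :: "nat \<Rightarrow> nat \<Rightarrow> int list \<Rightarrow> cube set" where
  "cell d m z = shift_cube (center m z) ` cube_box d (- int m - 1) (int m)"

lemma length_center[simp]: "length (center m z) = length z"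
  by (simp add: center_def)

lemma finite_block[simp]: "finite (block d m z)"
  by (simp add: block_def)

lemma block_coordinates:
  assumes "length z = d" "R \<in> block d m z"
  shows "length R = d" "\<And>i. i < d \<Longrightarrow> - int m \<le> fst (R ! i) - center m z ! i"
    "\<And>i. i < d \<Longrightarrow> fst (R ! i) - center m z ! i + (if snd (R ! i) then 1 else 0) \<le> int m"
proof -
  obtain R' where R': "R' \<in> window d m" "R = shift_cube (center m z) R'"
    using assms by (auto simp: block_def)
  then have len: "length R' = d" by (simp add: window_def)
  then show "length R = d" using R' assms by simp
  fix i assume "i < d"
  then have "R ! i = (fst (R' ! i) + center m z ! i, snd (R' ! i))"
    using R' len assms by (simp add: nth_shift_cube)
  then show "- int m \<le> fst (R ! i) - center m z ! i"
    "fst (R ! i) - center m z ! i + (if snd (R ! i) then 1 else 0) \<le> int m"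
    using R'(1) \<open>i < d\<close> by (simp_all add: window_def)
qed

lemma in_blockI:
  assumes "length z = d" "length R = d"
    and "\<And>i. i < d \<Longrightarrow> - int m \<le> fst (R ! i) - center m z ! i \<and> fst (R ! i) - center m z ! i + 1 \<le> int m"
  shows "R \<in> block d m z"
proof -
  have "shift_cube (map uminus (center m z)) R \<in> window d m"
    unfolding window_def
  proof (intro CollectI conjI allI impI)
    fix i assume i: "i < d"
    have "shift_cube (map uminus (center m z)) R ! i = (fst (R ! i) - center m z ! i, snd (R ! i))"
      using i assms by (simp add: nth_shift_cube)
    then show "- int m \<le> fst (shift_cube (map uminus (center m z)) R ! i)"
      "fst (shift_cube (map uminus (center m z)) R ! i) + (if snd (shift_cube (map uminus (center m z)) R ! i) then 1 else 0) \<le> int m"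
      using assms(3)[OF i] by simp_all
  qed (use assms in simp)
  moreover have "R = shift_cube (center m z) (shift_cube (map uminus (center m z)) R)"
    using assms by (simp add: shift_cube_uminus)
  ultimately show ?thesis unfolding block_def by blast
qed

lemma in_cell_iff:
  "length z = d \<Longrightarrow> Q \<in> cell d m z \<longleftrightarrow> length Q = d \<and>
     (\<forall>i<d. - int m - 1 \<le> fst (Q ! i) - center m z ! i \<and> fst (Q ! i) - center m z ! i \<le> int m)"
  unfolding cell_def by (rule in_shift_box_iff) simp

lemma cell_subset_cubes_all: "length z = d \<Longrightarrow> cell d m z \<subseteq> cubes_all d"
  by (auto simp: in_cell_iff cubes_all_def)

lemma block_subset_cubes_all: "length z = d \<Longrightarrow> block d m z \<subseteq> cubes_all d"
  using block_coordinates(1) by (auto simp: cubes_all_def)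

lemma coface_in_cell:
  assumes "length z = d" "R \<in> block d m z" "Q \<in> cubes_all d" "cube_set R \<subseteq> cube_set Q"
  shows "Q \<in> cell d m z"
proof -
  have "- int m - 1 \<le> fst (Q ! i) - center m z ! i \<and> fst (Q ! i) - center m z ! i \<le> int m" if "i < d" for i
  proof -
    have 1: "fst (Q ! i) \<le> fst (R ! i)" "fst (R ! i) \<le> fst (Q ! i) + 1"
      using face_coordinate[OF assms(4), of i] that assms(3) by (auto simp: cubes_all_def)
    have 2: "- int m \<le> fst (R ! i) - center m z ! i" "fst (R ! i) - center m z ! i \<le> int m"
      using block_coordinates(2,3)[OF assms(1,2) that] by (auto split: if_splits)
    show ?thesis using 1 2 by linarith
  qed
  then show ?thesis using assms by (simp add: in_cell_iff cubes_all_def)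
qed

lemma cells_disjoint:
  assumes "length z = d" "length z' = d" "Q \<in> cell d m z" "Q \<in> cell d m z'"
  shows "z = z'"
proof (rule nth_equalityI)
  fix i assume "i < length z"
  then have i: "i < d" using assms by simp
  let ?s = "2 * int m + 2"
  have c: "center m z ! i = ?s * z ! i" "center m z' ! i = ?s * z' ! i"
    using i assms by (auto simp: center_def)
  have "- int m - 1 \<le> fst (Q ! i) - ?s * z ! i" "fst (Q ! i) - ?s * z ! i \<le> int m"
    "- int m - 1 \<le> fst (Q ! i) - ?s * z' ! i" "fst (Q ! i) - ?s * z' ! i \<le> int m"
    using assms(3,4) i unfolding in_cell_iff[OF assms(1)] in_cell_iff[OF assms(2)] c[symmetric] by auto
  \<comment> \<open>Both offsets lie among \<open>?s\<close> consecutive integers, so the two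
    centres differ by less than one spacing.\<close>
  then have "?s * (z ! i - z' ! i) < ?s * 1" "?s * (z' ! i - z ! i) < ?s * 1"
    by (simp_all add: algebra_simps)
  then have "z ! i - z' ! i < 1" "z' ! i - z ! i < 1"
    by (subst (asm) mult_less_cancel_left_pos; simp)+
  then show "z ! i = z' ! i" by linarith
qed (use assms in simp)

lemma block_subset_cell: "length z = d \<Longrightarrow> block d m z \<subseteq> cell d m z"
  using coface_in_cell[of z d _ m] block_subset_cubes_all[of z d m] by blast

lemma blocks_disjoint:
  "length z = d \<Longrightarrow> length z' = d \<Longrightarrow> z \<noteq> z' \<Longrightarrow> block d m z \<inter> block d m z' = {}"
  using block_subset_cell[of z d m] block_subset_cell[of z' d m] cells_disjoint[of z d z' _ m] by blast

lemma center_bound: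
  assumes "z \<in> grid d k" "i < d"
  shows "\<bar>center m z ! i\<bar> \<le> int (k * (2 * m + 2))"
proof -
  have "\<bar>center m z ! i\<bar> = (2 * int m + 2) * \<bar>z ! i\<bar>"
    using assms by (simp add: center_def in_grid_iff abs_mult)
  also have "\<dots> \<le> (2 * int m + 2) * int k"
    using assms by (intro mult_left_mono) (auto simp: in_grid_iff)
  finally show ?thesis by (simp add: algebra_simps)
qed

lemma block_subset_window:
  assumes "z \<in> grid d k" "k * (2 * m + 2) + m \<le> n"
  shows "block d m z \<subseteq> window d n"
proof
  fix R assume R: "R \<in> block d m z"
  have z: "length z = d" using assms by (simp add: in_grid_iff)
  have "int (k * (2 * m + 2)) + int m \<le> int n"
    using assms(2) by (simp flip: of_nat_add)
  then have "- int n \<le> fst (R ! i) \<and> fst (R ! i) + (if snd (R ! i) then 1 else 0) \<le> int n" if "i < d" for i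
    using block_coordinates(2,3)[OF z R that] center_bound[OF assms(1) that, of m] by linarith
  then show "R \<in> window d n"
    using block_coordinates(1)[OF z R] by (simp add: window_def)
qed

text \<open>The radius leaves room for a ball of radius \<open>r\<close> and for one further unit,
  since a nondegenerate cube ends one above its lower corner.\<close>

definition core :: "nat \<Rightarrow> nat \<Rightarrow> nat \<Rightarrow> int list \<Rightarrow> cube set" where
  "core d m r z = shift_cube (center m z) ` cube_box d (- int (m - r - 1)) (int (m - r - 1))"

lemma in_core_iff:
  "length z = d \<Longrightarrow> Q \<in> core d m r z \<longleftrightarrow> length Q = d \<and>
     (\<forall>i<d. - int (m - r - 1) \<le> fst (Q ! i) - center m z ! i \<and> fst (Q ! i) - center m z ! i \<le> int (m - r - 1))"
  unfolding core_def by (rule in_shift_box_iff) simp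

lemma card_core:
  assumes "length z = d" "r < m"
  shows "card (core d m r z) = (2 * (2 * (m - r) - 1)) ^ d"
proof -
  have "cube_box d (- int (m - r - 1)) (int (m - r - 1)) \<subseteq> cubes_all (length (center m z))"
    using assms(1) box_subset_cubes_all by simp
  then have "card (core d m r z) = card (cube_box d (- int (m - r - 1)) (int (m - r - 1)))"
    unfolding core_def by (intro card_image inj_on_subset[OF inj_on_shift_cube])
  also have "\<dots> = (2 * (2 * (m - r) - 1)) ^ d"
    unfolding card_box by (rule arg_cong[of _ _ "\<lambda>x. (2 * x) ^ d"]) (use assms(2) in auto)
  finally show ?thesis .
qed

lemma core_subset_cell:
  assumes "length z = d"
  shows "core d m r z \<subseteq> cell d m z"
proof
  fix Q assume "Q \<in> core d m r z"
  then show "Q \<in> cell d m z"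
    unfolding in_core_iff[OF assms] in_cell_iff[OF assms] by force
qed

lemma ball_at_core_subset_block:
  assumes "length z = d" "Q \<in> core d m r z" "r < m"
  shows "ball_at d r Q \<subseteq> block d m z"
proof
  fix R assume R: "R \<in> ball_at d r Q"
  have len: "length Q = d" using assms by (simp add: in_core_iff)
  show "R \<in> block d m z"
  proof (rule in_blockI[OF assms(1)])
    show "length R = d" using R len by (simp add: in_ball_at_iff)
    fix i assume i: "i < d"
    have "\<bar>fst (R ! i) - fst (Q ! i)\<bar> \<le> int r" using R len i by (simp add: in_ball_at_iff)
    moreover have "- int (m - r - 1) \<le> fst (Q ! i) - center m z ! i" "fst (Q ! i) - center m z ! i \<le> int (m - r - 1)"
      using assms(2) i by (simp_all add: in_core_iff[OF assms(1)])
    moreover have "int (m - r - 1) = int m - int r - 1" using assms(3) by simp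
    ultimately show "- int m \<le> fst (R ! i) - center m z ! i \<and> fst (R ! i) - center m z ! i + 1 \<le> int m"
      by linarith
  qed
qed

lemma core_subset_box:
  assumes "z \<in> grid d k" "k * (2 * m + 2) + m \<le> n"
  shows "core d m r z \<subseteq> cube_box d (- int n - 1) (int n)"
proof
  fix Q assume Q: "Q \<in> core d m r z"
  have z: "length z = d" using assms by (simp add: in_grid_iff)
  have "int (k * (2 * m + 2)) + int m \<le> int n"
    using assms(2) by (simp flip: of_nat_add)
  moreover have "int (m - r - 1) \<le> int m" by simp
  ultimately have "- int n - 1 \<le> fst (Q ! i) \<and> fst (Q ! i) \<le> int n" if "i < d" for i
    using Q that center_bound[OF assms(1) that, of m] unfolding in_core_iff[OF z] by force
  then show "Q \<in> cube_box d (- int n - 1) (int n)"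
    using Q by (simp add: in_box_iff in_core_iff[OF z])
qed

lemma coface_window_in_box:
  assumes "R \<in> window d n" "Q \<in> cubes_all d" "cube_set R \<subseteq> cube_set Q"
  shows "Q \<in> cube_box d (- int n - 1) (int n)"
proof -
  have "- int n - 1 \<le> fst (Q ! i) \<and> fst (Q ! i) \<le> int n" if "i < d" for i
  proof -
    have "fst (Q ! i) \<le> fst (R ! i)" "fst (R ! i) \<le> fst (Q ! i) + 1"
      using face_coordinate[OF assms(3), of i] that assms(2) by (auto simp: cubes_all_def)
    moreover have "R \<in> cube_box d (- int n) (int n)" using assms(1) window_subset_box by blast
    then have "- int n \<le> fst (R ! i)" "fst (R ! i) \<le> int n" using that by (auto simp: in_box_iff)
    ultimately show ?thesis by linarith
  qed
  then show ?thesis using assms(2) by (simp add: in_box_iff cubes_all_def)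
qed

text \<open>In the crude bound, each direction offers two lower ends and two types.\<close>

lemma finite_faces: "finite {R. cube_set R \<subseteq> cube_set Q}"
  and card_faces_le: "length Q = d \<Longrightarrow> card {R. cube_set R \<subseteq> cube_set Q} \<le> 4 ^ d"
proof -
  have sub: "{R. cube_set R \<subseteq> cube_set Q} \<subseteq> shift_cube (map fst Q) ` cube_box (length Q) 0 1"
  proof
    fix R assume "R \<in> {R. cube_set R \<subseteq> cube_set Q}"
    then have R: "cube_set R \<subseteq> cube_set Q" by simp
    then have "length R = length Q" by (simp add: cube_set_subset_iff)
    moreover have "0 \<le> fst (R ! i) - map fst Q ! i \<and> fst (R ! i) - map fst Q ! i \<le> 1" if "i < length Q" for i
      using face_coordinate[OF R that] that by simp
    ultimately show "R \<in> shift_cube (map fst Q) ` cube_box (length Q) 0 1"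
      by (simp add: in_shift_box_iff)
  qed
  then show fin: "finite {R. cube_set R \<subseteq> cube_set Q}"
    by (rule finite_subset) simp
  assume "length Q = d"
  have "card {R. cube_set R \<subseteq> cube_set Q} \<le> card (shift_cube (map fst Q) ` cube_box (length Q) 0 1)"
    using sub by (intro card_mono) auto
  also have "\<dots> \<le> card (cube_box (length Q) 0 1)" by (rule card_image_le) simp
  finally show "card {R. cube_set R \<subseteq> cube_set Q} \<le> 4 ^ d"
    using \<open>length Q = d\<close> by (simp add: card_box)
qed

section \<open>Variance of the block approximation\<close>

context cubical_field
begin

lemma distr_tau:
  assumes "length y = d"
  shows "distr (PiM (cubes_all d) \<mu>) (PiM (cubes_all d) \<mu>) (tau d y) = PiM (cubes_all d) \<mu>"
    and "tau d y \<in> measurable (PiM (cubes_all d) \<mu>) (PiM (cubes_all d) \<mu>)"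
proof -
  let ?f = "shift_cube (map uminus y)"
  have in_I: "?f \<in> cubes_all d \<rightarrow> cubes_all d"
    using assms by (auto simp: shift_cube_in_cubes_all)
  have inj: "inj_on ?f (cubes_all d)"
    using inj_on_shift_cube[of "map uminus y"] assms by simp
  have eq: "PiM (cubes_all d) (\<lambda>Q. \<mu> (?f Q)) = PiM (cubes_all d) \<mu>"
    using assms by (intro PiM_cong refl) (auto simp: shift_\<mu>)
  have "distr (PiM (cubes_all d) \<mu>) (PiM (cubes_all d) (\<lambda>Q. \<mu> (?f Q))) (\<lambda>\<omega>. \<lambda>Q\<in>cubes_all d. \<omega> (?f Q)) = PiM (cubes_all d) (\<lambda>Q. \<mu> (?f Q))"
    by (rule distr_PiM_reindex[OF prob_\<mu> inj in_I])
  then show "distr (PiM (cubes_all d) \<mu>) (PiM (cubes_all d) \<mu>) (tau d y) = PiM (cubes_all d) \<mu>"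
    unfolding eq tau_def[abs_def] .
  have "(\<lambda>\<omega>. \<lambda>Q\<in>cubes_all d. \<omega> (?f Q)) \<in> measurable (PiM (cubes_all d) \<mu>) (PiM (cubes_all d) (\<lambda>Q. \<mu> (?f Q)))"
    by (rule measurable_restrict, rule measurable_component_singleton) (use in_I in auto)
  then show "tau d y \<in> measurable (PiM (cubes_all d) \<mu>) (PiM (cubes_all d) \<mu>)"
    unfolding eq tau_def[abs_def] .
qed

lemma expectation_level_integral_shift:
  fixes f :: "real \<Rightarrow> real"
  assumes "length y = d" "shift_invariant d h" "finite A" "A \<subseteq> cubes_all d" and f: "f \<in> borel_measurable borel"
  shows "P.expectation (\<lambda>\<omega>. f (level_integral d h (shift_cube y ` A) \<omega>)) = P.expectation (\<lambda>\<omega>. f (level_integral d h A \<omega>))"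
proof -
  let ?\<Omega> = "PiM (cubes_all d) \<mu>"
  have "P.expectation (\<lambda>\<omega>. f (level_integral d h (shift_cube y ` A) \<omega>))
      = integral\<^sup>L (distr ?\<Omega> ?\<Omega> (tau d y)) (\<lambda>\<omega>. f (level_integral d h (shift_cube y ` A) \<omega>))"
    unfolding distr_tau(1)[OF assms(1)] ..
  also have "\<dots> = P.expectation (\<lambda>\<omega>. f (level_integral d h (shift_cube y ` A) (tau d y \<omega>)))"
    using assms(3) by (intro integral_distr distr_tau(2)[OF assms(1)] measurable_compose[OF _ f]) auto
  finally show ?thesis
    unfolding level_integral_tau[OF assms(1-4)] .
qed

text \<open>Each block functional reads only its own cell, and cells are disjoint. Disjointness of
  the blocks alone would not suffice, because cofaces reach outside them.\<close>

lemma indep_vars_blocks: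
  "P.indep_vars (\<lambda>_. borel) (\<lambda>z \<omega>. level_integral d h (block d m z) \<omega> - a) (grid d k)"
proof -
  have z: "length z = d" if "z \<in> grid d k" for z using that by (simp add: in_grid_iff)
  have "P.indep_vars \<mu> (\<lambda>Q \<omega>. \<omega> Q) (cubes_all d)"
    by (rule indep_vars_PiM_components) (rule prob_\<mu>)
  then have "P.indep_vars (\<lambda>z. PiM (cell d m z) \<mu>) (\<lambda>z \<omega>. restrict (\<lambda>Q. \<omega> Q) (cell d m z)) (grid d k)"
  proof (rule P.indep_vars_restrict)
    show "cell d m z \<subseteq> cubes_all d" if "z \<in> grid d k" for z
      using cell_subset_cubes_all[OF z[OF that]] .
    show "disjoint_family_on (cell d m) (grid d k)"
      unfolding disjoint_family_on_def using cells_disjoint[OF z z, of _ _ _ m] by blast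
  qed
  then have "P.indep_vars (\<lambda>_. borel)
      (\<lambda>z \<omega>. level_integral d h (block d m z) (restrict (\<lambda>Q. \<omega> Q) (cell d m z)) - a) (grid d k)"
  proof (rule P.indep_vars_compose2)
    fix i assume "i \<in> grid d k"
    then have len: "length i = d" by (rule z)
    have "level_integral d h (block d m i) \<in> borel_measurable (PiM (cell d m i) \<mu>)"
      using cell_subset_cubes_all[OF len] coface_in_cell[OF len] by (intro measurable_level_integral) auto
    then show "(\<lambda>\<omega>. level_integral d h (block d m i) \<omega> - a) \<in> borel_measurable (PiM (cell d m i) \<mu>)"
      by simp
  qed
  moreover have "level_integral d h (block d m z) (restrict (\<lambda>Q. \<omega> Q) (cell d m z)) = level_integral d h (block d m z) \<omega>"
    if "z \<in> grid d k" for z \<omega>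
    using coface_in_cell[OF z[OF that]] by (intro level_integral_cong) auto
  ultimately show ?thesis
    by (subst P.indep_vars_cong[OF refl _ refl]) auto
qed

end

text \<open>The difference of the two functions has increments of either sign, so both parts are
  kept to apply the monotonicity argument to each.\<close>

locale stable_functional = cubical_field +
  fixes h1 h2 :: "cube set \<Rightarrow> real" and c :: real
  assumes submod1: "bounded_submodular c h1" and submod2: "bounded_submodular c h2"
    and shift1: "shift_invariant d h1" and shift2: "shift_invariant d h2"
begin

definition h :: "cube set \<Rightarrow> real" where
  "h S = h1 S - h2 S"

lemma c_nonneg: "c \<ge> 0"
proof -
  have "h1 {} \<le> h1 {[]} \<and> h1 {[]} \<le> h1 {} + c"
    using submod1 unfolding bounded_submodular_def by (metis finite.emptyI)
  then show ?thesis by linarith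
qed

lemma shift_h: "shift_invariant d h"
  using shift1 shift2 by (auto simp: shift_invariant_def h_def)

lemma level_integral_h: "finite A \<Longrightarrow> level_integral d h A \<omega> = level_integral d h1 A \<omega> - level_integral d h2 A \<omega>"
  unfolding h_def[abs_def] by (rule level_integral_diff)

lemma increment_h: "finite A \<Longrightarrow> increment h Q A x = increment h1 Q A x - increment h2 Q A x"
  by (simp add: increment_def level_integral_h)

lemma abs_increment_h_le:
  assumes "finite A"
  shows "\<bar>increment h Q A x\<bar> \<le> 2 * c * card {R\<in>A. cube_set R \<subseteq> cube_set Q}"
proof -
  have "\<bar>increment h1 Q A x\<bar> \<le> c * card {R\<in>A. cube_set R \<subseteq> cube_set Q}"
    unfolding increment_def by (rule level_integral_resample_le[OF submod1 assms c_nonneg pick_agree])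
  moreover have "\<bar>increment h2 Q A x\<bar> \<le> c * card {R\<in>A. cube_set R \<subseteq> cube_set Q}"
    unfolding increment_def by (rule level_integral_resample_le[OF submod2 assms c_nonneg pick_agree])
  ultimately show ?thesis unfolding increment_h[OF assms] by linarith
qed

definition remainder :: "nat \<Rightarrow> nat \<Rightarrow> nat \<Rightarrow> (cube \<Rightarrow> real) \<Rightarrow> real" where
  "remainder m k n \<omega> = level_integral d h (window d n) \<omega> - (\<Sum>z\<in>grid d k. level_integral d h (block d m z) \<omega>)"

definition remainder_increment :: "nat \<Rightarrow> nat \<Rightarrow> nat \<Rightarrow> cube \<Rightarrow> (cube \<times> bool \<Rightarrow> real) \<Rightarrow> real" where
  "remainder_increment m k n Q x = increment h Q (window d n) x - (\<Sum>z\<in>grid d k. increment h Q (block d m z) x)"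

lemma remainder_increment_eq:
  "remainder m k n (pick (cubes_all d) {} x) - remainder m k n (pick (cubes_all d) {Q} x) = remainder_increment m k n Q x"
  by (simp add: remainder_def remainder_increment_def increment_def sum_subtractf)

lemma measurable_remainder[measurable]: "remainder m k n \<in> borel_measurable (PiM (cubes_all d) \<mu>)"
  unfolding remainder_def[abs_def] by measurable

lemma measurable_remainder_increment[measurable]:
  "remainder_increment m k n Q \<in> borel_measurable (doubled (cubes_all d) \<mu>)"
  unfolding remainder_increment_def[abs_def] by measurable

text \<open>Each of \<open>h1\<close> and \<open>h2\<close> changes by at most \<open>c\<close> per
  face of the resampled cube, which gives \<open>2 * c * 4 ^ d\<close> for the window. All blocks
  together contribute at most the same amount.\<close>

definition C :: real where
  "C = 4 * c * 4 ^ d"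

lemma C_nonneg: "C \<ge> 0"
  using c_nonneg by (simp add: C_def)

lemma abs_remainder_increment_le:
  assumes "Q \<in> cubes_all d"
  shows "\<bar>remainder_increment m k n Q x\<bar> \<le> C"
proof -
  let ?F = "{R. cube_set R \<subseteq> cube_set Q}"
  have F: "card ?F \<le> 4 ^ d" using assms by (intro card_faces_le) (simp add: cubes_all_def)
  have W: "card {R\<in>window d n. cube_set R \<subseteq> cube_set Q} \<le> 4 ^ d"
    by (rule order_trans[OF card_mono F]) (auto simp: finite_faces)
  \<comment> \<open>Disjoint blocks share out the faces of \<open>Q\<close>, so the bound does not
    grow with the number of blocks.\<close>
  have "(\<Sum>z\<in>grid d k. card {R\<in>block d m z. cube_set R \<subseteq> cube_set Q})
      = card (\<Union>z\<in>grid d k. {R\<in>block d m z. cube_set R \<subseteq> cube_set Q})"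
  proof (rule card_UN_disjoint[symmetric])
    show "\<forall>z\<in>grid d k. \<forall>z'\<in>grid d k. z \<noteq> z' \<longrightarrow>
        {R \<in> block d m z. cube_set R \<subseteq> cube_set Q} \<inter> {R \<in> block d m z'. cube_set R \<subseteq> cube_set Q} = {}"
    proof (intro ballI impI)
      fix z z' assume "z \<in> grid d k" "z' \<in> grid d k" "z \<noteq> z'"
      then have "block d m z \<inter> block d m z' = {}"
        by (intro blocks_disjoint) (auto simp: in_grid_iff)
      then show "{R \<in> block d m z. cube_set R \<subseteq> cube_set Q} \<inter> {R \<in> block d m z'. cube_set R \<subseteq> cube_set Q} = {}"
        by auto
    qed
  qed auto
  also have "\<dots> \<le> 4 ^ d"
    by (rule order_trans[OF card_mono F]) (auto simp: finite_faces)
  finally have B: "(\<Sum>z\<in>grid d k. card {R\<in>block d m z. cube_set R \<subseteq> cube_set Q}) \<le> 4 ^ d" .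
  have B': "\<bar>\<Sum>z\<in>grid d k. increment h Q (block d m z) x\<bar> \<le> 2 * c * 4 ^ d"
  proof -
    have "\<bar>\<Sum>z\<in>grid d k. increment h Q (block d m z) x\<bar> \<le> (\<Sum>z\<in>grid d k. 2 * c * card {R\<in>block d m z. cube_set R \<subseteq> cube_set Q})"
      by (rule order_trans[OF sum_abs]) (intro sum_mono abs_increment_h_le finite_block)
    also have "\<dots> = 2 * c * real (\<Sum>z\<in>grid d k. card {R\<in>block d m z. cube_set R \<subseteq> cube_set Q})"
      by (simp add: sum_distrib_left)
    also have "\<dots> \<le> 2 * c * real (4 ^ d)"
      using B c_nonneg by (intro mult_left_mono of_nat_mono) auto
    finally show ?thesis by simp
  qed
  have W': "\<bar>increment h Q (window d n) x\<bar> \<le> 2 * c * 4 ^ d"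
  proof -
    have "\<bar>increment h Q (window d n) x\<bar> \<le> 2 * c * real (card {R\<in>window d n. cube_set R \<subseteq> cube_set Q})"
      by (rule abs_increment_h_le) simp
    also have "\<dots> \<le> 2 * c * real (4 ^ d)"
      using W c_nonneg by (intro mult_left_mono of_nat_mono) auto
    finally show ?thesis by simp
  qed
  show ?thesis
    using B' W' unfolding remainder_increment_def C_def by linarith
qed

lemma square_remainder_increment_le:
  assumes "Q \<in> cubes_all d"
  shows "(remainder_increment m k n Q x)\<^sup>2 \<le> C\<^sup>2"
  using power_mono[OF abs_remainder_increment_le[OF assms, of m k n x], of 2] by simp

text \<open>A cube of a cell is a coface of nothing in any other block. What is left compares the
  same increment in two nested windows, as stabilisation requires.\<close>

lemma remainder_increment_core:
  assumes z: "z \<in> grid d k" and Q: "Q \<in> core d m r z"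
  shows "remainder_increment m k n Q x = increment h Q (window d n) x - increment h Q (block d m z) x"
proof -
  have len: "length z = d" using z by (simp add: in_grid_iff)
  have Qc: "Q \<in> cell d m z" using core_subset_cell[OF len] Q by auto
  have QI: "Q \<in> cubes_all d" using cell_subset_cubes_all[OF len] Qc by auto
  have "increment h Q (block d m z') x = 0" if z': "z' \<in> grid d k - {z}" for z'
  proof -
    have len': "length z' = d" using z' by (simp add: in_grid_iff)
    have "{R\<in>block d m z'. cube_set R \<subseteq> cube_set Q} = {}"
      using coface_in_cell[OF len' _ QI] cells_disjoint[OF len len' Qc] z' by auto
    then have "card {R\<in>block d m z'. cube_set R \<subseteq> cube_set Q} = 0"
      by (simp only: card.empty)
    then show ?thesis using abs_increment_h_le[of "block d m z'" Q x] by (simp del: card_0_eq)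
  qed
  then have "(\<Sum>z'\<in>grid d k. increment h Q (block d m z') x) = increment h Q (block d m z) x"
    using z by (subst sum.remove[of _ z]) auto
  then show ?thesis by (simp add: remainder_increment_def)
qed

definition stabilised :: "nat \<Rightarrow> real \<Rightarrow> bool" where
  "stabilised r e \<longleftrightarrow> (\<forall>Q\<in>cubes_all d. \<forall>A B. finite B \<longrightarrow> B \<subseteq> cubes_all d \<longrightarrow> ball_at d r Q \<subseteq> A \<longrightarrow> A \<subseteq> B \<longrightarrow>
    D.expectation (\<lambda>x. \<bar>increment h Q A x - increment h Q B x\<bar>) \<le> e)"

lemma exists_stabilised:
  assumes "e > 0"
  shows "\<exists>r. stabilised r e"
proof -
  obtain r1 where r1: "\<forall>Q\<in>cubes_all d. \<forall>A B. finite B \<longrightarrow> B \<subseteq> cubes_all d \<longrightarrow> ball_at d r1 Q \<subseteq> A \<longrightarrow> A \<subseteq> B \<longrightarrow>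
    D.expectation (\<lambda>x. \<bar>increment h1 Q A x - increment h1 Q B x\<bar>) \<le> e / 2"
    using increment_stabilises[OF submod1 shift1, of "e/2"] assms by auto
  obtain r2 where r2: "\<forall>Q\<in>cubes_all d. \<forall>A B. finite B \<longrightarrow> B \<subseteq> cubes_all d \<longrightarrow> ball_at d r2 Q \<subseteq> A \<longrightarrow> A \<subseteq> B \<longrightarrow>
    D.expectation (\<lambda>x. \<bar>increment h2 Q A x - increment h2 Q B x\<bar>) \<le> e / 2"
    using increment_stabilises[OF submod2 shift2, of "e/2"] assms by auto
  have "D.expectation (\<lambda>x. \<bar>increment h Q A x - increment h Q B x\<bar>) \<le> e"
    if Q: "Q \<in> cubes_all d" and B: "finite B" "B \<subseteq> cubes_all d" and AB: "ball_at d (max r1 r2) Q \<subseteq> A" "A \<subseteq> B" for Q A B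
  proof -
    have A: "finite A" using B AB by (metis finite_subset)
    have len: "length Q = d" using Q by (simp add: cubes_all_def)
    have sub: "ball_at d r1 Q \<subseteq> A" "ball_at d r2 Q \<subseteq> A"
      using AB(1) ball_at_mono[OF len, of r1 "max r1 r2"] ball_at_mono[OF len, of r2 "max r1 r2"] by auto
    have "D.expectation (\<lambda>x. \<bar>increment h Q A x - increment h Q B x\<bar>)
        \<le> D.expectation (\<lambda>x. \<bar>increment h1 Q A x - increment h1 Q B x\<bar> + \<bar>increment h2 Q A x - increment h2 Q B x\<bar>)"
      using A B
      by (intro integral_mono Bochner_Integration.integrable_add integrable_abs Bochner_Integration.integrable_diff integrable_increment)
         (auto simp: increment_h)
    also have "\<dots> = D.expectation (\<lambda>x. \<bar>increment h1 Q A x - increment h1 Q B x\<bar>) + D.expectation (\<lambda>x. \<bar>increment h2 Q A x - increment h2 Q B x\<bar>)"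
      using A B by (intro Bochner_Integration.integral_add integrable_abs Bochner_Integration.integrable_diff integrable_increment)
    also have "\<dots> \<le> e / 2 + e / 2"
      using r1 r2 Q B AB(2) sub by (intro add_mono) blast+
    finally show ?thesis by simp
  qed
  then show ?thesis
    unfolding stabilised_def by (intro exI[of _ "max r1 r2"]) blast
qed

text \<open>The uniform bound \<open>C\<close> converts the L1 estimate from stabilisation into a
  mean square estimate.\<close>

lemma expectation_remainder_increment_core:
  assumes z: "z \<in> grid d k" and Q: "Q \<in> core d m r z" and "r < m" "k * (2 * m + 2) + m \<le> n" and st: "stabilised r e"
  shows "D.expectation (\<lambda>x. (remainder_increment m k n Q x)\<^sup>2) \<le> C * e"
proof -
  have len: "length z = d" using z by (simp add: in_grid_iff)
  have QI: "Q \<in> cubes_all d"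
    using core_subset_cell[OF len] cell_subset_cubes_all[OF len] Q by blast
  have int: "integrable (doubled (cubes_all d) \<mu>) (\<lambda>x. \<bar>remainder_increment m k n Q x\<bar>)"
    by (rule D.integrable_const_bound[of _ C]) (auto simp: abs_remainder_increment_le[OF QI])
  have "D.expectation (\<lambda>x. (remainder_increment m k n Q x)\<^sup>2) \<le> D.expectation (\<lambda>x. C * \<bar>remainder_increment m k n Q x\<bar>)"
  proof (rule integral_mono)
    fix x
    have "\<bar>remainder_increment m k n Q x\<bar> * \<bar>remainder_increment m k n Q x\<bar> \<le> C * \<bar>remainder_increment m k n Q x\<bar>"
      using abs_remainder_increment_le[OF QI] by (intro mult_right_mono) auto
    then show "(remainder_increment m k n Q x)\<^sup>2 \<le> C * \<bar>remainder_increment m k n Q x\<bar>"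
      by (simp add: power2_eq_square)
  next
    show "integrable (doubled (cubes_all d) \<mu>) (\<lambda>x. (remainder_increment m k n Q x)\<^sup>2)"
      by (rule D.integrable_const_bound[of _ "C\<^sup>2"])
         (auto intro!: AE_I2 square_remainder_increment_le[OF QI])
  qed (use int in simp)
  also have "\<dots> = C * D.expectation (\<lambda>x. \<bar>remainder_increment m k n Q x\<bar>)" by simp
  also have "(\<lambda>x. \<bar>remainder_increment m k n Q x\<bar>) = (\<lambda>x. \<bar>increment h Q (block d m z) x - increment h Q (window d n) x\<bar>)"
    unfolding remainder_increment_core[OF z Q] by (simp add: abs_minus_commute)
  also have "D.expectation \<dots> \<le> e"
    using st QI block_subset_window[OF z assms(4)] ball_at_core_subset_block[OF len Q assms(3)]
      window_subset_cubes_all[of d n]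
    unfolding stabilised_def by simp
  finally show ?thesis using C_nonneg by (simp add: mult_left_mono)
qed

text \<open>The coordinates read by the window lie in a box of \<open>(4 * n + 4) ^ d\<close> cubes.
  Those in a core contribute at most \<open>C * e\<close> each, all others at most the square of
  \<open>C\<close>; the subtracted product counts the core cubes.\<close>

lemma variance_remainder_le:
  assumes "r < m" "k * (2 * m + 2) + m \<le> n" and st: "stabilised r e" and "e > 0"
  shows "P.variance (remainder m k n)
    \<le> (real ((4 * n + 4) ^ d) * (C * e) + (real ((4 * n + 4) ^ d) - real ((2 * k + 1) ^ d) * real ((2 * (2 * (m - r) - 1)) ^ d)) * C\<^sup>2) / 2"
proof -
  let ?J = "cube_box d (- int n - 1) (int n)"
  let ?E = "\<lambda>Q. D.expectation (\<lambda>x. (remainder_increment m k n Q x)\<^sup>2)"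
  define U where "U = (\<Union>z\<in>grid d k. core d m r z)"
  have len: "length z = d" if "z \<in> grid d k" for z using that by (simp add: in_grid_iff)
  have JI: "?J \<subseteq> cubes_all d" by (rule box_subset_cubes_all)
  have UJ: "U \<subseteq> ?J" unfolding U_def using core_subset_box[OF _ assms(2)] by blast
  have fin: "finite U" using UJ by (rule finite_subset) simp
  have cardU: "card U = (2 * k + 1) ^ d * (2 * (2 * (m - r) - 1)) ^ d"
  proof -
    have "card U = (\<Sum>z\<in>grid d k. card (core d m r z))"
      unfolding U_def
    proof (rule card_UN_disjoint)
      show "\<forall>z\<in>grid d k. \<forall>z'\<in>grid d k. z \<noteq> z' \<longrightarrow> core d m r z \<inter> core d m r z' = {}"
      proof (intro ballI impI)
        fix z z' assume zz: "z \<in> grid d k" "z' \<in> grid d k" "z \<noteq> z'"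
        show "core d m r z \<inter> core d m r z' = {}"
          using core_subset_cell[OF len[OF zz(1)], of m r] core_subset_cell[OF len[OF zz(2)], of m r]
            cells_disjoint[OF len[OF zz(1)] len[OF zz(2)], of _ m] zz(3) by blast
      qed
    qed (auto simp: core_def)
    also have "\<dots> = card (grid d k) * (2 * (2 * (m - r) - 1)) ^ d"
      using card_core[OF len assms(1)] by simp
    finally show ?thesis by (simp add: card_grid)
  qed
  have cardJ: "card ?J = (4 * n + 4) ^ d"
  proof -
    have "2 * nat (int n - (- int n - 1) + 1) = 4 * n + 4" by simp
    then show ?thesis unfolding card_box by metis
  qed
  have bound: "\<bar>remainder m k n \<omega>\<bar> \<le> (\<Sum>S\<in>Pow (window d n). \<bar>h S\<bar>) + (\<Sum>z\<in>grid d k. \<Sum>S\<in>Pow (block d m z). \<bar>h S\<bar>)" for \<omega>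
  proof -
    have "\<bar>\<Sum>z\<in>grid d k. level_integral d h (block d m z) \<omega>\<bar> \<le> (\<Sum>z\<in>grid d k. \<Sum>S\<in>Pow (block d m z). \<bar>h S\<bar>)"
      by (rule order_trans[OF sum_abs]) (intro sum_mono abs_level_integral_le finite_block)
    moreover have "\<bar>level_integral d h (window d n) \<omega>\<bar> \<le> (\<Sum>S\<in>Pow (window d n). \<bar>h S\<bar>)"
      by (intro abs_level_integral_le finite_window)
    ultimately show ?thesis unfolding remainder_def by linarith
  qed
  have "P.variance (remainder m k n) \<le> (\<Sum>Q\<in>?J. D.expectation (\<lambda>x. (remainder m k n (pick (cubes_all d) {} x) - remainder m k n (pick (cubes_all d) {Q} x))\<^sup>2)) / 2"
  proof (rule efron_stein[OF measurable_remainder bound _ JI])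
    fix \<omega> \<omega>' :: "cube \<Rightarrow> real" assume eq: "\<And>i. i \<in> ?J \<Longrightarrow> \<omega> i = \<omega>' i"
    have W: "level_integral d h (window d n) \<omega> = level_integral d h (window d n) \<omega>'"
      using eq coface_window_in_box by (intro level_integral_cong) blast
    have "level_integral d h (block d m z) \<omega> = level_integral d h (block d m z) \<omega>'" if "z \<in> grid d k" for z
      using eq coface_window_in_box block_subset_window[OF that assms(2)] by (intro level_integral_cong) blast
    with W show "remainder m k n \<omega> = remainder m k n \<omega>'"
      unfolding remainder_def by simp
  qed simp
  also have "\<dots> = (\<Sum>Q\<in>?J. ?E Q) / 2"
    unfolding remainder_increment_eq ..
  also have "(\<Sum>Q\<in>?J. ?E Q) = (\<Sum>Q\<in>?J - U. ?E Q) + (\<Sum>Q\<in>U. ?E Q)"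
    by (rule sum.subset_diff[OF UJ]) simp
  also have "\<dots> \<le> real (card (?J - U)) * C\<^sup>2 + real (card U) * (C * e)"
  proof (rule add_mono)
    have "?E Q \<le> C\<^sup>2" if "Q \<in> ?J - U" for Q
    proof -
      have QI: "Q \<in> cubes_all d" using that JI by blast
      have "?E Q \<le> D.expectation (\<lambda>x. C\<^sup>2)"
      proof (rule integral_mono)
        show le: "(remainder_increment m k n Q x)\<^sup>2 \<le> C\<^sup>2" for x
          by (rule square_remainder_increment_le[OF QI])
        show "integrable (doubled (cubes_all d) \<mu>) (\<lambda>x. (remainder_increment m k n Q x)\<^sup>2)"
          by (rule D.integrable_const_bound[of _ "C\<^sup>2"]) (auto intro!: AE_I2 le)
      qed simp
      then show ?thesis by (simp add: D.prob_space)
    qed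
    then show "(\<Sum>Q\<in>?J - U. ?E Q) \<le> real (card (?J - U)) * C\<^sup>2"
      by (rule sum_bounded_above)
    have "?E Q \<le> C * e" if "Q \<in> U" for Q
      using that expectation_remainder_increment_core[OF _ _ assms(1,2) st] by (auto simp: U_def)
    then show "(\<Sum>Q\<in>U. ?E Q) \<le> real (card U) * (C * e)"
      by (rule sum_bounded_above)
  qed
  also have "real (card (?J - U)) = real (card ?J) - real (card U)"
    using card_mono[OF _ UJ] by (simp add: card_Diff_subset[OF fin UJ] of_nat_diff)
  \<comment> \<open>Only in the term with the small factor \<open>e\<close> is \<open>card U\<close>
    enlarged. In the other term the exact difference matters, as it must become a small proportion
    of the volume.\<close>
  also have "(real (card ?J) - real (card U)) * C\<^sup>2 + real (card U) * (C * e)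
      \<le> (real (card ?J) - real (card U)) * C\<^sup>2 + real (card ?J) * (C * e)"
    using card_mono[OF _ UJ] C_nonneg \<open>e > 0\<close> by (intro add_left_mono mult_right_mono) auto
  finally show ?thesis
    unfolding cardU cardJ by (simp add: add.commute divide_right_mono)
qed

end

section \<open>The central limit theorem\<close>

text \<open>The largest grid radius whose outermost blocks, of half-width \<open>m\<close>, stay in
  the window. For \<open>n < m\<close> it is 0 although not even one block fits.\<close>

definition block_range :: "nat \<Rightarrow> nat \<Rightarrow> nat" where
  "block_range m n = (n - m) div (2 * m + 2)"

lemma block_range_fits: "m \<le> n \<Longrightarrow> block_range m n * (2 * m + 2) + m \<le> n"
  using div_times_less_eq_dividend[of "n - m" "2 * m + 2"] unfolding block_range_def by linarith

lemma block_range_ratio: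
  "(\<lambda>n. real (2 * block_range m n + 1) / (2 * real n)) \<longlonglongrightarrow> 1 / (2 * real m + 2)"
proof (rule real_tendsto_sandwich)
  let ?s = "2 * real m + 2"
  have s: "?s > 0" by linarith
  have bounds: "(real n - real m) / ?s - 1 \<le> real (block_range m n)" "real (block_range m n) \<le> (real n - real m) / ?s"
    if "m \<le> n" for n
  proof -
    have "real (n - m) = real (block_range m n * (2 * m + 2) + (n - m) mod (2 * m + 2))"
      unfolding block_range_def by (simp only: div_mult_mod_eq)
    then have eq: "real n - real m = real (block_range m n) * ?s + real ((n - m) mod (2 * m + 2))"
      using that by (simp add: algebra_simps)
    have "(n - m) mod (2 * m + 2) < 2 * m + 2" by simp
    then have "real ((n - m) mod (2 * m + 2)) \<le> ?s" by linarith
    with eq s show "(real n - real m) / ?s - 1 \<le> real (block_range m n)" "real (block_range m n) \<le> (real n - real m) / ?s"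
      by (simp_all add: field_simps)
  qed
  show "\<forall>\<^sub>F n in sequentially. (2 * ((real n - real m) / ?s - 1) + 1) / (2 * real n) \<le> real (2 * block_range m n + 1) / (2 * real n)"
    using eventually_ge_at_top[of m]
  proof eventually_elim
    case (elim n)
    show ?case
      using bounds(1)[OF elim] unfolding of_nat_add of_nat_mult of_nat_numeral of_nat_1
      by (intro divide_right_mono add_mono mult_left_mono order_refl) auto
  qed
  show "\<forall>\<^sub>F n in sequentially. real (2 * block_range m n + 1) / (2 * real n) \<le> (2 * ((real n - real m) / ?s) + 1) / (2 * real n)"
    using eventually_ge_at_top[of m]
  proof eventually_elim
    case (elim n)
    show ?case
      using bounds(2)[OF elim] unfolding of_nat_add of_nat_mult of_nat_numeral of_nat_1
      by (intro divide_right_mono add_mono mult_left_mono order_refl) auto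
  qed
  have inv: "(\<lambda>n. a / real n) \<longlonglongrightarrow> 0" for a :: real
    by (rule lim_const_over_n)
  have lim: "(\<lambda>n. 1 / ?s + a / real n) \<longlonglongrightarrow> 1 / ?s" for a
    using tendsto_add[OF tendsto_const inv] by simp
  have alg: "1 / u + (- b / u - 1 / 2) / x = (2 * ((x - b) / u - 1) + 1) / (2 * x)"
    "1 / u + (- b / u + 1 / 2) / x = (2 * ((x - b) / u) + 1) / (2 * x)" if "x > 0" "u > 0" for u x b :: real
    using that by (simp_all add: field_simps)
  have "\<forall>\<^sub>F n in sequentially. 1 / ?s + (- real m / ?s - 1 / 2) / real n = (2 * ((real n - real m) / ?s - 1) + 1) / (2 * real n)"
    using eventually_gt_at_top[of 0] by eventually_elim (intro alg s, simp)
  from Lim_transform_eventually[OF lim this]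
  show "(\<lambda>n. (2 * ((real n - real m) / ?s - 1) + 1) / (2 * real n)) \<longlonglongrightarrow> 1 / ?s" .
  have "\<forall>\<^sub>F n in sequentially. 1 / ?s + (- real m / ?s + 1 / 2) / real n = (2 * ((real n - real m) / ?s) + 1) / (2 * real n)"
    using eventually_gt_at_top[of 0] by eventually_elim (intro alg s, simp)
  from Lim_transform_eventually[OF lim this]
  show "(\<lambda>n. (2 * ((real n - real m) / ?s) + 1) / (2 * real n)) \<longlonglongrightarrow> 1 / ?s" .
qed

lemma card_grid_ratio:
  "(\<lambda>n. real (card (grid d (block_range m n))) / (2 * real n) ^ d) \<longlonglongrightarrow> (1 / (2 * real m + 2)) ^ d"
proof -
  have eq: "real (card (grid d (block_range m n))) / (2 * real n) ^ d = (real (2 * block_range m n + 1) / (2 * real n)) ^ d" for n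
    unfolding card_grid power_divide of_nat_power ..
  show ?thesis unfolding eq by (intro tendsto_power block_range_ratio)
qed

text \<open>The limit is not 1 because every direction of a cube has two types.\<close>

lemma card_box_ratio: "(\<lambda>n. real ((4 * n + 4) ^ d) / (2 * real n) ^ d) \<longlonglongrightarrow> 2 ^ d"
proof -
  have "(\<lambda>n. 2 + 2 / real n) \<longlonglongrightarrow> 2 + 0"
    by (intro tendsto_add tendsto_const lim_const_over_n)
  moreover have "\<forall>\<^sub>F n in sequentially. 2 + 2 / real n = real (4 * n + 4) / (2 * real n)"
    using eventually_gt_at_top[of 0] by eventually_elim (simp add: field_simps)
  ultimately have "(\<lambda>n. real (4 * n + 4) / (2 * real n)) \<longlonglongrightarrow> 2"
    using Lim_transform_eventually by fastforce
  then have "(\<lambda>n. (real (4 * n + 4) / (2 * real n)) ^ d) \<longlonglongrightarrow> 2 ^ d"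
    by (rule tendsto_power)
  then show ?thesis by (simp only: power_divide of_nat_power)
qed

text \<open>This is the proportion of a cell outside its core; the factors \<open>2 ^ d\<close> for
  the types of cubes cancel.\<close>

lemma core_fraction_tendsto:
  "(\<lambda>m. 1 - (1 / (2 * real m + 2)) ^ d * real ((2 * (m - r) - 1) ^ d)) \<longlonglongrightarrow> 0"
proof -
  \<comment> \<open>The side of the cell minus that of the core:
    \<open>(2 * m + 2) - (2 * (m - r) - 1)\<close> for \<open>r < m\<close>.\<close>
  let ?a = "real (2 * r + 3)"
  have "(\<lambda>m. 1 - ?a / real (2 * m + 2)) \<longlonglongrightarrow> 1 - 0"
  proof (intro tendsto_diff tendsto_const)
    have "filterlim (\<lambda>m. real (2 * m + 2)) at_top sequentially"
      by (rule filterlim_at_top_mono[OF filterlim_real_sequentially]) auto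
    then show "(\<lambda>m. ?a / real (2 * m + 2)) \<longlonglongrightarrow> 0"
      by (rule real_tendsto_divide_at_top[OF tendsto_const])
  qed
  moreover have "\<forall>\<^sub>F m in sequentially. 1 - ?a / real (2 * m + 2) = (1 / (2 * real m + 2)) * real (2 * (m - r) - 1)"
    using eventually_gt_at_top[of r]
  proof eventually_elim
    case (elim m)
    then have "real (2 * (m - r) - 1) = 2 * real m - 2 * real r - 1"
      by (simp add: of_nat_diff)
    moreover have "2 * real m + 2 > 0" by linarith
    ultimately show ?case by (simp add: field_simps)
  qed
  ultimately have "(\<lambda>m. (1 / (2 * real m + 2)) * real (2 * (m - r) - 1)) \<longlonglongrightarrow> 1"
    using Lim_transform_eventually by fastforce
  from tendsto_power[OF this, of d] have "(\<lambda>m. (1 / (2 * real m + 2)) ^ d * real ((2 * (m - r) - 1) ^ d)) \<longlonglongrightarrow> 1"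
    by (simp only: power_mult_distrib of_nat_power power_one)
  from tendsto_diff[OF tendsto_const[of 1] this] show ?thesis by simp
qed

context stable_functional
begin

definition L :: "nat \<Rightarrow> (cube \<Rightarrow> real) \<Rightarrow> real" where
  "L n = level_integral d h (window d n)"

lemma measurable_L[measurable]: "L n \<in> borel_measurable (PiM (cubes_all d) \<mu>)"
  unfolding L_def by measurable

lemma integrable_level_integral: "finite A \<Longrightarrow> integrable (PiM (cubes_all d) \<mu>) (level_integral d h A)"
  by (rule P.integrable_const_bound[of _ "\<Sum>S\<in>Pow A. \<bar>h S\<bar>"]) (auto intro!: AE_I2 abs_level_integral_le)

text \<open>The order of choices matters: \<epsilon> fixes the stabilisation radius
  \<open>r\<close>, then \<open>m\<close> is taken so large that the cores nearly fill the cells,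
  and only then does \<open>n\<close> grow.\<close>

lemma variance_remainder_small:
  assumes "e > 0" "d > 0"
  shows "\<exists>m. \<forall>\<^sub>F n in sequentially. P.variance (remainder m (block_range m n) n) / (2 * real n) ^ d \<le> e"
proof -
  \<comment> \<open>Makes \<open>2 ^ d * (C * \<epsilon>)\<close> at most \<open>e / 4\<close>;
    \<open>C + 1\<close> avoids division by zero when \<open>C\<close> is 0.\<close>
  define \<epsilon> where "\<epsilon> = e / (4 * 2 ^ d * (C + 1))"
  have "C + 1 > 0" using C_nonneg by simp
  then have \<epsilon>: "\<epsilon> > 0" unfolding \<epsilon>_def using assms(1) by simp
  obtain r where r: "stabilised r \<epsilon>" using exists_stabilised[OF \<epsilon>] by auto
  define \<delta> where "\<delta> m = 1 - (1 / (2 * real m + 2)) ^ d * real ((2 * (m - r) - 1) ^ d)" for m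
  have "\<delta> \<longlonglongrightarrow> 0" unfolding \<delta>_def by (rule core_fraction_tendsto)
  then have "(\<lambda>m. 2 ^ d * \<delta> m * C\<^sup>2) \<longlonglongrightarrow> 2 ^ d * 0 * C\<^sup>2" by (intro tendsto_intros)
  then have "\<forall>\<^sub>F m in sequentially. 2 ^ d * \<delta> m * C\<^sup>2 < e"
    using assms(1) by (intro order_tendstoD(2)[where y = "2 ^ d * 0 * C\<^sup>2"]) auto
  then have "\<forall>\<^sub>F m in sequentially. 2 ^ d * \<delta> m * C\<^sup>2 < e \<and> r < m"
    using eventually_gt_at_top[of r] by eventually_elim simp
  then obtain m where m: "2 ^ d * \<delta> m * C\<^sup>2 < e" "r < m"
    by (auto simp: eventually_sequentially)
  let ?k = "block_range m"
  let ?a = "\<lambda>n. real ((4 * n + 4) ^ d) / (2 * real n) ^ d"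
  let ?b = "\<lambda>n. real (card (grid d (?k n))) / (2 * real n) ^ d"
  let ?w = "real ((2 * (2 * (m - r) - 1)) ^ d)"
  have lim: "(\<lambda>n. (?a n * (C * \<epsilon>) + (?a n - ?b n * ?w) * C\<^sup>2) / 2)
      \<longlonglongrightarrow> (2 ^ d * (C * \<epsilon>) + (2 ^ d - (1 / (2 * real m + 2)) ^ d * ?w) * C\<^sup>2) / 2"
    by (intro tendsto_intros card_box_ratio card_grid_ratio) auto
  have "?w = 2 ^ d * real ((2 * (m - r) - 1) ^ d)" by (simp add: power_mult_distrib)
  then have "2 ^ d - (1 / (2 * real m + 2)) ^ d * ?w = 2 ^ d * \<delta> m"
    by (simp add: \<delta>_def right_diff_distrib)
  moreover have "2 ^ d * (C * \<epsilon>) < e"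
  proof -
    have "2 ^ d * (C * \<epsilon>) \<le> 2 ^ d * ((C + 1) * \<epsilon>)"
      using \<epsilon> by (intro mult_left_mono mult_right_mono) auto
    also have "\<dots> = e / 4" using \<open>C + 1 > 0\<close> by (simp add: \<epsilon>_def)
    finally show ?thesis using assms(1) by simp
  qed
  ultimately have "(2 ^ d * (C * \<epsilon>) + (2 ^ d - (1 / (2 * real m + 2)) ^ d * ?w) * C\<^sup>2) / 2 < e"
    using m(1) by simp
  from order_tendstoD(2)[OF lim this]
  have "\<forall>\<^sub>F n in sequentially. (?a n * (C * \<epsilon>) + (?a n - ?b n * ?w) * C\<^sup>2) / 2 < e" .
  then have "\<forall>\<^sub>F n in sequentially. P.variance (remainder m (?k n) n) / (2 * real n) ^ d \<le> e"
    using eventually_ge_at_top[of m]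
  proof eventually_elim
    case (elim n)
    have "P.variance (remainder m (?k n) n) \<le>
        (real ((4 * n + 4) ^ d) * (C * \<epsilon>) + (real ((4 * n + 4) ^ d) - real ((2 * ?k n + 1) ^ d) * ?w) * C\<^sup>2) / 2"
      by (rule variance_remainder_le[OF m(2) block_range_fits[OF elim(2)] r \<epsilon>])
    then have "P.variance (remainder m (?k n) n) / (2 * real n) ^ d \<le>
        (real ((4 * n + 4) ^ d) * (C * \<epsilon>) + (real ((4 * n + 4) ^ d) - real (card (grid d (?k n))) * ?w) * C\<^sup>2) / 2 / (2 * real n) ^ d"
      unfolding card_grid by (rule divide_right_mono) simp
    also have "\<dots> = (?a n * (C * \<epsilon>) + (?a n - ?b n * ?w) * C\<^sup>2) / 2"
    proof -
      have "(A * p + (A - B * w) * u) / 2 / x = (A / x * p + (A / x - B / x * w) * u) / 2" for A B p w u x :: real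
        by (simp add: add_divide_distrib diff_divide_distrib algebra_simps)
      then show ?thesis .
    qed
    finally show ?case using elim(1) by linarith
  qed
  then show ?thesis ..
qed

theorem central_limit:
  assumes "d > 0"
  shows "\<exists>\<tau>2\<ge>0. (\<lambda>n. P.variance (L n) / (2 * real n) ^ d) \<longlonglongrightarrow> \<tau>2 \<and>
    weak_conv_m (\<lambda>n. distr (PiM (cubes_all d) \<mu>) borel (\<lambda>\<omega>. (L n \<omega> - P.expectation (L n)) / sqrt ((2 * real n) ^ d)))
      (normal_law \<tau>2)"
proof -
  let ?\<Omega> = "PiM (cubes_all d) \<mu>"
  define s where "s n = 1 / sqrt ((2 * real n) ^ d)" for n
  define Y where "Y n \<omega> = (L n \<omega> - P.expectation (L n)) / sqrt ((2 * real n) ^ d)" for n \<omega>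
  have s2: "(s n)\<^sup>2 = 1 / (2 * real n) ^ d" for n
    by (simp add: s_def power_divide)
  \<comment> \<open>Positivity of \<open>d\<close> enters here: in dimension 0 the volume would stay
    1.\<close>
  have s_lim: "s \<longlonglongrightarrow> 0"
  proof -
    have "filterlim (\<lambda>n. sqrt ((2 * real n) ^ d)) at_top sequentially"
      using assms
      by (intro filterlim_compose[OF sqrt_at_top] filterlim_pow_at_top
          filterlim_tendsto_pos_mult_at_top[OF tendsto_const] filterlim_real_sequentially) auto
    then show ?thesis unfolding s_def by (rule real_tendsto_divide_at_top[OF tendsto_const])
  qed
  have Y_eq: "Y n \<omega> = s n * (L n \<omega> - P.expectation (L n))" for n \<omega>
    by (simp add: Y_def s_def)
  have Y2: "P.expectation (\<lambda>\<omega>. (Y n \<omega>)\<^sup>2) = P.variance (L n) / (2 * real n) ^ d" for n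
    unfolding Y_eq power_mult_distrib s2 by simp
  have Ymeas[measurable]: "Y n \<in> borel_measurable ?\<Omega>" for n unfolding Y_def by measurable
  have centred_bound: "\<bar>level_integral d h A \<omega> - a\<bar> \<le> (\<Sum>S\<in>Pow A. \<bar>h S\<bar>) + \<bar>a\<bar>" if "finite A" for A \<omega> a
    using abs_level_integral_le[OF that, of d h \<omega>] by linarith
  have Yint: "integrable ?\<Omega> (\<lambda>\<omega>. (Y n \<omega>)\<^sup>2)" for n
  proof -
    have "\<bar>Y n \<omega>\<bar> \<le> \<bar>s n\<bar> * ((\<Sum>S\<in>Pow (window d n). \<bar>h S\<bar>) + \<bar>P.expectation (L n)\<bar>)" for \<omega>
      unfolding Y_eq abs_mult L_def by (intro mult_left_mono centred_bound) auto
    from power_mono[OF this, of _ 2] show ?thesis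
      by (intro P.integrable_const_bound[of _ "(\<bar>s n\<bar> * ((\<Sum>S\<in>Pow (window d n). \<bar>h S\<bar>) + \<bar>P.expectation (L n)\<bar>))\<^sup>2"]) auto
  qed
  have "\<exists>\<tau>2\<ge>0. (\<lambda>n. P.expectation (\<lambda>\<omega>. (Y n \<omega>)\<^sup>2)) \<longlonglongrightarrow> \<tau>2 \<and> weak_conv_m (\<lambda>n. distr ?\<Omega> borel (Y n)) (normal_law \<tau>2)"
  proof (rule P.normal_limit_of_approximations[OF Ymeas Yint])
    fix e :: real assume "e > 0"
    then obtain m where m: "\<forall>\<^sub>F n in sequentially. P.variance (remainder m (block_range m n) n) / (2 * real n) ^ d \<le> e\<^sup>2"
      using variance_remainder_small[of "e\<^sup>2"] assms by auto
    let ?k = "block_range m"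
    define a where "a = P.expectation (L m)"
    define X where "X z \<omega> = level_integral d h (block d m z) \<omega> - a" for z \<omega>
    define v where "v = P.expectation (\<lambda>\<omega>. (L m \<omega> - a)\<^sup>2)"
    define S where "S n \<omega> = s n * (\<Sum>z\<in>grid d (?k n). X z \<omega>)" for n \<omega>
    have len: "length (center m z) = d" if "z \<in> grid d k" for z k using that by (simp add: in_grid_iff)
    have X_dist: "P.expectation (\<lambda>\<omega>. f (level_integral d h (block d m z) \<omega>)) = P.expectation (\<lambda>\<omega>. f (L m \<omega>))"
      if "z \<in> grid d k" "f \<in> borel_measurable borel" for f :: "real \<Rightarrow> real" and z k
      unfolding block_def L_def
      by (rule expectation_level_integral_shift[OF len[OF that(1)] shift_h finite_window window_subset_cubes_all that(2)])
    have X_exp: "P.expectation (level_integral d h (block d m z)) = a" if "z \<in> grid d k" for z k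
      using X_dist[OF that, of "\<lambda>x. x"] by (simp add: a_def)
    have X_mean: "P.expectation (X z) = 0" if "z \<in> grid d k" for z k
      using X_dist[OF that, of "\<lambda>x. x - a"] integrable_level_integral[of "window d m"]
      by (simp add: X_def[abs_def] a_def L_def P.prob_space)
    have X_var: "P.expectation (\<lambda>\<omega>. (X z \<omega>)\<^sup>2) = v" if "z \<in> grid d k" for z k
      using X_dist[OF that, of "\<lambda>x. (x - a)\<^sup>2"] by (simp add: X_def v_def)
    \<comment> \<open>Translating the block back to the window makes the bound independent of
      \<open>z\<close>, as the limit theorem for the block sums demands.\<close>
    have X_bound: "\<bar>X z \<omega>\<bar> \<le> (\<Sum>S\<in>Pow (window d m). \<bar>h S\<bar>) + \<bar>a\<bar>" if "z \<in> grid d k" for z k \<omega>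
    proof -
      let ?y = "center m z"
      have "shift_cube (map uminus ?y) ` block d m z = window d m"
      proof -
        have "shift_cube (map uminus ?y) ` block d m z = (\<lambda>R. R) ` window d m"
          unfolding block_def image_image
          by (intro image_cong refl shift_cube_uminus) (use len[OF that] in \<open>auto simp: window_def\<close>)
        then show ?thesis by simp
      qed
      then have "level_integral d h (block d m z) \<omega> = level_integral d h (window d m) (tau d (map uminus ?y) \<omega>)"
        using level_integral_tau[of "map uminus ?y" d h "block d m z" \<omega>] shift_h len[OF that]
          block_subset_cubes_all[of z d m] by simp
      then show ?thesis unfolding X_def using centred_bound[OF finite_window] by simp
    qed
    have X_indep: "P.indep_vars (\<lambda>_. borel) X (grid d k)" for k
      unfolding X_def[abs_def] by (rule indep_vars_blocks)
    have ratio: "(\<lambda>n. real (card (grid d (?k n))) * (s n)\<^sup>2) \<longlonglongrightarrow> (1 / (2 * real m + 2)) ^ d"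
      unfolding s2 using card_grid_ratio[of d m] by simp
    have Smeas[measurable]: "S n \<in> borel_measurable ?\<Omega>" for n
      unfolding S_def X_def by measurable
    have S2: "P.expectation (\<lambda>\<omega>. (S n \<omega>)\<^sup>2) = real (card (grid d (?k n))) * (s n)\<^sup>2 * v" for n
    proof -
      have "P.expectation (\<lambda>\<omega>. (\<Sum>z\<in>grid d (?k n). X z \<omega>)\<^sup>2) = (\<Sum>z\<in>grid d (?k n). P.expectation (\<lambda>\<omega>. (X z \<omega>)\<^sup>2))"
        by (rule P.expectation_square_indep_sum[OF finite_grid X_indep X_bound X_mean])
      also have "\<dots> = real (card (grid d (?k n))) * v"
        using X_var by simp
      finally show ?thesis unfolding S_def power_mult_distrib by simp
    qed
    have Sint: "integrable ?\<Omega> (\<lambda>\<omega>. (S n \<omega>)\<^sup>2)" for n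
    proof -
      define b where "b = \<bar>s n\<bar> * (\<Sum>z\<in>grid d (?k n). (\<Sum>S\<in>Pow (window d m). \<bar>h S\<bar>) + \<bar>a\<bar>)"
      have "\<bar>S n \<omega>\<bar> \<le> b" for \<omega>
        unfolding S_def abs_mult b_def
        by (intro mult_left_mono order_trans[OF sum_abs] sum_mono X_bound) auto
      from power_mono[OF this, of _ 2] show ?thesis
        by (intro P.integrable_const_bound[of _ "b\<^sup>2"]) auto
    qed
    \<comment> \<open>The approximation error is exactly the centred remainder times
      \<open>s n\<close>, so its mean square is the normalised variance already estimated.\<close>
    have close: "P.expectation (\<lambda>\<omega>. (Y n \<omega> - S n \<omega>)\<^sup>2) = P.variance (remainder m (?k n) n) / (2 * real n) ^ d" for n
    proof -
      have "P.expectation (remainder m (?k n) n) = P.expectation (L n) - (\<Sum>z\<in>grid d (?k n). a)"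
        unfolding remainder_def[abs_def] L_def using X_exp
        by (subst Bochner_Integration.integral_diff)
           (auto simp: Bochner_Integration.integral_sum integrable_level_integral)
      then have "Y n \<omega> - S n \<omega> = s n * (remainder m (?k n) n \<omega> - P.expectation (remainder m (?k n) n))" for \<omega>
        unfolding Y_eq S_def X_def remainder_def L_def by (simp add: sum_subtractf right_diff_distrib)
      then show ?thesis by (simp add: power_mult_distrib s2)
    qed
    have "v \<ge> 0" unfolding v_def by simp
    show "\<exists>v\<ge>0. \<exists>S. (\<forall>n. S n \<in> borel_measurable ?\<Omega> \<and> integrable ?\<Omega> (\<lambda>x. (S n x)\<^sup>2)) \<and>
        (\<lambda>n. P.expectation (\<lambda>x. (S n x)\<^sup>2)) \<longlonglongrightarrow> v \<and>
        (\<forall>t. (\<lambda>n. char (distr ?\<Omega> borel (S n)) t) \<longlonglongrightarrow> complex_of_real (exp (- (v * t\<^sup>2) / 2))) \<and>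
        (\<forall>\<^sub>F n in sequentially. P.expectation (\<lambda>x. (Y n x - S n x)\<^sup>2) \<le> e\<^sup>2)"
    proof (intro exI[of _ "(1 / (2 * real m + 2)) ^ d * v"] exI[of _ S] conjI allI)
      show "0 \<le> (1 / (2 * real m + 2)) ^ d * v" using \<open>v \<ge> 0\<close> by simp
      show "(\<lambda>n. P.expectation (\<lambda>x. (S n x)\<^sup>2)) \<longlonglongrightarrow> (1 / (2 * real m + 2)) ^ d * v"
        unfolding S2 by (intro tendsto_mult ratio tendsto_const)
      show "(\<lambda>n. char (distr ?\<Omega> borel (S n)) t) \<longlonglongrightarrow> complex_of_real (exp (- ((1 / (2 * real m + 2)) ^ d * v * t\<^sup>2) / 2))" for t
        unfolding S_def[abs_def]
        by (rule P.char_indep_sum_tendsto[OF X_indep X_bound X_mean X_var s_lim ratio])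
      show "\<forall>\<^sub>F n in sequentially. P.expectation (\<lambda>x. (Y n x - S n x)\<^sup>2) \<le> e\<^sup>2"
        unfolding close by (rule m)
    qed (auto intro: Sint)
  qed
  then show ?thesis unfolding Y2 unfolding Y_def[abs_def] .
qed

end

theorem theorem2p13:
  fixes d q :: nat and P :: "(cube \<Rightarrow> real) measure"
  assumes "q < d"
    and prod: "\<exists>\<mu>. (\<forall>Q\<in>cubes_all d. prob_space (\<mu> Q) \<and>
                  sets (\<mu> Q) = sets (restrict_space borel {0..1::real}))
              \<and> P = PiM (cubes_all d) \<mu>"
    and "prob_space P"
    and "sets P = sets (Omega d)"
    and stationary: "\<forall>x. length x = d \<longrightarrow> distr P P (tau d x) = P"
    and ergodic: "\<forall>A\<in>sets P. (\<forall>x. length x = d \<longrightarrow> tau d x -` A \<inter> space P = A)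
                     \<longrightarrow> measure P A = 0 \<or> measure P A = 1"
  shows "\<exists>\<tau>2\<ge>0.
     (\<lambda>n. (integral\<^sup>L P (\<lambda>\<omega>. (Lqn d q n \<omega> - integral\<^sup>L P (Lqn d q n))\<^sup>2))
            / (2 * real n) ^ d) \<longlonglongrightarrow> \<tau>2
   \<and> weak_conv_m
       (\<lambda>n. distr P borel (\<lambda>\<omega>. (Lqn d q n \<omega> - integral\<^sup>L P (Lqn d q n)) / sqrt ((2 * real n) ^ d)))
       (normal_law \<tau>2)"
proof -
  obtain \<mu> where \<mu>: "\<And>Q. Q \<in> cubes_all d \<Longrightarrow> prob_space (\<mu> Q)"
    "\<And>Q. Q \<in> cubes_all d \<Longrightarrow> sets (\<mu> Q) = sets (restrict_space borel {0..1::real})"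
    and P: "P = PiM (cubes_all d) \<mu>"
    using prod by auto
  \<comment> \<open>Stationarity is passed to the marginals: the coordinate of
    \<open>tau d x \<omega>\<close> at the translate of \<open>Q\<close> is
    \<open>\<omega> Q\<close>, so invariance of \<open>P\<close> gives both coordinates the same
    law.\<close>
  have shift: "\<mu> (shift_cube x Q) = \<mu> Q" if x: "length x = d" and Q: "Q \<in> cubes_all d" for x Q
  proof -
    let ?R = "shift_cube x Q"
    have R: "?R \<in> cubes_all d" using x Q by (rule shift_cube_in_cubes_all)
    have comp: "(\<lambda>\<omega>. \<omega> S) \<in> measurable P (\<mu> S)" if "S \<in> cubes_all d" for S
      unfolding P by (rule measurable_component_singleton[OF that])
    have sets: "sets (\<mu> ?R) = sets (\<mu> Q)" using \<mu>(2) R Q by simp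
    have tau: "tau d x \<in> measurable P P"
    proof -
      have "(\<lambda>\<omega>. \<omega> (shift_cube (map uminus x) S)) \<in> measurable P (\<mu> S)" if "S \<in> cubes_all d" for S
      proof -
        have S': "shift_cube (map uminus x) S \<in> cubes_all d"
          using that x by (simp add: shift_cube_in_cubes_all)
        show ?thesis
          using comp[OF S'] measurable_cong_sets[OF refl, of "\<mu> (shift_cube (map uminus x) S)" "\<mu> S" P] \<mu>(2)[OF S'] \<mu>(2)[OF that] by simp
      qed
      then show ?thesis
        unfolding tau_def[abs_def] by (subst (2) P) (rule measurable_restrict)
    qed
    have "\<mu> ?R = distr P (\<mu> ?R) (\<lambda>\<omega>. \<omega> ?R)"
      unfolding P by (rule distr_PiM_component[OF \<mu>(1) R, symmetric])
    also have "\<dots> = distr (distr P P (tau d x)) (\<mu> ?R) (\<lambda>\<omega>. \<omega> ?R)"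
      using stationary x by simp
    also have "\<dots> = distr P (\<mu> ?R) (\<lambda>\<omega>. tau d x \<omega> ?R)"
      by (subst distr_distr[OF comp[OF R] tau]) (simp add: comp_def)
    also have "\<dots> = distr P (\<mu> Q) (\<lambda>\<omega>. \<omega> Q)"
      using x Q R by (intro distr_cong sets refl) (simp add: tau_def shift_cube_uminus cubes_all_def)
    also have "\<dots> = \<mu> Q"
      unfolding P by (rule distr_PiM_component[OF \<mu>(1) Q])
    finally show ?thesis .
  qed
  define h1 where "h1 S = real (card {R\<in>S. cdim R = q})" for S
  define h2 where "h2 S = real (bd_rank q S) + real (bd_rank (Suc q) S)" for S
  \<comment> \<open>The constant 2 is forced by \<open>h2\<close>, a sum of two ranks with
    increments at most 1 each; the count \<open>h1\<close> is relaxed to the same constant.\<close>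
  interpret stable_functional d \<mu> h1 h2 2
  proof (intro stable_functional.intro cubical_field.intro stable_functional_axioms.intro)
    show "bounded_submodular 2 h1"
      unfolding h1_def[abs_def] by (rule bounded_submodular_mono_const[OF bounded_submodular_count]) simp
    show "bounded_submodular 2 h2"
      using bounded_submodular_add[OF bounded_submodular_bd_rank[of q] bounded_submodular_bd_rank[of "Suc q"]]
      by (simp add: h2_def[abs_def])
    show "shift_invariant d h1"
      unfolding shift_invariant_def h1_def
    proof (intro allI impI)
      fix x :: "int list" and S :: "cube set" assume x: "length x = d" and S: "finite S" "S \<subseteq> cubes_all d"
      have "{R \<in> shift_cube x ` S. cdim R = q} = shift_cube x ` {R\<in>S. cdim R = q}"
        using S x cdim_shift_cube[of _ x] by (auto simp: cubes_all_def subset_iff)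
      moreover have "inj_on (shift_cube x) {R\<in>S. cdim R = q}"
        using S x by (intro inj_on_subset[OF inj_on_shift_cube]) auto
      ultimately show "real (card {R \<in> shift_cube x ` S. cdim R = q}) = real (card {R\<in>S. cdim R = q})"
        by (simp add: card_image)
    qed
    show "shift_invariant d h2"
      unfolding shift_invariant_def h2_def by (simp add: bd_rank_shift)
    show "prob_space (\<mu> Q)" "sets (\<mu> Q) = sets (restrict_space borel {0..1})" if "Q \<in> cubes_all d" for Q
      by (rule \<mu>[OF that])+
    show "\<mu> (shift_cube x Q) = \<mu> Q" if "length x = d" "Q \<in> cubes_all d" for x Q
      by (rule shift[OF that])
  qed
  have "Lqn d q n = L n" for n
    by (rule ext) (simp add: Lqn_def L_def level_integral_def betti_n_eq h_def h1_def h2_def)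
  then show ?thesis
    using central_limit \<open>q < d\<close> unfolding P by simp
qed

end
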